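(* Let $1\le m<n$ be integers, $\Omega\subset\mathbb{C}^n$ an open set, and $T$ a current of bidimension $(p,p)$ on $\Omega$ with $m+p\geq n$. Assume that $T$ is $m$-positive and that $dd^cT\wedge\beta^{p-1}$ is a positive measure on $\Omega$. Then the Lelong number $$\nu_T(a)=\lim_{r\to0^+}\frac{1}{r^{\frac{2n}{m}(m+p-n)}}\int_{\mathbb{B}(a,r)}T\wedge\beta^{p}$$ exists at every point $a\in\Omega$.
   Context: Conventions: $d=\partial+\overline\partial$, $d^c=\frac{i}{4\pi}(\overline\partial-\partial)$, so $dd^c=\frac{i}{2\pi}\partial\overline\partial$; $\beta=dd^c|z|^2$; $\mathbb{B}(a,r)=\{z\in\mathbb{C}^n: |z-a|<r\}$. A $(1,1)$-form $\alpha$ on $\Omega$ is $m$-positive if $\alpha^j\wedge\beta^{n-j}\ge 0$ for every $1\le j\le m$. A $(q,q)$-form $\alpha$ is strongly $m$-positive if $\alpha=\sum_{k=1}^N a_k\,\alpha_{1,k}\wedge\dots\wedge\alpha_{q,k}$ with $N=\binom{n}{q}$, $a_k\ge0$ and all $\alpha_{j,k}$ $m$-positive $(1,1)$-forms. A current $T$ of bidimension $(p,p)$ on $\Omega$ with $m+p\ge n$ is $m$-positive if $\langle T\wedge\beta^{n-m},\alpha\rangle\ge0$ for every strongly $m$-positive $(m+p-n,m+p-n)$-test form $\alpha$ on $\Omega$. *)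

theory Defs
  imports "HOL-Analysis.Analysis"
begin

text \<open>
  The complexified exterior algebra of \<open>\<complex>\<^sup>n\<close>, with \<open>n = CARD('n)\<close>: the component with index
  \<open>(I, J)\<close> is the coefficient of \<open>dz\<^sub>I \<and> d\<bar>z\<^sub>J\<close>, where \<open>dz\<^sub>I\<close> and \<open>d\<bar>z\<^sub>J\<close> are taken in increasing order of
  the indices.  Only the signs depend on the linear order of the index type.
\<close>

type_synonym 'n ext = "complex ^ ('n set \<times> 'n set)"

type_synonym 'n cspace = "complex ^ 'n"

type_synonym 'n form_field = "'n cspace \<Rightarrow> 'n ext"

definition shuffle_sign :: "'n::linorder set \<Rightarrow> 'n set \<Rightarrow> complex" where
  "shuffle_sign I I' = (-1) ^ card {(i, i'). i \<in> I \<and> i' \<in> I' \<and> i' < i}"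

text \<open>
  The factor \<open>(-1) ^ (card J * card (K - I))\<close> comes from moving \<open>dz\<^bsub>K-I\<^esub>\<close> to the left
  past \<open>d\<bar>z\<^sub>J\<close>.
\<close>

definition wedge :: "'n::{finite,linorder} ext \<Rightarrow> 'n ext \<Rightarrow> 'n ext"  (infixl \<open>\<and>\<^sub>E\<close> 75) where
  "\<alpha> \<and>\<^sub>E \<omega> = (\<chi> KL. case KL of (K, L) \<Rightarrow>
     (\<Sum>I\<in>Pow K. \<Sum>J\<in>Pow L.
        (-1) ^ (card J * card (K - I)) * shuffle_sign I (K - I) * shuffle_sign J (L - J)
        * \<alpha> $ (I, J) * \<omega> $ (K - I, L - J)))"

definition ext_scalar :: "complex \<Rightarrow> 'n::{finite,linorder} ext" where
  "ext_scalar c = axis ({}, {}) c"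

definition dz :: "'n::{finite,linorder} \<Rightarrow> 'n ext" where
  "dz j = axis ({j}, {}) 1"

definition dzbar :: "'n::{finite,linorder} \<Rightarrow> 'n ext" where
  "dzbar j = axis ({}, {j}) 1"

definition wedge_list :: "'n::{finite,linorder} ext list \<Rightarrow> 'n ext" where
  "wedge_list \<omega>s = foldr (\<and>\<^sub>E) \<omega>s (ext_scalar 1)"

definition wedge_power :: "'n::{finite,linorder} ext \<Rightarrow> nat \<Rightarrow> 'n ext" where
  "wedge_power \<omega> k = wedge_list (replicate k \<omega>)"

definition bidegree :: "nat \<Rightarrow> nat \<Rightarrow> 'n::{finite,linorder} ext \<Rightarrow> bool" where
  "bidegree p q \<omega> \<longleftrightarrow> (\<forall>I J. \<omega> $ (I, J) \<noteq> 0 \<longrightarrow> card I = p \<and> card J = q)"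

text \<open>
  A form of bidegree \<open>(1,1)\<close> is real iff it is \<open>\<i> \<Sum> h\<^sub>j\<^sub>k dz\<^sub>j \<and> d\<bar>z\<^sub>k\<close> with \<open>h\<close> Hermitian.
\<close>

definition real_11 :: "'n::{finite,linorder} ext \<Rightarrow> bool" where
  "real_11 \<omega> \<longleftrightarrow> bidegree 1 1 \<omega> \<and> (\<forall>j k. \<omega> $ ({j}, {k}) = - cnj (\<omega> $ ({k}, {j})))"

definition orientation_form :: "'n::{finite,linorder} ext" where
  "orientation_form =
     wedge_list (map (\<lambda>j. \<i> *s (dz j \<and>\<^sub>E dzbar j)) (sorted_list_of_set UNIV))"

definition nonneg_top :: "'n::{finite,linorder} ext \<Rightarrow> bool" where
  "nonneg_top \<omega> \<longleftrightarrow> (\<exists>c::real. c \<ge> 0 \<and> \<omega> = complex_of_real c *s orientation_form)"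


subsection \<open>Differential operators\<close>

definition del_z :: "'n::{finite,linorder} \<Rightarrow> 'n form_field \<Rightarrow> 'n form_field" where
  "del_z j \<alpha> z = (1/2) *s (frechet_derivative \<alpha> (at z) (axis j 1)
                     - \<i> *s frechet_derivative \<alpha> (at z) (axis j \<i>))"

definition del_zbar :: "'n::{finite,linorder} \<Rightarrow> 'n form_field \<Rightarrow> 'n form_field" where
  "del_zbar j \<alpha> z = (1/2) *s (frechet_derivative \<alpha> (at z) (axis j 1)
                     + \<i> *s frechet_derivative \<alpha> (at z) (axis j \<i>))"

definition del :: "'n::{finite,linorder} form_field \<Rightarrow> 'n form_field" where
  "del \<alpha> z = (\<Sum>j\<in>UNIV. dz j \<and>\<^sub>E del_z j \<alpha> z)"

definition delbar :: "'n::{finite,linorder} form_field \<Rightarrow> 'n form_field" where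
  "delbar \<alpha> z = (\<Sum>j\<in>UNIV. dzbar j \<and>\<^sub>E del_zbar j \<alpha> z)"

definition ext_d :: "'n::{finite,linorder} form_field \<Rightarrow> 'n form_field" where
  "ext_d \<alpha> z = del \<alpha> z + delbar \<alpha> z"

definition ext_dc :: "'n::{finite,linorder} form_field \<Rightarrow> 'n form_field" where
  "ext_dc \<alpha> z = (\<i> / (4 * complex_of_real pi)) *s (delbar \<alpha> z - del \<alpha> z)"

definition ddc :: "'n::{finite,linorder} form_field \<Rightarrow> 'n form_field" where
  "ddc \<alpha> = ext_d (ext_dc \<alpha>)"

text \<open>Explicitly, \<open>beta z = \<i> / (2\<pi>) \<Sum> dz\<^sub>j \<and> d\<bar>z\<^sub>j\<close> for every \<open>z\<close>.\<close>

definition beta :: "'n::{finite,linorder} form_field" where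
  "beta = ddc (\<lambda>z. ext_scalar (complex_of_real ((norm z)\<^sup>2)))"

definition beta_power :: "nat \<Rightarrow> 'n::{finite,linorder} form_field" where
  "beta_power k z = wedge_power (beta z) k"


subsection \<open>Positivity of forms\<close>

text \<open>
  Both notions are pointwise: no regularity in \<open>z\<close> is imposed on \<open>\<alpha>\<close>, on the coefficients \<open>a k\<close>
  or on the factors \<open>A j k\<close>.
\<close>

definition m_positive_11 ::
    "'n cspace set \<Rightarrow> nat \<Rightarrow> 'n::{finite,linorder} form_field \<Rightarrow> bool" where
  "m_positive_11 \<Omega> m \<alpha> \<longleftrightarrow>
     (\<forall>z\<in>\<Omega>. real_11 (\<alpha> z) \<and>
        (\<forall>j\<in>{1..m}. nonneg_top (wedge_power (\<alpha> z) j \<and>\<^sub>E beta_power (CARD('n) - j) z)))"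

definition strongly_m_positive ::
    "'n cspace set \<Rightarrow> nat \<Rightarrow> nat \<Rightarrow> 'n::{finite,linorder} form_field \<Rightarrow> bool" where
  "strongly_m_positive \<Omega> m q \<alpha> \<longleftrightarrow>
     (\<exists>(a :: nat \<Rightarrow> 'n cspace \<Rightarrow> real) (A :: nat \<Rightarrow> nat \<Rightarrow> 'n form_field).
        (\<forall>k < CARD('n) choose q. \<forall>z\<in>\<Omega>. a k z \<ge> 0) \<and>
        (\<forall>k < CARD('n) choose q. \<forall>j<q. m_positive_11 \<Omega> m (A j k)) \<and>
        (\<forall>z\<in>\<Omega>. \<alpha> z = (\<Sum>k < CARD('n) choose q.
            complex_of_real (a k z) *s wedge_list (map (\<lambda>j. A j k z) [0..<q]))))"


subsection \<open>Test forms and currents\<close>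

primrec iterated_deriv ::
    "'a list \<Rightarrow> ('a::real_normed_vector \<Rightarrow> 'b::real_normed_vector) \<Rightarrow> 'a \<Rightarrow> 'b" where
  "iterated_deriv [] f = f"
| "iterated_deriv (v # vs) f = (\<lambda>x. frechet_derivative (iterated_deriv vs f) (at x) v)"

text \<open>
  Differentiability of all iterated directional derivatives implies their continuity, so on a
  finite-dimensional space this is \<open>C\<^sup>\<infinity>\<close>.
\<close>

definition smooth :: "('a::real_normed_vector \<Rightarrow> 'b::real_normed_vector) \<Rightarrow> bool" where
  "smooth f \<longleftrightarrow> (\<forall>vs x. iterated_deriv vs f differentiable at x)"

text \<open>Test forms on \<open>\<Omega>\<close> are extended by zero to the whole space.\<close>

definition test_forms :: "'n cspace set \<Rightarrow> nat \<Rightarrow> nat \<Rightarrow> 'n::{finite,linorder} form_field set" where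
  "test_forms \<Omega> p q =
     {\<alpha>. smooth \<alpha> \<and> (\<forall>z. bidegree p q (\<alpha> z)) \<and>
         compact (closure {z. \<alpha> z \<noteq> 0}) \<and> closure {z. \<alpha> z \<noteq> 0} \<subseteq> \<Omega>}"

type_synonym 'n current = "'n form_field \<Rightarrow> complex"

text \<open>
  Only the values of \<open>T\<close> on \<open>test_forms \<Omega> p p\<close> are relevant.  Continuity is sequential continuity on
  each Frechet space of test forms supported in a fixed compact set.
\<close>

definition is_current :: "'n cspace set \<Rightarrow> nat \<Rightarrow> 'n::{finite,linorder} current \<Rightarrow> bool" where
  "is_current \<Omega> p T \<longleftrightarrow>
     p \<le> CARD('n) \<and>
     (\<forall>\<alpha>\<in>test_forms \<Omega> p p. \<forall>\<omega>\<in>test_forms \<Omega> p p. T (\<lambda>z. \<alpha> z + \<omega> z) = T \<alpha> + T \<omega>) \<and>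
     (\<forall>c. \<forall>\<alpha>\<in>test_forms \<Omega> p p. T (\<lambda>z. c *s \<alpha> z) = c * T \<alpha>) \<and>
     (\<forall>K (\<alpha> :: nat \<Rightarrow> 'n form_field).
        compact K \<and> K \<subseteq> \<Omega> \<and>
        (\<forall>i. \<alpha> i \<in> test_forms \<Omega> p p \<and> (\<forall>z. z \<notin> K \<longrightarrow> \<alpha> i z = 0)) \<and>
        (\<forall>vs. uniform_limit UNIV (\<lambda>i. iterated_deriv vs (\<alpha> i)) (\<lambda>_. 0) sequentially)
        \<longrightarrow> (\<lambda>i. T (\<alpha> i)) \<longlonglongrightarrow> 0)"

text \<open>
  \<open>\<langle>T \<and> \<theta>, \<alpha>\<rangle> = \<langle>T, \<theta> \<and> \<alpha>\<rangle>\<close> and \<open>\<langle>dd\<^sup>c T, \<alpha>\<rangle> = \<langle>T, dd\<^sup>c \<alpha>\<rangle>\<close>; there are no signs, because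
  \<open>T\<close> has even degree.
\<close>

definition current_wedge ::
    "'n current \<Rightarrow> 'n form_field \<Rightarrow> 'n::{finite,linorder} current" where
  "current_wedge T \<theta> = (\<lambda>\<alpha>. T (\<lambda>z. \<theta> z \<and>\<^sub>E \<alpha> z))"

definition current_ddc :: "'n current \<Rightarrow> 'n::{finite,linorder} current" where
  "current_ddc T = (\<lambda>\<alpha>. T (ddc \<alpha>))"

definition m_positive_current ::
    "'n cspace set \<Rightarrow> nat \<Rightarrow> nat \<Rightarrow> 'n::{finite,linorder} current \<Rightarrow> bool" where
  "m_positive_current \<Omega> m p T \<longleftrightarrow>
     (\<forall>\<alpha>\<in>test_forms \<Omega> (m + p - CARD('n)) (m + p - CARD('n)).
        strongly_m_positive \<Omega> m (m + p - CARD('n)) \<alpha> \<longrightarrow>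
        current_wedge T (beta_power (CARD('n) - m)) \<alpha> \<in> \<real>\<^sub>\<ge>\<^sub>0)"


subsection \<open>Currents of bidimension (0,0) as measures\<close>

definition represents :: "'n cspace set \<Rightarrow> 'n::{finite,linorder} current \<Rightarrow> 'n cspace measure \<Rightarrow> bool" where
  "represents \<Omega> S M \<longleftrightarrow>
     sets M = sets (restrict_space borel \<Omega>) \<and>
     (\<forall>K. compact K \<and> K \<subseteq> \<Omega> \<longrightarrow> emeasure M K < \<infinity>) \<and>
     (\<forall>\<phi>\<in>test_forms \<Omega> 0 0. S \<phi> = (\<integral>z. \<phi> z $ ({}, {}) \<partial>M))"

definition is_positive_measure :: "'n cspace set \<Rightarrow> 'n::{finite,linorder} current \<Rightarrow> bool" where
  "is_positive_measure \<Omega> S \<longleftrightarrow> (\<exists>M. represents \<Omega> S M)"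

text \<open>For \<open>\<Omega>\<close> open there is at most one such measure.\<close>

definition current_measure :: "'n cspace set \<Rightarrow> 'n::{finite,linorder} current \<Rightarrow> 'n cspace measure" where
  "current_measure \<Omega> S = (THE M. represents \<Omega> S M)"

end

theory Submission
  imports Defs
begin

text \<open>
  Put \<open>q = m + p - n\<close>, \<open>e = q n / m\<close> and \<open>t = |z - a|\<^sup>2\<close>, and let \<open>\<theta>\<close> be \<open>\<i>/(2\<pi>)\<close> times the wedge product of \<open>\<partial>t\<close> with its conjugate.
  The form \<open>\<beta> - (n/m) \<theta>/t\<close> is \<open>m\<close>-positive, hence so is its \<open>q\<close>-th power, and since \<open>\<theta>\<^sup>2 = 0\<close> this
  gives \<open>\<langle>T, h(t) (t \<beta>\<^sup>p - e \<beta>\<^bsup>p-1\<^esup> \<and> \<theta>)\<rangle> \<ge> 0\<close> for every \<open>h \<ge> 0\<close>.  On the other hand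
  \<open>dd\<^sup>c g(t) = g'(t) \<beta> + g''(t) \<theta>\<close>, so positivity of \<open>dd\<^sup>c T \<and> \<beta>\<^bsup>p-1\<^esup>\<close>, tested on the function \<open>g \<ge> 0\<close>
  with \<open>g'' = h\<close> that vanishes for large \<open>t\<close>, yields
  \<open>\<langle>T, h(t) \<beta>\<^bsup>p-1\<^esup> \<and> \<theta>\<rangle> \<ge> \<integral> H(t) T \<and> \<beta>\<^sup>p\<close> with \<open>H(t) = \<integral>\<^sub>t h\<close>.
  Together, \<open>\<integral> t h(t) T \<and> \<beta>\<^sup>p \<ge> e \<integral> H(t) T \<and> \<beta>\<^sup>p\<close>.  Letting \<open>h\<close> tend to the indicator of \<open>(x, y)\<close> shows
  that the mass \<open>G(x)\<close> of \<open>T \<and> \<beta>\<^sup>p\<close> on the ball of squared radius \<open>x\<close> satisfies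
  \<open>y (G(y) - G(x)) \<ge> e (y - x) G(x)\<close>, so \<open>G(x) / x\<^sup>e\<close> is nondecreasing and has a limit at \<open>0\<close>.
  That \<open>T \<and> \<beta>\<^sup>p\<close> is given by a unique measure is the Riesz representation theorem.
\<close>

subsection \<open>Smooth functions\<close>

text \<open>The constant n/m is the largest admissible one: relative to \<beta> the form \<beta> -
  (n/m) \<theta>/t has the eigenvalues 1, ..., 1, 1 - n/m, and its j-th power wedged with
  \<beta>^(n-j) equals (1 - j/m) \<beta>^n, which is nonnegative exactly up to j = m. This form is
  singular at a. It enters only after multiplication by t h(t) with h = 0 near 0, and since
  positivity of forms is a pointwise notion, only the resulting products have to be smooth. T is not
  assumed closed, so Stokes' formula on spheres does not give the monotonicity. Instead both
  derivatives are moved onto g, and the term containing dd^c T is discarded by its sign; this is why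
  an inequality between masses comes out and not a formula. A current acts on smooth forms only, so
  balls can be reached just through smooth cut-offs, and the measure T \<and> \<beta>^p has to be
  built from a positive functional on smooth functions. As t is a squared radius, t^e is r^(2e), the
  normalisation with exponent 2n(m+p-n)/m.\<close>

lemma smooth_coinduct [consumes 1, case_names step]:
  assumes "f \<in> X"
    and step: "\<And>f. f \<in> X \<Longrightarrow> \<exists>f'. (\<forall>x. (f has_derivative f' x) (at x)) \<and> (\<forall>v. (\<lambda>x. f' x v) \<in> X)"
  shows "smooth f"
proof -
  have *: "f differentiable at x" "(\<lambda>x. frechet_derivative f (at x) v) \<in> X" if f: "f \<in> X" for f x v
  proof -
    obtain f' where f': "\<And>x. (f has_derivative f' x) (at x)" "\<And>v. (\<lambda>x. f' x v) \<in> X"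
      using step[OF f] by blast
    then show "f differentiable at x"
      unfolding differentiable_def by blast
    have "frechet_derivative f (at x) = f' x" for x
      using f'(1) frechet_derivative_at by metis
    then show "(\<lambda>x. frechet_derivative f (at x) v) \<in> X"
      using f'(2) by simp
  qed
  \<comment> \<open>A set closed under directional derivatives contains all iterated ones. The
    closure properties of smooth functions thus reduce to naming such a set, without Leibniz or
    chain formulas of higher order.\<close>
  have "iterated_deriv vs f \<in> X" for vs
  proof (induction vs)
    case (Cons v vs)
    then show ?case using *(2)[of "iterated_deriv vs f" v] by simp
  qed (simp add: \<open>f \<in> X\<close>)
  then show ?thesis
    unfolding smooth_def using * by blast
qed

lemma smooth_differentiable: "smooth f \<Longrightarrow> f differentiable at x"
  unfolding smooth_def using iterated_deriv.simps(1)[of f] by metis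

lemma smooth_has_derivative: "smooth f \<Longrightarrow> (f has_derivative frechet_derivative f (at x)) (at x)"
  using smooth_differentiable frechet_derivative_works by blast

lemma smooth_deriv:
  assumes "smooth f"
  shows "smooth (\<lambda>x. frechet_derivative f (at x) v)"
proof -
  \<comment> \<open>The last entry of the list is the direction applied first.\<close>
  have "iterated_deriv vs (\<lambda>x. frechet_derivative f (at x) v) = iterated_deriv (vs @ [v]) f" for vs
    by (induction vs) auto
  then show ?thesis
    using assms unfolding smooth_def by metis
qed

lemma smooth_continuous_on: "smooth f \<Longrightarrow> continuous_on S f"
  by (intro continuous_at_imp_continuous_on ballI differentiable_imp_continuous_within smooth_differentiable)

lemma smooth_const: "smooth (\<lambda>x. c)"
proof (rule smooth_coinduct[where X="range (\<lambda>c x. c)"])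
  fix f :: "'a \<Rightarrow> 'b" assume "f \<in> range (\<lambda>c x. c)"
  then obtain c where f: "f = (\<lambda>x. c)" by blast
  show "\<exists>f'. (\<forall>x. (f has_derivative f' x) (at x)) \<and> (\<forall>v. (\<lambda>x. f' x v) \<in> range (\<lambda>c x. c))"
    unfolding f by (intro exI[of _ "\<lambda>x v. 0"] conjI allI has_derivative_const rangeI)
qed (rule rangeI)

lemma smooth_linear_compose:
  assumes L: "bounded_linear L" and f: "smooth f"
  shows "smooth (\<lambda>x. L (f x))"
proof (rule smooth_coinduct[where X="(\<lambda>f x. L (f x)) ` Collect smooth"])
  fix g assume "g \<in> (\<lambda>f x. L (f x)) ` Collect smooth"
  then obtain f where f: "smooth f" "g = (\<lambda>x. L (f x))" by auto
  let ?D = "\<lambda>x v. L (frechet_derivative f (at x) v)"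
  have "(g has_derivative ?D x) (at x)" for x
    unfolding f(2) by (rule bounded_linear.has_derivative[OF L smooth_has_derivative[OF f(1)]])
  moreover have "(\<lambda>x. ?D x v) \<in> (\<lambda>f x. L (f x)) ` Collect smooth" for v
    by (rule image_eqI[where x="\<lambda>x. frechet_derivative f (at x) v"]) (simp_all add: smooth_deriv[OF f(1)])
  ultimately show "\<exists>f'. (\<forall>x. (g has_derivative f' x) (at x)) \<and> (\<forall>v. (\<lambda>x. f' x v) \<in> (\<lambda>f x. L (f x)) ` Collect smooth)"
    by (intro exI[of _ ?D]) blast
qed (use f in auto)

lemma smooth_bounded_linear:
  assumes L: "bounded_linear L"
  shows "smooth L"
proof (rule smooth_coinduct[where X="insert L (Collect smooth)"])
  fix g assume "g \<in> insert L (Collect smooth)"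
  then consider "g = L" | "smooth g" by auto
  then show "\<exists>f'. (\<forall>x. (g has_derivative f' x) (at x)) \<and> (\<forall>v. (\<lambda>x. f' x v) \<in> insert L (Collect smooth))"
  proof cases
    case 1
    have "(g has_derivative L) (at x)" for x
      unfolding 1 by (rule bounded_linear_imp_has_derivative[OF L])
    moreover have "(\<lambda>x::'a. L v) \<in> insert L (Collect smooth)" for v
      by (simp add: smooth_const)
    ultimately show ?thesis by (intro exI[of _ "\<lambda>x. L"] conjI allI)
  next
    case 2
    then show ?thesis
      by (intro exI[of _ "\<lambda>x. frechet_derivative g (at x)"] conjI allI)
        (simp_all add: smooth_has_derivative smooth_deriv)
  qed
qed auto

lemma smooth_add:
  assumes "smooth f" "smooth g"
  shows "smooth (\<lambda>x. f x + g x)"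
proof (rule smooth_coinduct[where X="(\<lambda>(f, g) x. f x + g x) ` (Collect smooth \<times> Collect smooth)"])
  let ?X = "(\<lambda>(f, g) x. f x + g x) ` (Collect smooth \<times> Collect smooth) :: ('a \<Rightarrow> 'b) set"
  fix h :: "'a \<Rightarrow> 'b" assume "h \<in> ?X"
  then obtain f g where fg: "smooth f" "smooth g" "h = (\<lambda>x. f x + g x)" by auto
  let ?D = "\<lambda>x v. frechet_derivative f (at x) v + frechet_derivative g (at x) v"
  have "(h has_derivative ?D x) (at x)" for x
    unfolding fg(3) by (intro has_derivative_add smooth_has_derivative fg)
  moreover have "(\<lambda>x. ?D x v) \<in> ?X" for v
    by (rule image_eqI[where x="(\<lambda>x. frechet_derivative f (at x) v, \<lambda>x. frechet_derivative g (at x) v)"])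
      (simp_all add: smooth_deriv fg)
  ultimately show "\<exists>f'. (\<forall>x. (h has_derivative f' x) (at x)) \<and> (\<forall>v. (\<lambda>x. f' x v) \<in> ?X)"
    by (intro exI[of _ ?D]) blast
next
  show "(\<lambda>x. f x + g x) \<in> (\<lambda>(f, g) x. f x + g x) ` (Collect smooth \<times> Collect smooth)"
    by (rule image_eqI[where x="(f, g)"]) (simp_all add: assms)
qed

lemma smooth_sum:
  assumes "\<And>i. i \<in> I \<Longrightarrow> smooth (f i)"
  shows "smooth (\<lambda>x. \<Sum>i\<in>I. f i x)"
proof (cases "finite I")
  case True
  then show ?thesis
    using assms by (induction I) (auto intro: smooth_const smooth_add)
qed (simp add: smooth_const)

text \<open>Leibniz turns one product into a sum of two, so products alone are not closed under
  directional derivatives, but their finite sums are.\<close>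

inductive_set prod_span :: "('b::real_normed_vector \<Rightarrow> 'c::real_normed_vector \<Rightarrow> 'd::real_normed_vector) \<Rightarrow> ('a::real_normed_vector \<Rightarrow> 'd) set"
  for bop :: "'b::real_normed_vector \<Rightarrow> 'c::real_normed_vector \<Rightarrow> 'd" where
  bop: "smooth f \<Longrightarrow> smooth g \<Longrightarrow> (\<lambda>x. bop (f x) (g x)) \<in> prod_span bop"
| add: "f \<in> prod_span bop \<Longrightarrow> g \<in> prod_span bop \<Longrightarrow> (\<lambda>x. f x + g x) \<in> prod_span bop"

lemma smooth_bounded_bilinear:
  fixes f :: "'a::real_normed_vector \<Rightarrow> 'b::real_normed_vector"
    and g :: "'a \<Rightarrow> 'c::real_normed_vector" and bop :: "'b \<Rightarrow> 'c \<Rightarrow> 'd::real_normed_vector"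
  assumes B: "bounded_bilinear bop" and "smooth f" "smooth g"
  shows "smooth (\<lambda>x. bop (f x) (g x))"
proof (rule smooth_coinduct[where X="prod_span bop"])
  fix h :: "'a \<Rightarrow> 'd" assume "h \<in> prod_span bop"
  then show "\<exists>f'. (\<forall>x. (h has_derivative f' x) (at x)) \<and> (\<forall>v. (\<lambda>x. f' x v) \<in> prod_span bop)"
  proof induction
    case (bop f g)
    let ?D = "\<lambda>x v. bop (f x) (frechet_derivative g (at x) v) + bop (frechet_derivative f (at x) v) (g x)"
    have "((\<lambda>x. bop (f x) (g x)) has_derivative ?D x) (at x)" for x
      by (intro bounded_bilinear.FDERIV[OF B] smooth_has_derivative bop)
    moreover have "(\<lambda>x. ?D x v) \<in> prod_span bop" for v
      by (intro prod_span.add prod_span.bop[of f "\<lambda>x. frechet_derivative g (at x) v"]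
          prod_span.bop[of "\<lambda>x. frechet_derivative f (at x) v" g] smooth_deriv bop)
    ultimately show ?case by (intro exI[of _ ?D]) blast
  next
    case (add f g)
    then obtain f' g' where *: "\<And>x. (f has_derivative f' x) (at x)" "\<And>v. (\<lambda>x. f' x v) \<in> prod_span bop"
      "\<And>x. (g has_derivative g' x) (at x)" "\<And>v. (\<lambda>x. g' x v) \<in> prod_span bop" by blast
    then show ?case
      by (intro exI[of _ "\<lambda>x v. f' x v + g' x v"] conjI allI has_derivative_add prod_span.add)
  qed
qed (intro prod_span.bop assms)

lemma smooth_mult:
  fixes f g :: "'a::real_normed_vector \<Rightarrow> 'b::real_normed_algebra"
  shows "smooth f \<Longrightarrow> smooth g \<Longrightarrow> smooth (\<lambda>x. f x * g x)"
  by (rule smooth_bounded_bilinear[OF bounded_bilinear_mult])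

lemma smooth_diff:
  assumes "smooth f" "smooth g"
  shows "smooth (\<lambda>x. f x - g x)"
  using smooth_add[OF assms(1) smooth_linear_compose[OF bounded_linear_minus[OF bounded_linear_ident] assms(2)]]
  by simp

lemma smooth_prod:
  fixes f :: "'i \<Rightarrow> 'a::real_normed_vector \<Rightarrow> real"
  assumes "\<And>i. i \<in> I \<Longrightarrow> smooth (f i)"
  shows "smooth (\<lambda>x. \<Prod>i\<in>I. f i x)"
proof (cases "finite I")
  case True
  then show ?thesis
    using assms by (induction I) (auto intro: smooth_const smooth_mult)
qed (simp add: smooth_const)

text \<open>The closed class for the chain rule: a derivative of \<open>f\<close> goes into the
  coefficient and \<open>h\<close> is replaced by its own derivative.\<close>

inductive_set comp_span :: "('a::real_normed_vector \<Rightarrow> real) \<Rightarrow> ('a \<Rightarrow> real) set"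
  for f :: "'a::real_normed_vector \<Rightarrow> real" where
  comp: "smooth g \<Longrightarrow> smooth h \<Longrightarrow> (\<lambda>x. g x * h (f x)) \<in> comp_span f"
| add: "g \<in> comp_span f \<Longrightarrow> h \<in> comp_span f \<Longrightarrow> (\<lambda>x. g x + h x) \<in> comp_span f"

lemma smooth_has_real_derivative:
  fixes h :: "real \<Rightarrow> real"
  assumes "smooth h"
  shows "(h has_real_derivative frechet_derivative h (at x) 1) (at x)"
proof -
  have "(h has_derivative frechet_derivative h (at x)) (at x)" using smooth_has_derivative[OF assms] .
  moreover have "frechet_derivative h (at x) = (*) (frechet_derivative h (at x) 1)"
  proof
    fix v :: real
    have "linear (frechet_derivative h (at x))"
      using has_derivative_linear[OF smooth_has_derivative[OF assms]] .
    from linear_cmul[OF this, of v 1]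
    show "frechet_derivative h (at x) v = frechet_derivative h (at x) 1 * v" by simp
  qed
  ultimately show ?thesis unfolding has_field_derivative_def by simp
qed

lemma smooth_compose:
  fixes f :: "'a::real_normed_vector \<Rightarrow> real" and h :: "real \<Rightarrow> real"
  assumes h: "smooth h" and f: "smooth f"
  shows "smooth (\<lambda>x. h (f x))"
proof (rule smooth_coinduct[where X="comp_span f"])
  have "(\<lambda>x. 1 * h (f x)) \<in> comp_span f"
    by (rule comp_span.comp[OF smooth_const h])
  then show "(\<lambda>x. h (f x)) \<in> comp_span f" by simp
  fix k assume "k \<in> comp_span f"
  then show "\<exists>f'. (\<forall>x. (k has_derivative f' x) (at x)) \<and> (\<forall>v. (\<lambda>x. f' x v) \<in> comp_span f)"
  proof induction
    case (comp g h)
    let ?D = "\<lambda>x v. (g x * frechet_derivative f (at x) v) * frechet_derivative h (at (f x)) 1 + frechet_derivative g (at x) v * h (f x)"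
    have "((\<lambda>x. g x * h (f x)) has_derivative ?D x) (at x)" for x
    proof -
      have "((\<lambda>x. h (f x)) has_derivative (\<lambda>v. frechet_derivative h (at (f x)) 1 * frechet_derivative f (at x) v)) (at x)"
        using has_derivative_compose[OF smooth_has_derivative[OF f] smooth_has_real_derivative[OF comp(2), unfolded has_field_derivative_def]]
        by simp
      from has_derivative_mult[OF smooth_has_derivative[OF comp(1)] this]
      show ?thesis by (simp add: mult_ac)
    qed
    moreover have "(\<lambda>x. ?D x v) \<in> comp_span f" for v
      by (intro comp_span.add comp_span.comp[where h="\<lambda>t. frechet_derivative h (at t) 1"] comp_span.comp[where h=h]
          smooth_mult smooth_deriv comp f)
    ultimately show ?case by (intro exI[of _ ?D]) blast
  next
    case (add g h)
    then obtain f' g' where *: "\<And>x. (g has_derivative f' x) (at x)" "\<And>v. (\<lambda>x. f' x v) \<in> comp_span f"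
      "\<And>x. (h has_derivative g' x) (at x)" "\<And>v. (\<lambda>x. g' x v) \<in> comp_span f" by blast
    then show ?case
      by (intro exI[of _ "\<lambda>x v. f' x v + g' x v"] conjI allI has_derivative_add comp_span.add)
  qed
qed

text \<open>On the real line a directional derivative is a multiple of the ordinary one. Constant
  factors absorb the directions, so closure under the ordinary derivative is enough.\<close>

lemma smooth_real_coinduct [consumes 1, case_names step]:
  fixes h :: "real \<Rightarrow> real"
  assumes "h \<in> X"
    and step: "\<And>h. h \<in> X \<Longrightarrow> \<exists>h'\<in>X. \<forall>x. (h has_real_derivative h' x) (at x)"
  shows "smooth h"
proof (rule smooth_coinduct[where X="{\<lambda>x. c * h x |c h. h \<in> X}"])
  fix k :: "real \<Rightarrow> real" assume "k \<in> {\<lambda>x. c * h x |c h. h \<in> X}"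
  then obtain c h where k: "k = (\<lambda>x. c * h x)" "h \<in> X" by auto
  obtain h' where h': "h' \<in> X" "\<And>x. (h has_real_derivative h' x) (at x)"
    using step[OF k(2)] by blast
  show "\<exists>f'. (\<forall>x. (k has_derivative f' x) (at x)) \<and> (\<forall>v. (\<lambda>x. f' x v) \<in> {\<lambda>x. c * h x |c h. h \<in> X})"
  proof (intro exI[of _ "\<lambda>x v. (c * v) * h' x"] conjI allI)
    show "(k has_derivative (\<lambda>v. (c * v) * h' x)) (at x)" for x
    proof -
      have "(*) (c * h' x) = (\<lambda>v. (c * v) * h' x)" by (simp add: fun_eq_iff mult_ac)
      then show ?thesis
        using DERIV_cmult[OF h'(2)[of x], of c] unfolding k(1) has_field_derivative_def by metis
    qed
  qed (use h'(1) in blast)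
next
  show "h \<in> {\<lambda>x. c * h x |c h. h \<in> X}"
    using assms(1) by (auto intro!: exI[of _ "1::real"] bexI)
qed

lemma smooth_real_antiderivative:
  fixes g h :: "real \<Rightarrow> real"
  assumes "\<And>x. (g has_real_derivative h x) (at x)" "smooth h"
  shows "smooth g"
proof (rule smooth_real_coinduct[where X="insert g (Collect smooth)"])
  fix k :: "real \<Rightarrow> real" assume "k \<in> insert g (Collect smooth)"
  then show "\<exists>h'\<in>insert g (Collect smooth). \<forall>x. (k has_real_derivative h' x) (at x)"
    using assms smooth_has_real_derivative smooth_deriv[of k 1] by (cases "k = g") auto
qed auto

section \<open>Functions that are flat at the origin\<close>

definition exp_cutoff :: "real poly \<Rightarrow> real \<Rightarrow> real" where
  "exp_cutoff p x = (if x > 0 then poly p (1/x) * exp (- (1/x)) else 0)"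

text \<open>The quotient is the difference quotient of \<open>exp_cutoff p\<close> at 0. From the
  right, y = 1/x turns it into y p(y) exp(-y), which tends to 0 at infinity.\<close>

lemma exp_cutoff_limit: "((\<lambda>x. exp_cutoff p x / x) \<longlongrightarrow> 0) (at 0)"
proof -
  have "((\<lambda>y. poly q y * exp (- y)) \<longlongrightarrow> 0) at_top" for q :: "real poly"
  proof (induction q)
    case (pCons a q)
    have 1: "((\<lambda>y::real. y ^ n * exp (- y)) \<longlongrightarrow> 0) at_top" for n
      using tendsto_power_div_exp_0[of n] by (simp add: exp_minus divide_inverse)
    have "((\<lambda>y. y * (poly q y * exp (- y))) \<longlongrightarrow> 0) at_top"
    proof -
      have "((\<lambda>y::real. \<Sum>i\<le>degree q. coeff q i * (y ^ Suc i * exp (- y))) \<longlongrightarrow> (\<Sum>i\<le>degree q. coeff q i * 0)) at_top"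
        by (intro tendsto_sum tendsto_mult tendsto_const 1)
      then show ?thesis
        by (simp add: poly_altdef sum_distrib_left sum_distrib_right mult_ac)
    qed
    then have "((\<lambda>y. a * (y^0 * exp (- y)) + y * (poly q y * exp (- y))) \<longlongrightarrow> a * 0 + 0) at_top"
      by (intro tendsto_add tendsto_mult tendsto_const 1)
    then show ?case
      by (simp add: algebra_simps)
  qed auto
  from this[of "pCons 0 p"]
  have "((\<lambda>y. y * poly p y * exp (- y)) \<longlongrightarrow> 0) at_top" by simp
  from filterlim_compose[OF this filterlim_inverse_at_top_right]
  have "((\<lambda>x. inverse x * poly p (inverse x) * exp (- inverse x)) \<longlongrightarrow> 0) (at_right 0)" .
  then have "((\<lambda>x. exp_cutoff p x / x) \<longlongrightarrow> 0) (at_right 0)"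
    by (rule Lim_transform_eventually)
      (auto simp: eventually_at_right_field exp_cutoff_def field_simps intro: exI[of _ 1])
  moreover have "((\<lambda>x. exp_cutoff p x / x) \<longlongrightarrow> 0) (at_left 0)"
    by (rule Lim_transform_eventually[OF tendsto_const])
      (auto simp: eventually_at_left_field exp_cutoff_def intro: exI[of _ "-1"])
  ultimately show ?thesis
    by (simp add: filterlim_split_at)
qed

text \<open>In y = 1/x, where dy/dx = -y^2, the function p(y) exp(-y) has the derivative y^2 (p -
  p')(y) exp(-y), and \<open>[:0,0,1:]\<close> is y^2. Allowing an arbitrary polynomial is what
  closes the family under differentiation.\<close>

lemma exp_cutoff_deriv:
  "(exp_cutoff p has_real_derivative exp_cutoff ([:0,0,1:] * (p - pderiv p)) x) (at x)"
proof -
  consider "x > 0" | "x = 0" | "x < 0" by linarith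
  then show ?thesis
  proof cases
    case 1
    have "((\<lambda>x. poly p (1/x) * exp (- (1/x))) has_real_derivative exp_cutoff ([:0,0,1:] * (p - pderiv p)) x) (at x)"
      using 1 by (auto intro!: derivative_eq_intros poly_DERIV[THEN DERIV_chain2] simp: exp_cutoff_def power2_eq_square divide_simps algebra_simps)
    moreover have "eventually (\<lambda>y. poly p (1/y) * exp (- (1/y)) = exp_cutoff p y) (nhds x)"
      using eventually_nhds_in_open[of "{0<..}" x] 1 by (auto simp: exp_cutoff_def elim!: eventually_mono)
    ultimately show ?thesis
      using DERIV_cong_ev[OF refl _ refl, of "\<lambda>x. poly p (1/x) * exp (- (1/x))" "exp_cutoff p"] by blast
  next
    case 2
    then show ?thesis
      using exp_cutoff_limit[of p] by (simp add: DERIV_def exp_cutoff_def)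
  next
    case 3
    have "eventually (\<lambda>y. exp_cutoff p y = 0) (nhds x)"
      using eventually_nhds_in_open[of "{..<0}" x] 3 by (auto simp: exp_cutoff_def elim!: eventually_mono)
    then show ?thesis
      using DERIV_cong_ev[of x x "exp_cutoff p" "\<lambda>x. 0"] 3 by (simp add: exp_cutoff_def)
  qed
qed

lemma smooth_exp_cutoff: "smooth (exp_cutoff p)"
  by (rule smooth_real_coinduct[where X="range exp_cutoff"]) (use exp_cutoff_deriv in auto)

subsection \<open>Smooth cut-off functions\<close>

text \<open>Applied twice, tail integrals produce the function with second derivative
  \<open>h\<close> that vanishes for large arguments. The upper limit is b + 1 rather than b so that
  t = b is still interior to \<open>{a..b+1}\<close>.\<close>

lemma tail_integral_deriv:
  fixes f :: "real \<Rightarrow> real"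
  assumes f: "continuous_on UNIV f" and 0: "\<And>t. t \<ge> b \<Longrightarrow> f t = 0"
  shows "((\<lambda>t. integral {t..b+1} f) has_real_derivative - f t) (at t)"
proof (cases "t \<le> b")
  case True
  define a where "a = t - 1"
  have cont: "continuous_on {a..b+1} f" using f continuous_on_subset by blast
  have "((\<lambda>x. integral {a..x} f) has_real_derivative f t) (at t within {a..b+1})"
    by (rule integral_has_real_derivative[OF cont]) (use True in \<open>auto simp: a_def\<close>)
  then have "((\<lambda>x. integral {a..x} f) has_real_derivative f t) (at t)"
    using at_within_interior[of t "{a..b+1}"] True by (simp add: a_def)
  then have d: "((\<lambda>x. integral {a..b+1} f - integral {a..x} f) has_real_derivative - f t) (at t)"
    by (auto intro!: derivative_eq_intros)
  have "eventually (\<lambda>x. x \<in> {a<..<b+1}) (nhds t)"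
    by (rule eventually_nhds_in_open) (use True in \<open>auto simp: a_def\<close>)
  then have "eventually (\<lambda>x. integral {a..b+1} f - integral {a..x} f = integral {x..b+1} f) (nhds t)"
  proof eventually_elim
    case (elim x)
    then show ?case
      using Henstock_Kurzweil_Integration.integral_combine[where a=a and c=x and b="b+1" and f=f] integrable_continuous_interval[OF cont] by auto
  qed
  from DERIV_cong_ev[OF refl this refl] show ?thesis
    using d by simp
next
  case False
  have "integral {x..b+1} f = 0" if "x \<ge> b" for x
    using integral_cong[of "{x..b+1}" f "\<lambda>_. 0"] 0 that by simp
  then have "eventually (\<lambda>x. integral {x..b+1} f = 0) (nhds t)"
    using eventually_nhds_in_open[of "{b<..}" t] False by (auto elim!: eventually_mono)
  from DERIV_cong_ev[OF refl this refl] show ?thesis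
    using 0[of t] False by simp
qed

lemma tail_integral_eq_0:
  fixes f :: "real \<Rightarrow> real"
  assumes "\<And>t. t \<ge> b \<Longrightarrow> f t = 0" "t \<ge> b"
  shows "integral {t..b+1} f = 0"
  using integral_cong[of "{t..b+1}" f "\<lambda>_. 0"] assms by simp

lemma tail_integral_nonneg:
  fixes f :: "real \<Rightarrow> real"
  assumes "continuous_on UNIV f" "\<And>t. f t \<ge> 0"
  shows "integral {t..b+1} f \<ge> 0"
  by (rule integral_nonneg)
    (use assms in \<open>auto intro!: integrable_continuous_interval intro: continuous_on_subset\<close>)

lemma smooth_tail_integral:
  fixes f :: "real \<Rightarrow> real"
  assumes "smooth f" "\<And>t. t \<ge> b \<Longrightarrow> f t = 0"
  shows "smooth (\<lambda>t. integral {t..b+1} f)"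
proof (rule smooth_real_antiderivative)
  show "((\<lambda>t. integral {t..b+1} f) has_real_derivative - f x) (at x)" for x
    by (rule tail_integral_deriv) (use assms smooth_continuous_on in auto)
  show "smooth (\<lambda>x. - f x)"
    using smooth_diff[OF smooth_const[of 0] assms(1)] by simp
qed

lemma smooth_affine: "smooth (\<lambda>x::real. a * x + b)"
  using smooth_add[OF smooth_bounded_linear[OF bounded_linear_mult_right[of a]] smooth_const[of b]] .

text \<open>A bump \<open>b\<close> supported in [0, 1] is integrated and normalised: with its tail
  integral \<open>F\<close>, the step is 1 - F/F(0).\<close>

lemma smooth_step_exists:
  "\<exists>s::real\<Rightarrow>real. smooth s \<and> (\<forall>x\<le>0. s x = 0) \<and> (\<forall>x\<ge>1. s x = 1) \<and> (\<forall>x. 0 \<le> s x \<and> s x \<le> 1)"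
proof -
  define b where "b = (\<lambda>x. exp_cutoff 1 x * exp_cutoff 1 (1 - x))"
  have "smooth (\<lambda>x::real. exp_cutoff 1 (-1 * x + 1))"
    by (rule smooth_compose[OF smooth_exp_cutoff smooth_affine])
  then have b: "smooth b"
    unfolding b_def by (intro smooth_mult smooth_exp_cutoff) (simp add: add.commute)
  have b0: "b x = 0" if "x \<ge> 1 \<or> x \<le> 0" for x
    using that by (auto simp: b_def exp_cutoff_def)
  have bpos: "b x > 0" if "0 < x" "x < 1" for x
    using that by (auto simp: b_def exp_cutoff_def)
  have bnn: "b x \<ge> 0" for x
    by (auto simp: b_def exp_cutoff_def)
  define F where "F = (\<lambda>t. integral {t..1+1} b)"
  have dF: "(F has_real_derivative - b t) (at t)" for t
    unfolding F_def by (rule tail_integral_deriv) (use b b0 smooth_continuous_on in auto)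
  have F: "smooth F"
    unfolding F_def by (rule smooth_tail_integral) (use b b0 in auto)
  have anti: "F y \<le> F x" if "x \<le> y" for x y
    by (rule DERIV_nonpos_imp_nonincreasing[OF that]) (use dF bnn neg_le_0_iff_le in blast)
  have F1: "F x = 0" if "x \<ge> 1" for x
    unfolding F_def by (rule tail_integral_eq_0) (use b0 that in auto)
  \<comment> \<open>The normalising constant \<open>F 0\<close> must not vanish: \<open>b\<close> is
    positive on [1/4, 1/2], and monotonicity of \<open>F\<close> carries the strict inequality to 0
    and 1.\<close>
  have "F (1/2) < F (1/4)"
    by (rule DERIV_neg_imp_decreasing) (use dF bpos in \<open>auto intro!: exI\<close>)
  then have pos: "F 0 > 0"
    using anti[of 0 "1/4"] anti[of "1/2" 1] F1[of 1] by simp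
  have F0: "F x = F 0" if "x \<le> 0" for x
  proof (rule antisym)
    show "F x \<le> F 0"
    proof (rule DERIV_nonneg_imp_nondecreasing[OF that])
      show "\<exists>d. (F has_real_derivative d) (at t) \<and> 0 \<le> d" if "t \<le> 0" for t
        using dF[of t] b0[of t] that by (intro exI[of _ 0]) simp
    qed
  qed (rule anti[OF that])
  show ?thesis
  proof (intro exI conjI allI impI)
    show "smooth (\<lambda>x. 1 - (1 / F 0) * F x)"
      by (intro smooth_diff smooth_const smooth_mult F)
    fix x :: real
    show "1 - (1 / F 0) * F x = 0" if "x \<le> 0" using F0[OF that] pos by simp
    show "1 - (1 / F 0) * F x = 1" if "x \<ge> 1" using F1[OF that] pos by simp
    show "0 \<le> 1 - (1 / F 0) * F x"
      using anti[of "min x 0" x] F0[of "min x 0"] pos by simp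
    show "1 - (1 / F 0) * F x \<le> 1"
      using anti[of x "max x 1"] F1[of "max x 1"] pos by simp
  qed
qed

definition smooth_step :: "real \<Rightarrow> real" where
  "smooth_step = (SOME s. smooth s \<and> (\<forall>x\<le>0. s x = 0) \<and> (\<forall>x\<ge>1. s x = 1) \<and> (\<forall>x. 0 \<le> s x \<and> s x \<le> 1))"

lemma smooth_step:
  "smooth smooth_step" "x \<le> 0 \<Longrightarrow> smooth_step x = 0" "x \<ge> 1 \<Longrightarrow> smooth_step x = 1"
  "0 \<le> smooth_step x" "smooth_step x \<le> 1"
  using someI_ex[OF smooth_step_exists] unfolding smooth_step_def by auto

lemma smooth_norm_squared:
  fixes a :: "'a::euclidean_space"
  shows "smooth (\<lambda>z. (norm (z - a))\<^sup>2)"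
proof -
  have "smooth (\<lambda>z. (z - a) \<bullet> (z - a))"
    by (intro smooth_bounded_bilinear[OF bounded_bilinear_inner] smooth_diff smooth_const
        smooth_bounded_linear bounded_linear_ident)
  then show ?thesis by (simp add: power2_norm_eq_inner)
qed

definition test_functions :: "'a::euclidean_space set \<Rightarrow> ('a \<Rightarrow> real) set" where
  "test_functions U = {\<phi>. smooth \<phi> \<and> (\<exists>K. compact K \<and> K \<subseteq> U \<and> (\<forall>x. x \<notin> K \<longrightarrow> \<phi> x = 0))}"

lemma test_functions_mono: "U \<subseteq> V \<Longrightarrow> test_functions U \<subseteq> test_functions V"
  unfolding test_functions_def by blast

lemma test_functions_zero: "(\<lambda>x. 0) \<in> test_functions U"
  by (auto simp: test_functions_def smooth_const intro: exI[of _ "{}"])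

lemma test_functions_add:
  assumes "\<phi> \<in> test_functions U" "\<psi> \<in> test_functions U"
  shows "(\<lambda>x. \<phi> x + \<psi> x) \<in> test_functions U"
proof -
  obtain K L where "compact K" "K \<subseteq> U" "\<forall>x. x \<notin> K \<longrightarrow> \<phi> x = 0"
    "compact L" "L \<subseteq> U" "\<forall>x. x \<notin> L \<longrightarrow> \<psi> x = 0" "smooth \<phi>" "smooth \<psi>"
    using assms unfolding test_functions_def by blast
  then show ?thesis
    by (auto simp: test_functions_def smooth_add intro!: exI[of _ "K \<union> L"])
qed

lemma test_functions_mult:
  assumes "\<phi> \<in> test_functions U" "smooth g"
  shows "(\<lambda>x. g x * \<phi> x) \<in> test_functions U"
  using assms by (auto simp: test_functions_def smooth_mult)

lemma test_functions_cmul: "\<phi> \<in> test_functions U \<Longrightarrow> (\<lambda>x. c * \<phi> x) \<in> test_functions U"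
  by (rule test_functions_mult[OF _ smooth_const])

lemma test_functions_diff:
  assumes "\<phi> \<in> test_functions U" "\<psi> \<in> test_functions U"
  shows "(\<lambda>x. \<phi> x - \<psi> x) \<in> test_functions U"
  using test_functions_add[OF assms(1) test_functions_cmul[OF assms(2), of "-1"]] by simp

lemma test_functions_sum:
  assumes "\<And>i. i \<in> I \<Longrightarrow> \<phi> i \<in> test_functions U"
  shows "(\<lambda>x. \<Sum>i\<in>I. \<phi> i x) \<in> test_functions U"
proof (cases "finite I")
  case True
  then show ?thesis
    using assms by (induction I) (auto intro: test_functions_zero test_functions_add)
qed (simp add: test_functions_zero)

lemma test_functions_bounded:
  assumes "\<phi> \<in> test_functions U"
  shows "\<exists>B>0. \<forall>x. \<bar>\<phi> x\<bar> \<le> B"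
proof -
  obtain K where K: "smooth \<phi>" "compact K" "\<forall>x. x \<notin> K \<longrightarrow> \<phi> x = 0"
    using assms unfolding test_functions_def by blast
  have "bounded (\<phi> ` K)"
    by (intro compact_imp_bounded compact_continuous_image smooth_continuous_on K)
  then obtain B where "B > 0" "\<forall>x\<in>K. \<bar>\<phi> x\<bar> \<le> B"
    unfolding bounded_pos by auto
  then show ?thesis
    using K(3) by (intro exI[of _ B]) (metis abs_zero less_eq_real_def)
qed

text \<open>Finitely many bumps cover \<open>K\<close>, and 1 minus the product of their complements
  is 1 as soon as one bump is. The value 1 is reached on an open set \<open>V\<close> and not only
  on \<open>K\<close>, so that products with 1 - \<eta> have support away from
  \<open>K\<close>.\<close>

lemma smooth_urysohn:
  fixes K U :: "'a::euclidean_space set"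
  assumes "compact K" "open U" "K \<subseteq> U"
  obtains \<eta> V where "\<eta> \<in> test_functions U" "\<And>x. 0 \<le> \<eta> x" "\<And>x. \<eta> x \<le> 1"
    "open V" "K \<subseteq> V" "\<And>x. x \<in> V \<Longrightarrow> \<eta> x = 1"
proof -
  have "\<forall>x\<in>K. \<exists>r>0. cball x (2 * r) \<subseteq> U"
  proof
    fix x assume "x \<in> K"
    then obtain e where "e > 0" "cball x e \<subseteq> U"
      using assms open_contains_cball by blast
    then show "\<exists>r>0. cball x (2 * r) \<subseteq> U" by (intro exI[of _ "e/2"]) auto
  qed
  then obtain r where r: "\<And>x. x \<in> K \<Longrightarrow> r x > 0" "\<And>x. x \<in> K \<Longrightarrow> cball x (2 * r x) \<subseteq> U"
    by metis
  have "K \<subseteq> (\<Union>x\<in>K. ball x (r x))" using r(1) by auto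
  from compactE_image[OF assms(1) _ this]
  obtain I where I: "I \<subseteq> K" "finite I" "K \<subseteq> (\<Union>x\<in>I. ball x (r x))" by auto
  \<comment> \<open>The argument of the step is at least 1 within distance \<open>r x\<close> of
    \<open>x\<close> and at most 0 beyond distance \<open>2 * r x\<close>, so the bump lives in a
    ball that still lies in \<open>U\<close>.\<close>
  define b where "b = (\<lambda>x z. smooth_step ((- 1 / (r x)\<^sup>2) * (norm (z - x))\<^sup>2 + 2))"
  have b: "smooth (b x)" for x
    unfolding b_def
    by (rule smooth_compose[OF smooth_compose[OF smooth_step(1) smooth_affine] smooth_norm_squared])
  have b1: "b x z = 1" if "x \<in> I" "z \<in> ball x (r x)" for x z
  proof -
    have "(norm (z - x))\<^sup>2 \<le> (r x)\<^sup>2"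
      using that by (intro power_mono) (auto simp: dist_norm norm_minus_commute)
    moreover have "(r x)\<^sup>2 > 0" using r(1)[of x] that I(1) by auto
    ultimately show ?thesis
      unfolding b_def by (intro smooth_step) (simp add: field_simps)
  qed
  have b0: "b x z = 0" if "x \<in> I" "z \<notin> cball x (2 * r x)" for x z
  proof -
    have *: "r x > 0" using r(1)[of x] that I(1) by auto
    have "(2 * r x)\<^sup>2 \<le> (norm (z - x))\<^sup>2"
      using that * by (intro power_mono) (auto simp: dist_norm norm_minus_commute)
    moreover have "(r x)\<^sup>2 > 0" using * by auto
    ultimately show ?thesis
      unfolding b_def by (intro smooth_step) (simp add: field_simps power2_eq_square)
  qed
  have b01: "0 \<le> b x z" "b x z \<le> 1" for x z
    by (simp_all add: b_def smooth_step)
  define \<eta> where "\<eta> = (\<lambda>z. 1 - (\<Prod>x\<in>I. 1 - b x z))"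
  show ?thesis
  proof (rule that[of \<eta> "\<Union>x\<in>I. ball x (r x)"])
    have "smooth \<eta>"
      unfolding \<eta>_def by (intro smooth_diff smooth_prod smooth_const b)
    moreover have "compact (\<Union>x\<in>I. cball x (2 * r x))"
      using I(2) by (intro compact_UN) auto
    moreover have "(\<Union>x\<in>I. cball x (2 * r x)) \<subseteq> U" using r(2) I(1) by blast
    moreover have "\<eta> z = 0" if "z \<notin> (\<Union>x\<in>I. cball x (2 * r x))" for z
      using that b0 by (simp add: \<eta>_def)
    ultimately show "\<eta> \<in> test_functions U"
      unfolding test_functions_def by blast
    show "0 \<le> \<eta> x" for x
      using prod_le_1[of I "\<lambda>y. 1 - b y x"] b01 by (simp add: \<eta>_def)
    show "\<eta> x \<le> 1" for x
      using prod_nonneg[of I "\<lambda>y. 1 - b y x"] b01 by (simp add: \<eta>_def)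
    show "\<eta> x = 1" if "x \<in> (\<Union>x\<in>I. ball x (r x))" for x
    proof -
      have "(\<Prod>y\<in>I. 1 - b y x) = 0"
        using that b1 I(2) by (intro prod_zero) auto
      then show ?thesis by (simp add: \<eta>_def)
    qed
  qed (use I in auto)
qed

subsection \<open>Positive functionals on test functions\<close>

text \<open>The abstract setting for T \<and> \<beta>^p acting on real functions. The test functions
  are smooth because currents act on smooth forms; all bounds come from positivity, through
  \<open>mono\<close>.\<close>

locale positive_functional =
  fixes \<Omega> :: "'a::euclidean_space set" and \<Lambda> :: "('a \<Rightarrow> real) \<Rightarrow> real"
  assumes open_domain: "open \<Omega>"
    and add: "\<phi> \<in> test_functions \<Omega> \<Longrightarrow> \<psi> \<in> test_functions \<Omega> \<Longrightarrow> \<Lambda> (\<lambda>x. \<phi> x + \<psi> x) = \<Lambda> \<phi> + \<Lambda> \<psi>"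
    and cmul: "\<phi> \<in> test_functions \<Omega> \<Longrightarrow> \<Lambda> (\<lambda>x. c * \<phi> x) = c * \<Lambda> \<phi>"
    and nonneg: "\<phi> \<in> test_functions \<Omega> \<Longrightarrow> (\<And>x. \<phi> x \<ge> 0) \<Longrightarrow> \<Lambda> \<phi> \<ge> 0"
begin

lemma zero: "\<Lambda> (\<lambda>x. 0) = 0"
  using cmul[OF test_functions_zero, of 0] by simp

lemma mono:
  assumes "\<phi> \<in> test_functions \<Omega>" "\<psi> \<in> test_functions \<Omega>" "\<And>x. \<phi> x \<le> \<psi> x"
  shows "\<Lambda> \<phi> \<le> \<Lambda> \<psi>"
proof -
  have "\<Lambda> (\<lambda>x. \<phi> x + (\<psi> x - \<phi> x)) = \<Lambda> \<phi> + \<Lambda> (\<lambda>x. \<psi> x - \<phi> x)"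
    by (intro add assms test_functions_diff)
  then show ?thesis
    using nonneg[OF test_functions_diff[OF assms(2,1)]] assms(3) by simp
qed

lemma sum:
  assumes "\<And>i. i \<in> I \<Longrightarrow> \<phi> i \<in> test_functions \<Omega>"
  shows "\<Lambda> (\<lambda>x. \<Sum>i\<in>I. \<phi> i x) = (\<Sum>i\<in>I. \<Lambda> (\<phi> i))"
proof (cases "finite I")
  case True
  then show ?thesis
    using assms by (induction I) (auto simp: zero add test_functions_sum)
qed (simp add: zero)

section \<open>The outer measure of a positive functional\<close>

definition below :: "'a set \<Rightarrow> ('a \<Rightarrow> real) set" where
  "below U = {\<phi> \<in> test_functions (\<Omega> \<inter> U). \<forall>x. 0 \<le> \<phi> x \<and> \<phi> x \<le> 1}"

text \<open>The competitors have support in \<Omega> \<inter> U, so the content makes sense for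
  every open set of the whole space. Caratheodory's theorem can then run there, with restriction to
  \<Omega> only at the end.\<close>

definition content :: "'a set \<Rightarrow> ennreal" where
  "content U = (SUP \<phi>\<in>below U. ennreal (\<Lambda> \<phi>))"

definition outer :: "'a set \<Rightarrow> ennreal" where
  "outer A = (INF U\<in>{U. open U \<and> A \<subseteq> U}. content U)"

lemma below_test: "\<phi> \<in> below U \<Longrightarrow> \<phi> \<in> test_functions \<Omega>"
  unfolding below_def using test_functions_mono[of "\<Omega> \<inter> U" \<Omega>] by auto

lemma zero_below: "(\<lambda>x. 0) \<in> below U"
  by (simp add: below_def test_functions_zero)

lemma below_mono: "U \<subseteq> V \<Longrightarrow> below U \<subseteq> below V"
  unfolding below_def using test_functions_mono[of "\<Omega> \<inter> U" "\<Omega> \<inter> V"] by auto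

lemma below_nonneg: "\<phi> \<in> below U \<Longrightarrow> \<Lambda> \<phi> \<ge> 0"
  using nonneg[OF below_test] by (auto simp: below_def)

lemma content_upper: "\<phi> \<in> below U \<Longrightarrow> ennreal (\<Lambda> \<phi>) \<le> content U"
  unfolding content_def by (rule SUP_upper)

lemma content_mono: "U \<subseteq> V \<Longrightarrow> content U \<le> content V"
  unfolding content_def by (intro SUP_subset_mono below_mono) auto

lemma outer_open: "open U \<Longrightarrow> outer U = content U"
  unfolding outer_def by (intro antisym INF_lower INF_greatest content_mono) auto

text \<open>A cut-off \<eta> supported in \<open>U\<close> equals 1 near the part of
  \<open>K\<close> outside \<open>V\<close>. Hence \<eta> \<phi> lives in \<open>U\<close>, and (1 -
  \<eta>) \<phi> lives in \<open>V\<close>.\<close>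

lemma below_split:
  assumes \<phi>: "\<phi> \<in> below (U \<union> V)" and "open U" "open V"
  obtains \<phi>1 \<phi>2 where "\<phi>1 \<in> below U" "\<phi>2 \<in> below V" "\<phi> = (\<lambda>x. \<phi>1 x + \<phi>2 x)"
proof -
  obtain K where K: "compact K" "K \<subseteq> \<Omega> \<inter> (U \<union> V)" "\<And>x. x \<notin> K \<Longrightarrow> \<phi> x = 0" "smooth \<phi>"
    and b: "\<And>x. 0 \<le> \<phi> x" "\<And>x. \<phi> x \<le> 1"
    using \<phi> unfolding below_def test_functions_def by blast
  have "compact (K - V)" using K(1) assms(3) compact_diff by blast
  moreover have "K - V \<subseteq> \<Omega> \<inter> U" using K(2) by blast
  ultimately obtain \<eta> W where \<eta>: "\<eta> \<in> test_functions (\<Omega> \<inter> U)" "\<And>x. 0 \<le> \<eta> x" "\<And>x. \<eta> x \<le> 1"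
    "open W" "K - V \<subseteq> W" "\<And>x. x \<in> W \<Longrightarrow> \<eta> x = 1"
    using smooth_urysohn[of "K - V" "\<Omega> \<inter> U"] open_domain assms(2) by blast
  have s: "smooth (\<lambda>x. 1 - \<eta> x)"
    using \<eta>(1) by (intro smooth_diff smooth_const) (simp add: test_functions_def)
  show ?thesis
  proof (rule that[of "\<lambda>x. \<phi> x * \<eta> x" "\<lambda>x. (1 - \<eta> x) * \<phi> x"])
    show "(\<lambda>x. \<phi> x * \<eta> x) \<in> below U"
      unfolding below_def using \<eta> b K(4) by (auto intro: test_functions_mult mult_le_one)
    have "compact (K - W)" using K(1) \<eta>(4) compact_diff by blast
    moreover have "K - W \<subseteq> \<Omega> \<inter> V" using K(2) \<eta>(5) by blast
    moreover have "(1 - \<eta> x) * \<phi> x = 0" if "x \<notin> K - W" for x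
      using that K(3)[of x] \<eta>(6)[of x] by auto
    ultimately have "(\<lambda>x. (1 - \<eta> x) * \<phi> x) \<in> test_functions (\<Omega> \<inter> V)"
      unfolding test_functions_def using smooth_mult[OF s K(4)] by blast
    then show "(\<lambda>x. (1 - \<eta> x) * \<phi> x) \<in> below V"
      unfolding below_def using \<eta> b by (auto intro: mult_le_one)
  qed (simp add: algebra_simps)
qed

lemma content_Un:
  assumes "open U" "open V"
  shows "content (U \<union> V) \<le> content U + content V"
  unfolding content_def[of "U \<union> V"]
proof (rule SUP_least)
  fix \<phi> assume "\<phi> \<in> below (U \<union> V)"
  then obtain \<phi>1 \<phi>2 where *: "\<phi>1 \<in> below U" "\<phi>2 \<in> below V" "\<phi> = (\<lambda>x. \<phi>1 x + \<phi>2 x)"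
    using below_split[OF _ assms] by blast
  then have "ennreal (\<Lambda> \<phi>) = ennreal (\<Lambda> \<phi>1) + ennreal (\<Lambda> \<phi>2)"
    using add[OF below_test[OF *(1)] below_test[OF *(2)]] below_nonneg
    by (simp add: ennreal_plus)
  then show "ennreal (\<Lambda> \<phi>) \<le> content U + content V"
    using content_upper[OF *(1)] content_upper[OF *(2)] add_mono by metis
qed

lemma below_empty: "below {} = {\<lambda>x. 0}"
  using zero_below by (auto simp: below_def test_functions_def)

lemma content_empty: "content {} = 0"
  by (simp add: content_def below_empty zero)

lemma content_finite_UN:
  assumes "\<And>i::nat. open (U i)"
  shows "content (\<Union>i<n. U i) \<le> (\<Sum>i<n. content (U i))"
proof (induction n)
  case (Suc n)
  have "content (\<Union>i<Suc n. U i) = content ((\<Union>i<n. U i) \<union> U n)"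
    by (simp add: lessThan_Suc Un_commute)
  also have "\<dots> \<le> content (\<Union>i<n. U i) + content (U n)"
    by (rule content_Un) (use assms in auto)
  finally show ?case
    using Suc by (auto intro: order_trans add_right_mono)
qed (simp add: content_empty)

text \<open>A competitor \<phi> has compact support, so finitely many of the open sets already cover
  it and finite subadditivity applies.\<close>

lemma content_UN:
  assumes U: "\<And>i::nat. open (U i)"
  shows "content (\<Union>i. U i) \<le> (\<Sum>i. content (U i))"
  unfolding content_def[of "\<Union>i. U i"]
proof (rule SUP_least)
  fix \<phi> assume "\<phi> \<in> below (\<Union>i. U i)"
  then obtain K where K: "compact K" "K \<subseteq> \<Omega> \<inter> (\<Union>i. U i)" "\<And>x. x \<notin> K \<Longrightarrow> \<phi> x = 0" "smooth \<phi>"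
    and b: "\<And>x. 0 \<le> \<phi> x" "\<And>x. \<phi> x \<le> 1"
    unfolding below_def test_functions_def by blast
  obtain I where I: "finite I" "K \<subseteq> (\<Union>i\<in>I. U i)"
    using compactE_image[OF K(1), of UNIV U] U K(2) by (metis Int_subset_iff)
  then obtain n where "I \<subseteq> {..<n}" by (meson finite_nat_iff_bounded)
  then have "K \<subseteq> \<Omega> \<inter> (\<Union>i<n. U i)" using I K(2) by blast
  then have "\<phi> \<in> below (\<Union>i<n. U i)"
    unfolding below_def test_functions_def using K b by blast
  then have "ennreal (\<Lambda> \<phi>) \<le> (\<Sum>i<n. content (U i))"
    using content_upper content_finite_UN[of U n] U order_trans by blast
  also have "\<dots> \<le> (\<Sum>i. content (U i))"
    by (rule sum_le_suminf) auto
  finally show "ennreal (\<Lambda> \<phi>) \<le> (\<Sum>i. content (U i))" .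
qed

lemma outer_mono: "A \<subseteq> B \<Longrightarrow> outer A \<le> outer B"
  unfolding outer_def by (rule INF_superset_mono) auto

lemma outer_close:
  assumes "e > 0"
  shows "\<exists>U. open U \<and> A \<subseteq> U \<and> content U \<le> outer A + ennreal e"
proof (cases "outer A = \<infinity>")
  case True
  then show ?thesis by (intro exI[of _ UNIV]) auto
next
  case False
  then have "outer A < outer A + ennreal e"
    using assms by (metis add.commute add_0 ennreal_add_left_cancel_less ennreal_less_zero_iff infinity_ennreal_def)
  then show ?thesis
    unfolding outer_def INF_less_iff by (auto intro: less_imp_le)
qed

lemma outer_UN: "outer (\<Union>i::nat. A i) \<le> (\<Sum>i. outer (A i))"
proof (rule ennreal_le_epsilon)
  fix e :: real assume "0 < e"
  have "\<exists>U. \<forall>i. open (U i) \<and> A i \<subseteq> U i \<and> content (U i) \<le> outer (A i) + ennreal (e * (1/2) ^ Suc i)"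
    using outer_close \<open>0 < e\<close> by (intro choice) (auto simp del: power_Suc)
  then obtain U where U: "\<And>i. open (U i)" "\<And>i. A i \<subseteq> U i"
    "\<And>i. content (U i) \<le> outer (A i) + ennreal (e * (1/2) ^ Suc i)" by blast
  have "outer (\<Union>i. A i) \<le> outer (\<Union>i. U i)" using U(2) by (intro outer_mono) blast
  also have "\<dots> = content (\<Union>i. U i)" using U(1) by (intro outer_open) auto
  also have "\<dots> \<le> (\<Sum>i. content (U i))" by (rule content_UN[OF U(1)])
  also have "\<dots> \<le> (\<Sum>i. outer (A i) + ennreal (e * (1/2) ^ Suc i))"
    using U(3) by (intro suminf_le) auto
  also have "\<dots> = (\<Sum>i. outer (A i)) + (\<Sum>i. ennreal e * ennreal ((1/2) ^ Suc i))"
    using \<open>0 < e\<close> by (subst suminf_add[symmetric]) (auto simp del: power_Suc simp add: ennreal_mult)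
  also have "(\<Sum>i. ennreal e * ennreal ((1/2) ^ Suc i)) = ennreal e"
    unfolding ennreal_suminf_cmult
    by (subst suminf_ennreal_eq[OF zero_le_power power_half_series]) auto
  finally show "outer (\<Union>i. A i) \<le> (\<Sum>i. outer (A i)) + ennreal e" .
qed

lemma outer_measure_space_outer: "outer_measure_space (Pow UNIV) outer"
  unfolding outer_measure_space_def positive_def increasing_def countably_subadditive_def
  using outer_mono outer_UN outer_open[OF open_empty] content_empty by auto

lemma outer_Un: "outer (A \<union> B) \<le> outer A + outer B"
proof (rule ennreal_le_epsilon)
  fix e :: real assume "0 < e"
  obtain U where U: "open U" "A \<subseteq> U" "content U \<le> outer A + ennreal (e/2)"
    using outer_close[of "e/2" A] \<open>0 < e\<close> by auto
  obtain V where V: "open V" "B \<subseteq> V" "content V \<le> outer B + ennreal (e/2)"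
    using outer_close[of "e/2" B] \<open>0 < e\<close> by auto
  have "outer (A \<union> B) \<le> outer (U \<union> V)" using U V by (intro outer_mono) auto
  also have "\<dots> \<le> content U + content V" using U V outer_open content_Un by (metis open_Un)
  also have "\<dots> \<le> (outer A + ennreal (e/2)) + (outer B + ennreal (e/2))"
    by (intro add_mono U V)
  also have "\<dots> = (outer A + outer B) + (ennreal (e/2) + ennreal (e/2))" by (simp add: ac_simps)
  also have "ennreal (e/2) + ennreal (e/2) = ennreal e"
    using \<open>0 < e\<close> by (simp add: ennreal_plus[symmetric] del: ennreal_plus)
  finally show "outer (A \<union> B) \<le> outer A + outer B + ennreal e" .
qed

text \<open>The substantial half of Caratheodory's criterion, for an open \<open>V\<close>. If
  \<phi> lives on a compact set \<open>K\<close> inside V \<inter> U, then any \<psi> below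
  \<open>V - K\<close> vanishes on \<open>K\<close>, so \<phi> + \<psi> stays at most 1 and competes
  in \<open>V\<close>; moreover \<open>V - K\<close> contains \<open>V - U\<close>.\<close>

lemma content_add_outer:
  assumes U: "open U" and V: "open V"
  shows "content (V \<inter> U) + outer (V - U) \<le> content V"
proof -
  have "ennreal (\<Lambda> \<phi>) + outer (V - U) \<le> content V" if \<phi>: "\<phi> \<in> below (V \<inter> U)" for \<phi>
  proof -
    obtain K where K: "compact K" "K \<subseteq> \<Omega> \<inter> (V \<inter> U)" "\<And>x. x \<notin> K \<Longrightarrow> \<phi> x = 0"
      and b: "\<And>x. 0 \<le> \<phi> x" "\<And>x. \<phi> x \<le> 1"
      using \<phi> unfolding below_def test_functions_def by blast
    have o: "open (V - K)" using K(1) V by (simp add: compact_imp_closed open_Diff)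
    have "outer (V - U) \<le> content (V - K)"
      unfolding outer_open[OF o, symmetric] using K(2) by (intro outer_mono) auto
    moreover have "content (V - K) + ennreal (\<Lambda> \<phi>) \<le> content V"
    proof -
      have "ennreal (\<Lambda> \<psi>) + ennreal (\<Lambda> \<phi>) \<le> content V" if \<psi>: "\<psi> \<in> below (V - K)" for \<psi>
      proof -
        have "ennreal (\<Lambda> \<psi>) + ennreal (\<Lambda> \<phi>) = ennreal (\<Lambda> (\<lambda>x. \<psi> x + \<phi> x))"
          using add[OF below_test[OF \<psi>] below_test[OF \<phi>]] below_nonneg[OF \<psi>] below_nonneg[OF \<phi>]
          by (simp add: ennreal_plus)
        also have "(\<lambda>x. \<psi> x + \<phi> x) \<in> below V"
        proof -
          have 1: "\<psi> \<in> test_functions (\<Omega> \<inter> V)" "\<phi> \<in> test_functions (\<Omega> \<inter> V)"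
            using \<psi> \<phi> below_mono[of "V - K" V] below_mono[of "V \<inter> U" V] by (auto simp: below_def)
          have "\<psi> x + \<phi> x \<le> 1 \<and> 0 \<le> \<psi> x + \<phi> x" for x
          proof (cases "x \<in> K")
            case True
            then have "\<psi> x = 0" using \<psi> by (auto simp: below_def test_functions_def)
            then show ?thesis using b by simp
          next
            case False
            then show ?thesis using \<psi> K(3) by (simp add: below_def)
          qed
          then show ?thesis
            using test_functions_add[OF 1] by (simp add: below_def)
        qed
        then have "ennreal (\<Lambda> (\<lambda>x. \<psi> x + \<phi> x)) \<le> content V" by (rule content_upper)
        finally show ?thesis .
      qed
      then have "(SUP \<psi>\<in>below (V - K). ennreal (\<Lambda> \<psi>) + ennreal (\<Lambda> \<phi>)) \<le> content V"
        by (rule SUP_least)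
      moreover have "below (V - K) \<noteq> {}" using zero_below by blast
      ultimately show ?thesis
        unfolding content_def[of "V - K"] by (simp add: ennreal_SUP_add_left)
    qed
    ultimately show ?thesis
      by (metis add.commute add_left_mono order_trans)
  qed
  then have "(SUP \<phi>\<in>below (V \<inter> U). ennreal (\<Lambda> \<phi>) + outer (V - U)) \<le> content V"
    by (rule SUP_least)
  moreover have "below (V \<inter> U) \<noteq> {}" using zero_below by blast
  ultimately show ?thesis
    unfolding content_def[of "V \<inter> U"] by (simp add: ennreal_SUP_add_left)
qed

text \<open>Subadditivity gives one half of the criterion. For the other half an arbitrary set is
  replaced by the open sets containing it, since the outer measure is an infimum over these.\<close>

lemma borel_subset_lambda_system: "sets borel \<subseteq> lambda_system UNIV (Pow UNIV) outer"
proof -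
  interpret P: sigma_algebra UNIV "Pow UNIV :: 'a set set" by (rule sigma_algebra_Pow)
  have "measure_space UNIV (lambda_system UNIV (Pow UNIV) outer) outer"
    by (rule P.caratheodory_lemma[OF outer_measure_space_outer])
  then interpret L: sigma_algebra UNIV "lambda_system UNIV (Pow UNIV) outer"
    unfolding measure_space_def by blast
  have "U \<in> lambda_system UNIV (Pow UNIV) outer" if "open U" for U
  proof -
    have "outer (A \<inter> U) + outer (A - U) = outer A" for A
    proof (rule antisym)
      show "outer (A \<inter> U) + outer (A - U) \<le> outer A"
        unfolding outer_def[of A]
      proof (rule INF_greatest)
        fix V assume "V \<in> {V. open V \<and> A \<subseteq> V}"
        then have V: "open V" "A \<subseteq> V" by auto
        have "outer (A \<inter> U) \<le> content (V \<inter> U)" "outer (A - U) \<le> outer (V - U)"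
          unfolding outer_open[OF open_Int[OF V(1) that], symmetric]
          using V(2) by (auto intro!: outer_mono)
        then show "outer (A \<inter> U) + outer (A - U) \<le> content V"
          using content_add_outer[OF that V(1)] add_mono order_trans by blast
      qed
      have "A = A \<inter> U \<union> (A - U)" by blast
      then show "outer A \<le> outer (A \<inter> U) + outer (A - U)"
        using outer_Un by metis
    qed
    then show ?thesis
      by (simp add: lambda_system_def Int_commute Diff_eq)
  qed
  then show ?thesis
    using L.sigma_sets_subset[of "Collect open"] unfolding borel_def by auto
qed

text \<open>Built on the whole space and then cut down, because \<open>represents\<close> asks for
  the Borel sets restricted to \<Omega>.\<close>

definition riesz_measure :: "'a measure" where
  "riesz_measure = restrict_space (measure_of UNIV (sets borel) outer) \<Omega>"

lemma emeasure_borel_outer: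
  assumes "A \<in> sets borel"
  shows "emeasure (measure_of UNIV (sets borel) outer) A = outer A"
proof -
  interpret P: sigma_algebra UNIV "Pow UNIV :: 'a set set" by (rule sigma_algebra_Pow)
  have "sigma_algebra UNIV (sets (borel :: 'a measure))"
    using sets.sigma_algebra_axioms[of "borel :: 'a measure"] by simp
  then have "measure_space UNIV (sets borel) outer"
    by (rule measure_down[OF P.caratheodory_lemma[OF outer_measure_space_outer] _ borel_subset_lambda_system])
  then show ?thesis
    using assms unfolding measure_space_def by (intro emeasure_measure_of_sigma) blast+
qed

lemma sets_riesz_measure: "sets riesz_measure = sets (restrict_space borel \<Omega>)"
  unfolding riesz_measure_def
  using sets.sigma_sets_eq[of "borel :: 'a measure"] by (intro sets_restrict_space_cong) simp

lemma emeasure_riesz_measure_open: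
  assumes "open U" "U \<subseteq> \<Omega>"
  shows "emeasure riesz_measure U = content U"
  unfolding riesz_measure_def
  using assms open_domain
  by (subst emeasure_restrict_space) (auto simp: emeasure_borel_outer outer_open)

text \<open>With \<open>content_upper\<close> this squeezes the content of an open set between the
  values at a function with bounds 0 and 1 supported in it and at a nonnegative function that is at
  least 1 on it. The comparison with the integral rests on this squeeze.\<close>

lemma content_le:
  assumes "\<psi> \<in> test_functions \<Omega>" "\<And>x. \<psi> x \<ge> 0" "\<And>x. x \<in> U \<Longrightarrow> \<psi> x \<ge> 1"
  shows "content U \<le> ennreal (\<Lambda> \<psi>)"
  unfolding content_def
proof (rule SUP_least)
  fix \<phi> assume \<phi>: "\<phi> \<in> below U"
  have "\<phi> x \<le> \<psi> x" for x
  proof (cases "x \<in> U")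
    case True
    then show ?thesis using \<phi> assms(3) order_trans by (fastforce simp: below_def)
  next
    case False
    then have "\<phi> x = 0" using \<phi> by (auto simp: below_def test_functions_def)
    then show ?thesis using assms(2) by simp
  qed
  then show "ennreal (\<Lambda> \<phi>) \<le> ennreal (\<Lambda> \<psi>)"
    by (intro ennreal_leI mono below_test[OF \<phi>] assms)
qed

lemma emeasure_riesz_measure_compact:
  assumes "compact K" "K \<subseteq> \<Omega>"
  shows "emeasure riesz_measure K < \<infinity>"
proof -
  obtain \<eta> V where \<eta>: "\<eta> \<in> test_functions \<Omega>" "\<And>x. 0 \<le> \<eta> x" "\<And>x. \<eta> x \<le> 1"
    "open V" "K \<subseteq> V" "\<And>x. x \<in> V \<Longrightarrow> \<eta> x = 1"
    using smooth_urysohn[OF assms(1) open_domain assms(2)] by blast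
  have "V \<inter> \<Omega> \<in> sets riesz_measure"
    using \<eta>(4) open_domain by (auto simp: sets_riesz_measure sets_restrict_space_iff)
  then have "emeasure riesz_measure K \<le> emeasure riesz_measure (V \<inter> \<Omega>)"
    using \<eta>(5) assms(2) by (intro emeasure_mono) auto
  also have "\<dots> = content (V \<inter> \<Omega>)"
    using \<eta>(4) open_domain by (intro emeasure_riesz_measure_open) auto
  also have "\<dots> \<le> ennreal (\<Lambda> \<eta>)"
    using \<eta> by (intro content_le) auto
  finally show ?thesis
    by (simp add: le_less_trans)
qed

end

text \<open>
  The idea is to cut \<open>n \<phi>\<close> into the layers \<open>s (n \<phi> - k)\<close>, where \<open>s\<close> is a smooth step.  The layers with
  indices \<open>k + 2\<close> and \<open>k\<close> are separated by an open set, so \<open>cross\<close> applies to them, and the shift by two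
  costs an error that is bounded independently of \<open>n\<close>.
\<close>

lemma positive_functional_compare:
  assumes I1: "positive_functional \<Omega> I1" and I2: "positive_functional \<Omega> I2"
    and cross: "\<And>U \<phi> \<psi>. open U \<Longrightarrow> U \<subseteq> \<Omega> \<Longrightarrow> \<phi> \<in> test_functions U \<Longrightarrow> (\<And>x. 0 \<le> \<phi> x) \<Longrightarrow> (\<And>x. \<phi> x \<le> 1) \<Longrightarrow>
      \<psi> \<in> test_functions \<Omega> \<Longrightarrow> (\<And>x. 0 \<le> \<psi> x) \<Longrightarrow> (\<And>x. x \<in> U \<Longrightarrow> 1 \<le> \<psi> x) \<Longrightarrow> I1 \<phi> \<le> I2 \<psi>"
    and \<phi>: "\<phi> \<in> test_functions \<Omega>" "\<And>x. 0 \<le> \<phi> x"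
  shows "I1 \<phi> \<le> I2 \<phi>"
proof -
  interpret I1: positive_functional \<Omega> I1 by fact
  interpret I2: positive_functional \<Omega> I2 by fact
  have *: "I1 \<phi> \<le> I2 \<phi>" if \<phi>: "\<phi> \<in> test_functions \<Omega>" "\<And>x. 0 \<le> \<phi> x" "\<And>x. \<phi> x \<le> 1" for \<phi>
  proof -
    obtain K where K: "compact K" "K \<subseteq> \<Omega>" "\<And>x. x \<notin> K \<Longrightarrow> \<phi> x = 0" "smooth \<phi>"
      using \<phi>(1) unfolding test_functions_def by blast
    obtain \<eta> V where \<eta>: "\<eta> \<in> test_functions \<Omega>" "\<And>x. 0 \<le> \<eta> x" "\<And>x. \<eta> x \<le> 1"
      "open V" "K \<subseteq> V" "\<And>x. x \<in> V \<Longrightarrow> \<eta> x = 1"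
      using smooth_urysohn[OF K(1) I1.open_domain K(2)] by blast
    \<comment> \<open>Of the three copies of \<open>I1 \<eta>\<close>, one pays for replacing n
      \<phi> by the sum of the layers and two pay for the layers 0 and 1, which have no partner two
      steps below. \<open>I2 \<eta>\<close> pays for the return from layers to n \<phi>.\<close>
    have bound: "real n * (I1 \<phi> - I2 \<phi>) \<le> 3 * I1 \<eta> + I2 \<eta>" for n :: nat
    proof -
      define \<psi> where "\<psi> = (\<lambda>(k::nat) x. smooth_step (real n * \<phi> x + - real k))"
      have s: "smooth (\<psi> k)" for k
        unfolding \<psi>_def by (rule smooth_compose[OF smooth_compose[OF smooth_step(1) smooth_affine] K(4)])
      have z: "\<psi> k x = 0" if "x \<notin> K" for k x
        using K(3)[OF that] by (simp add: \<psi>_def smooth_step)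
      have b: "0 \<le> \<psi> k x" "\<psi> k x \<le> 1" for k x by (simp_all add: \<psi>_def smooth_step)
      have t: "\<psi> k \<in> test_functions \<Omega>" for k
        unfolding test_functions_def using s z K by blast
      have le: "\<psi> k x \<le> \<eta> x" for k x
        using z[of x k] b[of k x] \<eta>(2,5,6) by (cases "x \<in> K") auto
      define f where "f = (\<lambda>x. \<Sum>k<n. \<psi> k x)"
      have f: "f \<in> test_functions \<Omega>" unfolding f_def by (intro test_functions_sum t)
      have layers: "f x \<le> real n * \<phi> x + \<eta> x" "real n * \<phi> x \<le> f x + \<eta> x" for x
      proof -
        have "f x \<le> real n * \<phi> x + \<eta> x \<and> real n * \<phi> x \<le> f x + \<eta> x"
        proof (cases "x \<in> K")
          case True
          then have 1: "\<eta> x = 1" using \<eta> by auto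
          \<comment> \<open>The layers below \<open>j\<close> are 1, layer \<open>j\<close> is
            partial and the later ones are 0, so both \<open>f x\<close> and n \<phi>(x) lie in
            [j, j + 1].\<close>
          define j where "j = nat \<lfloor>real n * \<phi> x\<rfloor>"
          have j: "real j \<le> real n * \<phi> x" "real n * \<phi> x < real j + 1"
            using \<phi>(2)[of x] unfolding j_def by (simp_all add: of_nat_nat)
          have "real n * \<phi> x \<le> real n" using \<phi>(3)[of x] by (simp add: mult_left_le)
          then have "j \<le> n" using j by linarith
          then have "real j = (\<Sum>k<j. 1)" by simp
          also have "\<dots> \<le> (\<Sum>k<j. \<psi> k x)"
          proof (rule sum_mono)
            fix k assume "k \<in> {..<j}"
            then have "real n * \<phi> x + - real k \<ge> 1" using j(1) by auto
            then show "1 \<le> \<psi> k x" by (simp add: \<psi>_def smooth_step)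
          qed
          also have "\<dots> \<le> f x"
            unfolding f_def using \<open>j \<le> n\<close> b by (intro sum_mono2) auto
          finally have A: "real j \<le> f x" .
          have "f x \<le> (\<Sum>k<n. if k \<le> j then 1 else 0)"
            unfolding f_def
          proof (rule sum_mono)
            fix k assume "k \<in> {..<n}"
            show "\<psi> k x \<le> (if k \<le> j then 1 else 0)"
            proof (cases "k \<le> j")
              case False
              then have "real n * \<phi> x + - real k \<le> 0" using j(2) by linarith
              then show ?thesis using False by (simp add: \<psi>_def smooth_step)
            qed (use b in auto)
          qed
          also have "\<dots> = real (card ({..<n} \<inter> {k. k \<le> j}))"
            by (simp add: sum.If_cases)
          also have "\<dots> \<le> real (card {..j})"
            by (intro of_nat_mono card_mono) auto
          finally have B: "f x \<le> real j + 1" by simp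
          show ?thesis using A B j 1 by linarith
        next
          case False
          then show ?thesis using z K(3) \<eta>(2) by (simp add: f_def)
        qed
        then show "f x \<le> real n * \<phi> x + \<eta> x" "real n * \<phi> x \<le> f x + \<eta> x" by auto
      qed
      have "real n * I1 \<phi> = I1 (\<lambda>x. real n * \<phi> x)" using I1.cmul[OF \<phi>(1)] by simp
      also have "\<dots> \<le> I1 (\<lambda>x. f x + \<eta> x)"
        by (intro I1.mono test_functions_cmul test_functions_add f \<eta> \<phi> layers)
      also have "\<dots> = I1 f + I1 \<eta>" by (rule I1.add[OF f \<eta>(1)])
      also have "I1 f = (\<Sum>k<n. I1 (\<psi> k))" unfolding f_def by (rule I1.sum[OF t])
      finally have 1: "real n * I1 \<phi> \<le> (\<Sum>k<n. I1 (\<psi> k)) + I1 \<eta>" .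
      have "(\<Sum>k<n. I2 (\<psi> k)) = I2 f" unfolding f_def by (rule I2.sum[OF t, symmetric])
      also have "\<dots> \<le> I2 (\<lambda>x. real n * \<phi> x + \<eta> x)"
        by (intro I2.mono test_functions_cmul test_functions_add f \<eta> \<phi> layers)
      also have "\<dots> = real n * I2 \<phi> + I2 \<eta>"
        using I2.add[OF test_functions_cmul[OF \<phi>(1)] \<eta>(1)] I2.cmul[OF \<phi>(1)] by simp
      finally have 2: "(\<Sum>k<n. I2 (\<psi> k)) \<le> real n * I2 \<phi> + I2 \<eta>" .
      \<comment> \<open>Two nonnegative terms are added so that n of them remain after the shift by
        two.\<close>
      have "(\<Sum>k<n. I1 (\<psi> k)) \<le> (\<Sum>k<Suc (Suc n). I1 (\<psi> k))"
        using I1.nonneg[OF t b(1)] by simp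
      also have "\<dots> = I1 (\<psi> 0) + (I1 (\<psi> 1) + (\<Sum>k<n. I1 (\<psi> (Suc (Suc k)))))"
        by (simp add: sum.lessThan_Suc_shift del: sum.lessThan_Suc)
      also have "\<dots> \<le> I1 \<eta> + (I1 \<eta> + (\<Sum>k<n. I2 (\<psi> k)))"
      proof (intro add_mono sum_mono)
        show "I1 (\<psi> 0) \<le> I1 \<eta>" "I1 (\<psi> 1) \<le> I1 \<eta>" by (intro I1.mono t \<eta> le)+
        fix k
        \<comment> \<open>Layer k + 2 is supported where n \<phi> \<ge> k + 2, a compact part of
          this set, while layer k is already 1 on all of it.\<close>
        define U where "U = {x. real k + 1 < real n * \<phi> x} \<inter> \<Omega>"
        have cont: "continuous_on UNIV (\<lambda>x. real n * \<phi> x)"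
          by (intro continuous_intros smooth_continuous_on K)
        show "I1 (\<psi> (Suc (Suc k))) \<le> I2 (\<psi> k)"
        proof (rule cross[of U])
          show "open U"
            unfolding U_def by (intro open_Int I1.open_domain open_Collect_less cont continuous_on_const)
          define L where "L = K \<inter> {x. real k + 2 \<le> real n * \<phi> x}"
          have "compact L"
            unfolding L_def by (intro compact_Int_closed K closed_Collect_le cont continuous_on_const)
          moreover have "L \<subseteq> U" using K(2) by (auto simp: L_def U_def)
          moreover have "\<psi> (Suc (Suc k)) x = 0" if "x \<notin> L" for x
          proof (cases "x \<in> K")
            case True
            then show ?thesis using that by (simp add: L_def \<psi>_def smooth_step)
          qed (rule z)
          ultimately show "\<psi> (Suc (Suc k)) \<in> test_functions U"
            unfolding test_functions_def using s by blast
          show "1 \<le> \<psi> k x" if "x \<in> U" for x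
            using that by (simp add: U_def \<psi>_def smooth_step)
        qed (use b t in \<open>auto simp: U_def\<close>)
      qed
      finally show ?thesis using 1 2 by (simp add: algebra_simps)
    qed
    show ?thesis
    proof (rule ccontr)
      assume "\<not> ?thesis"
      then have "I1 \<phi> - I2 \<phi> > 0" by simp
      then obtain n :: nat where "3 * I1 \<eta> + I2 \<eta> < real n * (I1 \<phi> - I2 \<phi>)"
        using reals_Archimedean3 by blast
      then show False using bound[of n] by simp
    qed
  qed
  obtain B where B: "B > 0" "\<And>x. \<bar>\<phi> x\<bar> \<le> B"
    using test_functions_bounded[OF \<phi>(1)] by blast
  have "1 / B * \<phi> x \<le> 1" for x
    using B(1) B(2)[of x] by (simp add: field_simps)
  then have "I1 (\<lambda>x. 1 / B * \<phi> x) \<le> I2 (\<lambda>x. 1 / B * \<phi> x)"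
    using \<phi> B by (intro * test_functions_cmul) auto
  then show ?thesis
    unfolding I1.cmul[OF \<phi>(1)] I2.cmul[OF \<phi>(1)] using B(1) by (simp add: divide_le_cancel)
qed

lemma
  fixes M :: "'a::euclidean_space measure"
  assumes sets: "sets M = sets (restrict_space borel \<Omega>)" and "open \<Omega>"
    and fin: "\<And>K. compact K \<Longrightarrow> K \<subseteq> \<Omega> \<Longrightarrow> emeasure M K < \<infinity>"
  shows integrable_test_function: "\<phi> \<in> test_functions \<Omega> \<Longrightarrow> integrable M \<phi>"
    and positive_functional_integral: "positive_functional \<Omega> (\<lambda>\<phi>. \<integral>x. \<phi> x \<partial>M)"
proof -
  show *: "integrable M \<phi>" if \<phi>: "\<phi> \<in> test_functions \<Omega>" for \<phi>
  proof -
    obtain K where K: "compact K" "K \<subseteq> \<Omega>" "\<And>x. x \<notin> K \<Longrightarrow> \<phi> x = 0" "smooth \<phi>"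
      using \<phi> unfolding test_functions_def by blast
    obtain B where B: "B > 0" "\<And>x. \<bar>\<phi> x\<bar> \<le> B"
      using test_functions_bounded[OF \<phi>] by blast
    have "\<phi> \<in> borel_measurable borel"
      by (intro borel_measurable_continuous_onI smooth_continuous_on K)
    then have "\<phi> \<in> borel_measurable (restrict_space borel \<Omega>)"
      by (rule measurable_restrict_space1)
    then have "\<phi> \<in> borel_measurable M"
      by (subst measurable_cong_sets[OF sets refl])
    moreover have "K \<in> sets M"
      unfolding sets using K \<open>open \<Omega>\<close> by (simp add: sets_restrict_space_iff compact_imp_closed)
    ultimately show ?thesis
      by (intro integrableI_bounded_set[where A=K and B=B]) (simp_all add: B K(3) fin[OF K(1,2), simplified])
  qed
  show "positive_functional \<Omega> (\<lambda>\<phi>. \<integral>x. \<phi> x \<partial>M)"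
    by unfold_locales (simp_all add: * \<open>open \<Omega>\<close> Bochner_Integration.integral_nonneg)
qed

text \<open>Both inequalities are instances of \<open>positive_functional_compare\<close>, with the
  measure of an open set between the two sides. A signed \<phi> is made nonnegative by adding
  \<open>B * \<eta>\<close>, where \<eta> is 1 on its support.\<close>

lemma (in positive_functional) riesz_representation:
  assumes "\<phi> \<in> test_functions \<Omega>"
  shows "\<Lambda> \<phi> = (\<integral>x. \<phi> x \<partial>riesz_measure)"
proof -
  let ?M = riesz_measure
  note M = sets_riesz_measure open_domain emeasure_riesz_measure_compact
  interpret I: positive_functional \<Omega> "\<lambda>\<phi>. \<integral>x. \<phi> x \<partial>?M"
    by (rule positive_functional_integral[OF M])
  have nn: "(\<integral>\<^sup>+x. ennreal (\<psi> x) \<partial>?M) = ennreal (\<integral>x. \<psi> x \<partial>?M)"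
    if "\<psi> \<in> test_functions \<Omega>" "\<And>x. 0 \<le> \<psi> x" for \<psi>
    using integrable_test_function[OF M that(1)] that(2) by (intro nn_integral_eq_integral) auto
  have U: "U \<in> sets ?M" if "open U" "U \<subseteq> \<Omega>" for U
    using that open_domain by (auto simp: sets_riesz_measure sets_restrict_space_iff)
  have le: "\<Lambda> \<phi> \<le> (\<integral>x. \<phi> x \<partial>?M)" if "\<phi> \<in> test_functions \<Omega>" "\<And>x. 0 \<le> \<phi> x" for \<phi>
  proof (rule positive_functional_compare[OF positive_functional_axioms I.positive_functional_axioms _ that])
    fix U \<phi> \<psi> assume *: "open U" "U \<subseteq> \<Omega>" "\<phi> \<in> test_functions U" "\<And>x. 0 \<le> \<phi> x" "\<And>x. \<phi> x \<le> 1"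
      "\<psi> \<in> test_functions \<Omega>" "\<And>x. 0 \<le> \<psi> x" "\<And>x. x \<in> U \<Longrightarrow> 1 \<le> \<psi> x"
    have "\<Omega> \<inter> U = U" using *(2) by blast
    then have "ennreal (\<Lambda> \<phi>) \<le> content U"
      using * by (intro content_upper) (simp add: below_def)
    also have "\<dots> = emeasure ?M U" using emeasure_riesz_measure_open * by simp
    also have "\<dots> = (\<integral>\<^sup>+x. indicator U x \<partial>?M)" using U * by simp
    also have "\<dots> \<le> (\<integral>\<^sup>+x. ennreal (\<psi> x) \<partial>?M)"
      using *(7,8) by (intro nn_integral_mono) (auto simp: indicator_def)
    also have "\<dots> = ennreal (\<integral>x. \<psi> x \<partial>?M)" by (rule nn) fact+
    finally show "\<Lambda> \<phi> \<le> (\<integral>x. \<psi> x \<partial>?M)"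
      using I.nonneg[OF *(6,7)] by (simp add: ennreal_le_iff)
  qed
  have ge: "(\<integral>x. \<phi> x \<partial>?M) \<le> \<Lambda> \<phi>" if "\<phi> \<in> test_functions \<Omega>" "\<And>x. 0 \<le> \<phi> x" for \<phi>
  proof (rule positive_functional_compare[OF I.positive_functional_axioms positive_functional_axioms _ that])
    fix U \<phi> \<psi> assume *: "open U" "U \<subseteq> \<Omega>" "\<phi> \<in> test_functions U" "\<And>x. 0 \<le> \<phi> x" "\<And>x. \<phi> x \<le> 1"
      "\<psi> \<in> test_functions \<Omega>" "\<And>x. 0 \<le> \<psi> x" "\<And>x. x \<in> U \<Longrightarrow> 1 \<le> \<psi> x"
    have "\<phi> \<in> test_functions \<Omega>" using *(2,3) test_functions_mono by blast
    then have "ennreal (\<integral>x. \<phi> x \<partial>?M) = (\<integral>\<^sup>+x. ennreal (\<phi> x) \<partial>?M)" using nn *(4) by simp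
    also have "\<dots> \<le> (\<integral>\<^sup>+x. indicator U x \<partial>?M)"
      using *(3,4,5) by (intro nn_integral_mono) (auto simp: indicator_def test_functions_def)
    also have "\<dots> = emeasure ?M U" using U * by simp
    also have "\<dots> = content U" using emeasure_riesz_measure_open * by simp
    also have "\<dots> \<le> ennreal (\<Lambda> \<psi>)" by (rule content_le) fact+
    finally show "(\<integral>x. \<phi> x \<partial>?M) \<le> \<Lambda> \<psi>"
      using nonneg[OF *(6,7)] by (simp add: ennreal_le_iff)
  qed
  have eq: "\<Lambda> \<phi> = (\<integral>x. \<phi> x \<partial>?M)" if "\<phi> \<in> test_functions \<Omega>" "\<And>x. 0 \<le> \<phi> x" for \<phi>
    using le[OF that] ge[OF that] by simp
  obtain K where K: "compact K" "K \<subseteq> \<Omega>" "\<And>x. x \<notin> K \<Longrightarrow> \<phi> x = 0"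
    using assms unfolding test_functions_def by blast
  obtain B where B: "B > 0" "\<And>x. \<bar>\<phi> x\<bar> \<le> B"
    using test_functions_bounded[OF assms] by blast
  obtain \<eta> V where \<eta>: "\<eta> \<in> test_functions \<Omega>" "\<And>x. 0 \<le> \<eta> x" "\<And>x. \<eta> x \<le> 1"
    "open V" "K \<subseteq> V" "\<And>x. x \<in> V \<Longrightarrow> \<eta> x = 1"
    using smooth_urysohn[OF K(1) open_domain K(2)] by blast
  have B\<eta>: "(\<lambda>x. B * \<eta> x) \<in> test_functions \<Omega>" by (rule test_functions_cmul[OF \<eta>(1)])
  have pos: "0 \<le> \<phi> x + B * \<eta> x" for x
  proof (cases "x \<in> K")
    case True
    then show ?thesis using B(2)[of x] \<eta>(5,6) by auto
  qed (use K(3) B(1) \<eta>(2) in auto)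
  have "\<Lambda> (\<lambda>x. \<phi> x + B * \<eta> x) = (\<integral>x. \<phi> x + B * \<eta> x \<partial>?M)"
    by (rule eq[OF test_functions_add[OF assms B\<eta>] pos])
  moreover have "\<Lambda> (\<lambda>x. B * \<eta> x) = (\<integral>x. B * \<eta> x \<partial>?M)"
    using B(1) \<eta>(2) by (intro eq B\<eta>) auto
  ultimately show ?thesis
    using add[OF assms B\<eta>] I.add[OF assms B\<eta>] by simp
qed

text \<open>Exhaustion by compact sets shows that the measure of an open set is the supremum of the
  integrals of test functions between 0 and 1 supported in it. The open subsets of \<Omega> form an
  intersection-stable generator, and interiors of an exhaustion of \<Omega> supply sets of finite
  measure.\<close>

lemma measure_eqI_test_functions:
  fixes M N :: "'a::euclidean_space measure"
  assumes "open \<Omega>"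
    and M: "sets M = sets (restrict_space borel \<Omega>)" "\<And>K. compact K \<Longrightarrow> K \<subseteq> \<Omega> \<Longrightarrow> emeasure M K < \<infinity>"
    and N: "sets N = sets (restrict_space borel \<Omega>)" "\<And>K. compact K \<Longrightarrow> K \<subseteq> \<Omega> \<Longrightarrow> emeasure N K < \<infinity>"
    and eq: "\<And>\<phi>. \<phi> \<in> test_functions \<Omega> \<Longrightarrow> (\<integral>x. \<phi> x \<partial>M) = (\<integral>x. \<phi> x \<partial>N)"
  shows "M = N"
proof -
  have emeasure_open: "emeasure P U = (SUP \<phi>\<in>{\<phi> \<in> test_functions U. \<forall>x. 0 \<le> \<phi> x \<and> \<phi> x \<le> 1}. ennreal (\<integral>x. \<phi> x \<partial>P))"
    (is "_ = ?S")
    if P: "sets P = sets (restrict_space borel \<Omega>)" "\<And>K. compact K \<Longrightarrow> K \<subseteq> \<Omega> \<Longrightarrow> emeasure P K < \<infinity>"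
      and U: "open U" "U \<subseteq> \<Omega>" for P :: "'a measure" and U
  proof -
    have sb: "A \<in> sets P" if "A \<in> sets borel" "A \<subseteq> \<Omega>" for A
      using that \<open>open \<Omega>\<close> by (auto simp: P(1) sets_restrict_space_iff)
    have nn: "(\<integral>\<^sup>+x. ennreal (\<psi> x) \<partial>P) = ennreal (\<integral>x. \<psi> x \<partial>P)"
      if "\<psi> \<in> test_functions U" "\<And>x. 0 \<le> \<psi> x" for \<psi>
      using integrable_test_function[OF P(1) \<open>open \<Omega>\<close> P(2), of \<psi>] that test_functions_mono[OF U(2)]
      by (intro nn_integral_eq_integral) auto
    have Us: "U \<in> sets P" using U by (intro sb) auto
    show ?thesis
    proof (rule antisym)
      obtain C where C: "\<And>n. compact (C n)" "\<And>n. C n \<subseteq> U" "\<And>n. C n \<subseteq> interior (C (Suc n))"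
        "\<Union>(range C) = U"
        using open_Union_compact_subsets[OF U(1)] by metis
      have Cs: "range C \<subseteq> sets P" using C(1,2) U by (auto intro!: sb borel_compact)
      have "incseq C"
        using C(3) interior_subset by (intro incseq_SucI) blast
      then have "emeasure P U = (SUP n. emeasure P (C n))"
        using SUP_emeasure_incseq[OF Cs] C(4) by simp
      also have "\<dots> \<le> ?S"
      proof (rule SUP_least)
        fix n
        obtain \<eta> V where \<eta>: "\<eta> \<in> test_functions U" "\<And>x. 0 \<le> \<eta> x" "\<And>x. \<eta> x \<le> 1"
          "open V" "C n \<subseteq> V" "\<And>x. x \<in> V \<Longrightarrow> \<eta> x = 1"
          using smooth_urysohn[OF C(1) U(1) C(2)] by blast
        have "emeasure P (C n) = (\<integral>\<^sup>+x. indicator (C n) x \<partial>P)"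
          using Cs by (subst nn_integral_indicator) auto
        also have "\<dots> \<le> (\<integral>\<^sup>+x. ennreal (\<eta> x) \<partial>P)"
          using \<eta> by (intro nn_integral_mono) (auto simp: indicator_def)
        also have "\<dots> = ennreal (\<integral>x. \<eta> x \<partial>P)" by (rule nn[OF \<eta>(1,2)])
        also have "\<dots> \<le> ?S" using \<eta> by (intro SUP_upper) auto
        finally show "emeasure P (C n) \<le> ?S" .
      qed
      finally show "emeasure P U \<le> ?S" .
    next
      show "?S \<le> emeasure P U"
      proof (rule SUP_least, clarify)
        fix \<phi> assume \<phi>: "\<phi> \<in> test_functions U" "\<forall>x. 0 \<le> \<phi> x \<and> \<phi> x \<le> 1"
        then have "ennreal (\<integral>x. \<phi> x \<partial>P) = (\<integral>\<^sup>+x. ennreal (\<phi> x) \<partial>P)" by (simp add: nn)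
        also have "\<dots> \<le> (\<integral>\<^sup>+x. indicator U x \<partial>P)"
          using \<phi> by (intro nn_integral_mono) (auto simp: indicator_def test_functions_def)
        also have "\<dots> = emeasure P U" using Us by simp
        finally show "ennreal (\<integral>x. \<phi> x \<partial>P) \<le> emeasure P U" .
      qed
    qed
  qed
  define E where "E = {U. open U \<and> U \<subseteq> \<Omega>}"
  have "(\<inter>) \<Omega> ` sigma_sets UNIV (Collect open) = sigma_sets \<Omega> ((\<inter>) \<Omega> ` Collect open)"
    by (rule sigma_sets_Int) (use \<open>open \<Omega>\<close> in auto)
  moreover have "(\<inter>) \<Omega> ` Collect open = E"
  proof (intro equalityI subsetI)
    fix U assume "U \<in> E"
    then have "U = \<Omega> \<inter> U" "open U" by (auto simp: E_def)
    then show "U \<in> (\<inter>) \<Omega> ` Collect open" by blast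
  qed (use \<open>open \<Omega>\<close> in \<open>auto simp: E_def\<close>)
  ultimately have gen: "sets (restrict_space borel \<Omega>) = sigma_sets \<Omega> E"
    unfolding sets_restrict_space borel_def by simp
  obtain C where C: "\<And>n. compact (C n)" "\<And>n. C n \<subseteq> \<Omega>" "\<And>n. C n \<subseteq> interior (C (Suc n))"
    "\<Union>(range C) = \<Omega>"
    using open_Union_compact_subsets[OF \<open>open \<Omega>\<close>] by metis
  show ?thesis
  proof (rule measure_eqI_generator_eq[where E=E and \<Omega>=\<Omega> and A="\<lambda>n. interior (C n)"])
    show "Int_stable E" "E \<subseteq> Pow \<Omega>" by (auto simp: E_def Int_stable_def)
    show "emeasure M X = emeasure N X" if "X \<in> E" for X
    proof -
      have X: "open X" "X \<subseteq> \<Omega>" using that by (auto simp: E_def)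
      have "(\<integral>x. \<phi> x \<partial>M) = (\<integral>x. \<phi> x \<partial>N)" if "\<phi> \<in> test_functions X" for \<phi>
        using eq that test_functions_mono[OF X(2)] by blast
      then show ?thesis
        using emeasure_open[OF M X] emeasure_open[OF N X] by simp
    qed
    show "sets M = sigma_sets \<Omega> E" "sets N = sigma_sets \<Omega> E" using M(1) N(1) gen by auto
    show "range (\<lambda>n. interior (C n)) \<subseteq> E"
      using C(2) interior_subset by (fastforce simp: E_def)
    show "(\<Union>n. interior (C n)) = \<Omega>"
      using C(3,4) interior_subset C(2) by blast
    have "C n \<in> sets M" for n
      using C(1,2) \<open>open \<Omega>\<close> by (auto simp: M(1) sets_restrict_space_iff compact_imp_closed)
    then show "emeasure M (interior (C n)) \<noteq> \<infinity>" for n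
      using emeasure_mono[OF interior_subset, of "C n" M] M(2)[OF C(1,2), of n] by auto
  qed
qed

subsection \<open>The exterior algebra\<close>

lemma wedge_nth:
  "(\<alpha> \<and>\<^sub>E \<omega>) $ (K, L) = (\<Sum>I\<in>Pow K. \<Sum>J\<in>Pow L.
        (-1) ^ (card J * card (K - I)) * shuffle_sign I (K - I) * shuffle_sign J (L - J)
        * \<alpha> $ (I, J) * \<omega> $ (K - I, L - J))"
  by (simp add: wedge_def)

lemma ext_eqI:
  fixes \<alpha> \<omega> :: "'n::{finite,linorder} ext"
  assumes "\<And>K L. \<alpha> $ (K, L) = \<omega> $ (K, L)"
  shows "\<alpha> = \<omega>"
  using assms by (simp add: vec_eq_iff)

lemma wedge_add_left: "(\<alpha> + \<alpha>') \<and>\<^sub>E \<omega> = \<alpha> \<and>\<^sub>E \<omega> + \<alpha>' \<and>\<^sub>E \<omega>"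
  by (rule ext_eqI) (simp add: wedge_nth algebra_simps sum.distrib)

lemma wedge_add_right: "\<alpha> \<and>\<^sub>E (\<omega> + \<omega>') = \<alpha> \<and>\<^sub>E \<omega> + \<alpha> \<and>\<^sub>E \<omega>'"
  by (rule ext_eqI) (simp add: wedge_nth algebra_simps sum.distrib)

lemma wedge_scale_left: "(c *s \<alpha>) \<and>\<^sub>E \<omega> = c *s (\<alpha> \<and>\<^sub>E \<omega>)"
  by (rule ext_eqI) (simp add: wedge_nth sum_distrib_left mult_ac)

lemma wedge_scale_right: "\<alpha> \<and>\<^sub>E (c *s \<omega>) = c *s (\<alpha> \<and>\<^sub>E \<omega>)"
  by (rule ext_eqI) (simp add: wedge_nth sum_distrib_left mult_ac)

lemma wedge_zero_left: "0 \<and>\<^sub>E \<omega> = 0"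
  by (rule ext_eqI) (simp add: wedge_nth)

lemma wedge_zero_right: "\<alpha> \<and>\<^sub>E 0 = 0"
  by (rule ext_eqI) (simp add: wedge_nth)

lemma wedge_sum_left: "(\<Sum>i\<in>S. f i) \<and>\<^sub>E \<omega> = (\<Sum>i\<in>S. f i \<and>\<^sub>E \<omega>)"
  by (induction S rule: infinite_finite_induct) (simp_all add: wedge_zero_left wedge_add_left)

lemma wedge_sum_right: "\<alpha> \<and>\<^sub>E (\<Sum>i\<in>S. f i) = (\<Sum>i\<in>S. \<alpha> \<and>\<^sub>E f i)"
  by (induction S rule: infinite_finite_induct) (simp_all add: wedge_zero_right wedge_add_right)

lemma scale_sum_right: "c *s (\<Sum>i\<in>S. f i) = (\<Sum>i\<in>S. c *s (f i :: complex ^ 'k))"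
  by (induction S rule: infinite_finite_induct) (simp_all add: vector_add_ldistrib)

lemma finite_inversions: "finite {(i, i'). i \<in> I \<and> i' \<in> I' \<and> i' < (i::'n::{finite,linorder})}"
  by (rule finite_subset[OF subset_UNIV]) simp

lemma shuffle_sign_Un_left:
  fixes I I' L :: "'n::{finite,linorder} set"
  assumes "I \<inter> I' = {}"
  shows "shuffle_sign (I \<union> I') L = shuffle_sign I L * shuffle_sign I' L"
proof -
  have "{(i, i'). i \<in> I \<union> I' \<and> i' \<in> L \<and> i' < i}
      = {(i, i'). i \<in> I \<and> i' \<in> L \<and> i' < i} \<union> {(i, i'). i \<in> I' \<and> i' \<in> L \<and> i' < i}" by auto
  moreover have "{(i, i'). i \<in> I \<and> i' \<in> L \<and> i' < i} \<inter> {(i, i'). i \<in> I' \<and> i' \<in> L \<and> i' < i} = {}"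
    using assms by auto
  ultimately show ?thesis
    by (simp only: shuffle_sign_def card_Un_disjoint[OF finite_inversions finite_inversions] power_add)
qed

lemma shuffle_sign_Un_right:
  fixes I I' L :: "'n::{finite,linorder} set"
  assumes "I \<inter> I' = {}"
  shows "shuffle_sign L (I \<union> I') = shuffle_sign L I * shuffle_sign L I'"
proof -
  have "{(i, i'). i \<in> L \<and> i' \<in> I \<union> I' \<and> i' < i}
      = {(i, i'). i \<in> L \<and> i' \<in> I \<and> i' < i} \<union> {(i, i'). i \<in> L \<and> i' \<in> I' \<and> i' < i}" by auto
  moreover have "{(i, i'). i \<in> L \<and> i' \<in> I \<and> i' < i} \<inter> {(i, i'). i \<in> L \<and> i' \<in> I' \<and> i' < i} = {}"
    using assms by auto
  ultimately show ?thesis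
    by (simp only: shuffle_sign_def card_Un_disjoint[OF finite_inversions finite_inversions] power_add)
qed

lemma shuffle_sign_square: "shuffle_sign I I' * shuffle_sign I I' = 1"
  by (simp add: shuffle_sign_def power_mult_distrib[symmetric])

text \<open>Each pair in I \<times> I' is an inversion for exactly one of the two orders, so the two
  inversion counts add up to \<open>card I * card I'\<close>.\<close>

lemma shuffle_sign_swap:
  fixes I I' :: "'n::{finite,linorder} set"
  assumes "I \<inter> I' = {}"
  shows "shuffle_sign I' I = (-1) ^ (card I * card I') * shuffle_sign I I'"
proof -
  let ?A = "{(i, i'). i \<in> I \<and> i' \<in> I' \<and> i' < i}" and ?B = "{(i, i'). i \<in> I' \<and> i' \<in> I \<and> i' < i}"
  have "I \<times> I' = ?A \<union> prod.swap ` ?B"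
    using assms by (auto simp: image_iff not_less_iff_gr_or_eq)
  moreover have "?A \<inter> prod.swap ` ?B = {}" by auto
  moreover have "card (prod.swap ` ?B) = card ?B"
    by (rule card_image) (auto simp: inj_on_def)
  ultimately have "card I * card I' = card ?A + card ?B"
    by (simp only: card_cartesian_product[symmetric] card_Un_disjoint[OF finite_inversions finite_imageI[OF finite_inversions]])
  then have "(-1) ^ (card I * card I') * shuffle_sign I I' = ((-1) ^ card ?A * (-1) ^ card ?A) * (-1::complex) ^ card ?B"
    by (simp only: shuffle_sign_def power_add mult_ac)
  also have "((-1) ^ card ?A * (-1) ^ card ?A) = (1::complex)"
    by (simp add: power_mult_distrib[symmetric])
  finally show ?thesis by (simp add: shuffle_sign_def)
qed

lemma shuffle_sign_empty [simp]: "shuffle_sign {} I = 1" "shuffle_sign I {} = 1"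
  by (simp_all add: shuffle_sign_def)

lemma sum_Pow_delta:
  fixes I J K L :: "'n::finite set"
  shows "(\<Sum>A\<in>Pow K. \<Sum>B\<in>Pow L. if A = I then if B = J then t else 0 else 0)
    = (if I \<subseteq> K \<and> J \<subseteq> L then t else (0::complex))"
proof -
  have "(\<Sum>B\<in>Pow L. if A = I then if B = J then t else 0 else 0) = (if A = I then (if J \<subseteq> L then t else 0) else 0)" for A
    by (cases "A = I") (simp_all add: sum.delta)
  then show ?thesis by (simp add: sum.delta)
qed

text \<open>The multiplication table of the basis monomials. Together with \<open>ext_induct\<close>
  it yields associativity and commutation.\<close>

lemma wedge_axis:
  fixes I J I' J' :: "'n::{finite,linorder} set"
  shows "axis (I, J) a \<and>\<^sub>E axis (I', J') b =
    (if I \<inter> I' = {} \<and> J \<inter> J' = {}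
     then axis (I \<union> I', J \<union> J') ((-1) ^ (card J * card I') * shuffle_sign I I' * shuffle_sign J J' * a * b)
     else 0)"
proof (rule ext_eqI)
  fix K L :: "'n set"
  define t where "t = (\<lambda>A B. (-1) ^ (card B * card (K - A)) * shuffle_sign A (K - A) * shuffle_sign B (L - B)
        * axis (I, J) a $ (A, B) * axis (I', J') b $ (K - A, L - B))"
  have "t A B = 0" if "A \<noteq> I \<or> B \<noteq> J" for A B
    using that by (auto simp: t_def axis_def)
  then have "(\<Sum>A\<in>Pow K. \<Sum>B\<in>Pow L. t A B) = (\<Sum>A\<in>Pow K. \<Sum>B\<in>Pow L. if A = I then if B = J then t I J else 0 else 0)"
    by (intro sum.cong refl) auto
  also have "\<dots> = (if I \<subseteq> K \<and> J \<subseteq> L then t I J else 0)"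
    by (simp add: sum_Pow_delta)
  finally have 1: "(axis (I, J) a \<and>\<^sub>E axis (I', J') b) $ (K, L) = (if I \<subseteq> K \<and> J \<subseteq> L then t I J else 0)"
    unfolding wedge_nth t_def .
  show "(axis (I, J) a \<and>\<^sub>E axis (I', J') b) $ (K, L) =
    (if I \<inter> I' = {} \<and> J \<inter> J' = {}
     then axis (I \<union> I', J \<union> J') ((-1) ^ (card J * card I') * shuffle_sign I I' * shuffle_sign J J' * a * b)
     else 0) $ (K, L)"
  proof (cases "I \<subseteq> K \<and> J \<subseteq> L \<and> K - I = I' \<and> L - J = J'")
    case True
    then have "I \<inter> I' = {} \<and> J \<inter> J' = {}" "K = I \<union> I'" "L = J \<union> J'" by auto
    then show ?thesis using True unfolding 1 by (auto simp: t_def axis_def)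
  next
    case False
    then have "(if I \<subseteq> K \<and> J \<subseteq> L then t I J else 0) = 0"
      by (auto simp: t_def axis_def)
    moreover have "\<not> (I \<inter> I' = {} \<and> J \<inter> J' = {} \<and> I \<union> I' = K \<and> J \<union> J' = L)"
      using False by auto
    ultimately show ?thesis unfolding 1 by (auto simp: axis_def)
  qed
qed

text \<open>Reduces multilinear identities to basis monomials. Only monomials with nonzero
  coefficient have to be treated, so degree conditions on \<alpha> pass to them.\<close>

lemma ext_induct [case_names zero add axis]:
  fixes \<alpha> :: "'n::{finite,linorder} ext"
  assumes "P 0" "\<And>\<alpha> \<omega>. P \<alpha> \<Longrightarrow> P \<omega> \<Longrightarrow> P (\<alpha> + \<omega>)"
    "\<And>I J. \<alpha> $ (I, J) \<noteq> 0 \<Longrightarrow> P (axis (I, J) (\<alpha> $ (I, J)))"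
  shows "P \<alpha>"
proof -
  have "P (\<Sum>x\<in>S. axis x (\<alpha> $ x))" if "finite S" for S
    using that
  proof (induction S)
    case (insert x S)
    have "P (axis x (\<alpha> $ x))"
    proof (cases "\<alpha> $ x = 0")
      case True
      then have "axis x (\<alpha> $ x) = 0" by (simp add: vec_eq_iff axis_def)
      then show ?thesis using assms(1) by metis
    qed (use assms(3) in \<open>cases x; auto\<close>)
    then show ?case using insert assms(2) by simp
  qed (use assms(1) in simp)
  moreover have "(\<Sum>x\<in>UNIV. axis x (\<alpha> $ x)) = \<alpha>"
    by (simp add: vec_eq_iff axis_def sum.delta)
  ultimately show ?thesis
    by (metis finite)
qed

lemma wedge_assoc:
  fixes \<alpha> \<omega> \<eta> :: "'n::{finite,linorder} ext"
  shows "(\<alpha> \<and>\<^sub>E \<omega>) \<and>\<^sub>E \<eta> = \<alpha> \<and>\<^sub>E (\<omega> \<and>\<^sub>E \<eta>)"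
proof (induction \<alpha> rule: ext_induct)
  case (axis I1 J1)
  show ?case
  proof (induction \<omega> rule: ext_induct)
    case (axis I2 J2)
    show ?case
    proof (induction \<eta> rule: ext_induct)
      case (axis I3 J3)
      show ?case
      proof (cases "I1 \<inter> I2 = {} \<and> J1 \<inter> J2 = {} \<and> (I1 \<union> I2) \<inter> I3 = {} \<and> (J1 \<union> J2) \<inter> J3 = {}")
        case True
        then have d: "I1 \<inter> I2 = {}" "J1 \<inter> J2 = {}" "I1 \<inter> I3 = {}" "J1 \<inter> J3 = {}" "I2 \<inter> I3 = {}" "J2 \<inter> J3 = {}"
          "(I1 \<union> I2) \<inter> I3 = {}" "(J1 \<union> J2) \<inter> J3 = {}" "I1 \<inter> (I2 \<union> I3) = {}" "J1 \<inter> (J2 \<union> J3) = {}" by auto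
        show ?thesis
          by (simp add: wedge_axis d shuffle_sign_Un_left shuffle_sign_Un_right card_Un_disjoint Un_assoc
              power_add distrib_left distrib_right mult_ac)
      next
        case False
        let ?A = "axis (I1, J1) (\<alpha> $ (I1, J1))" and ?B = "axis (I2, J2) (\<omega> $ (I2, J2))"
          and ?C = "axis (I3, J3) (\<eta> $ (I3, J3))"
        have "(?A \<and>\<^sub>E ?B) \<and>\<^sub>E ?C = 0"
        proof (cases "I1 \<inter> I2 = {} \<and> J1 \<inter> J2 = {}")
          case True
          then have "\<not> ((I1 \<union> I2) \<inter> I3 = {} \<and> (J1 \<union> J2) \<inter> J3 = {})" using False by blast
          then show ?thesis by (simp only: wedge_axis True if_True if_False simp_thms)
        qed (simp only: wedge_axis if_False wedge_zero_left)
        moreover have "?A \<and>\<^sub>E (?B \<and>\<^sub>E ?C) = 0"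
        proof (cases "I2 \<inter> I3 = {} \<and> J2 \<inter> J3 = {}")
          case True
          then have "\<not> (I1 \<inter> (I2 \<union> I3) = {} \<and> J1 \<inter> (J2 \<union> J3) = {})" using False by blast
          then show ?thesis by (simp only: wedge_axis True if_True if_False simp_thms)
        qed (simp only: wedge_axis if_False wedge_zero_right)
        ultimately show ?thesis by simp
      qed
    qed (simp_all add: wedge_add_right wedge_zero_right)
  qed (simp_all add: wedge_add_right wedge_zero_right wedge_add_left wedge_zero_left)
qed (simp_all add: wedge_add_left wedge_zero_left)

text \<open>These are the sums of forms of bidegree (p, p) with varying p. The forms \<beta> and
  \<theta> and their powers are of this kind, and they commute with every form.\<close>

definition even_form :: "'n::{finite,linorder} ext \<Rightarrow> bool" where
  "even_form \<omega> \<longleftrightarrow> (\<forall>I J. \<omega> $ (I, J) \<noteq> 0 \<longrightarrow> card I = card J)"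

lemma bidegree_even: "bidegree p p \<omega> \<Longrightarrow> even_form \<omega>"
  by (auto simp: bidegree_def even_form_def)

lemma wedge_commute:
  fixes \<alpha> \<omega> :: "'n::{finite,linorder} ext"
  assumes "even_form \<alpha>"
  shows "\<alpha> \<and>\<^sub>E \<omega> = \<omega> \<and>\<^sub>E \<alpha>"
proof (induction \<alpha> rule: ext_induct)
  case (axis I J)
  then have c: "card I = card J" using assms by (auto simp: even_form_def)
  show ?case
  proof (induction \<omega> rule: ext_induct)
    case (axis I' J')
    show ?case
    proof (cases "I \<inter> I' = {} \<and> J \<inter> J' = {}")
      case True
      have "(-1::complex) ^ (card J' * card J) * ((-1) ^ (card J * card J') * x) = x" for x
        by (simp add: mult.commute[of "card J'"] flip: mult.assoc power_mult_distrib)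
      then show ?thesis
        using True shuffle_sign_swap[of I I'] shuffle_sign_swap[of J J']
        by (simp add: wedge_axis c Un_commute Int_commute mult_ac)
    qed (auto simp: wedge_axis)
  qed (simp_all add: wedge_add_left wedge_add_right wedge_zero_left wedge_zero_right)
qed (simp_all add: wedge_add_left wedge_add_right wedge_zero_left wedge_zero_right)

lemma wedge_ext_scalar_left: "ext_scalar c \<and>\<^sub>E \<omega> = c *s \<omega>"
proof (induction \<omega> rule: ext_induct)
  case (axis I J)
  then show ?case
    by (simp add: ext_scalar_def wedge_axis) (simp add: vec_eq_iff axis_def)
qed (simp_all add: wedge_add_right wedge_zero_right vector_add_ldistrib)

lemma ext_scalar_even: "even_form (ext_scalar c)"
  by (auto simp: even_form_def ext_scalar_def axis_def)

lemma wedge_ext_scalar_right: "\<omega> \<and>\<^sub>E ext_scalar c = c *s \<omega>"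
  using wedge_commute[OF ext_scalar_even] wedge_ext_scalar_left by metis

lemma bidegree_wedge:
  fixes \<alpha> \<omega> :: "'n::{finite,linorder} ext"
  assumes "bidegree p q \<alpha>" "bidegree p' q' \<omega>"
  shows "bidegree (p + p') (q + q') (\<alpha> \<and>\<^sub>E \<omega>)"
  unfolding bidegree_def
proof (intro allI impI)
  fix K L assume "(\<alpha> \<and>\<^sub>E \<omega>) $ (K, L) \<noteq> 0"
  then obtain I J where "I \<subseteq> K" "J \<subseteq> L" "\<alpha> $ (I, J) \<noteq> 0" "\<omega> $ (K - I, L - J) \<noteq> 0"
    unfolding wedge_nth by (metis (no_types, lifting) Pow_iff mult_eq_0_iff sum.not_neutral_contains_not_neutral)
  then show "card K = p + p' \<and> card L = q + q'"
    using assms card_Diff_subset[of I K] card_mono[of K I] card_Diff_subset[of J L] card_mono[of L J]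
    unfolding bidegree_def by (metis finite le_add_diff_inverse)
qed

lemma bidegree_add: "bidegree p q \<alpha> \<Longrightarrow> bidegree p q \<omega> \<Longrightarrow> bidegree p q (\<alpha> + \<omega>)"
  unfolding bidegree_def by (metis add.right_neutral add_0 vector_add_component)

lemma bidegree_scale: "bidegree p q \<alpha> \<Longrightarrow> bidegree p q (c *s \<alpha>)"
  by (auto simp: bidegree_def)

lemma bidegree_zero: "bidegree p q 0"
  by (simp add: bidegree_def)

lemma bidegree_sum: "(\<And>i. i \<in> S \<Longrightarrow> bidegree p q (f i)) \<Longrightarrow> bidegree p q (\<Sum>i\<in>S. f i)"
  by (induction S rule: infinite_finite_induct) (auto intro: bidegree_zero bidegree_add)

lemma bidegree_ext_scalar: "bidegree 0 0 (ext_scalar c)"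
  by (auto simp: bidegree_def ext_scalar_def axis_def)

lemma wedge_power_0 [simp]: "wedge_power \<omega> 0 = ext_scalar 1"
  by (simp add: wedge_power_def wedge_list_def)

lemma wedge_power_Suc: "wedge_power \<omega> (Suc k) = \<omega> \<and>\<^sub>E wedge_power \<omega> k"
  by (simp add: wedge_power_def wedge_list_def)

lemma bidegree_wedge_power: "bidegree 1 1 \<omega> \<Longrightarrow> bidegree k k (wedge_power \<omega> k)"
  by (induction k) (use bidegree_wedge[of 1 1 \<omega>] in \<open>auto simp: bidegree_ext_scalar wedge_power_Suc\<close>)

lemma wedge_power_add: "wedge_power \<omega> j \<and>\<^sub>E wedge_power \<omega> k = wedge_power \<omega> (j + k)"
  by (induction j) (simp_all add: wedge_ext_scalar_left wedge_power_Suc wedge_assoc)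

text \<open>The binomial formula stops after the linear term because \<theta>^2 = 0. For j = 0 the
  truncated exponent \<open>j - 1\<close> is harmless, as its term has coefficient 0.\<close>

lemma wedge_power_add_nilpotent:
  fixes \<alpha> \<theta> :: "'n::{finite,linorder} ext"
  assumes "even_form \<theta>" and sq: "\<theta> \<and>\<^sub>E \<theta> = 0"
  shows "wedge_power (\<alpha> + s *s \<theta>) j = wedge_power \<alpha> j + (of_nat j * s) *s (\<theta> \<and>\<^sub>E wedge_power \<alpha> (j - 1))"
proof (induction j)
  case (Suc j)
  have 1: "\<theta> \<and>\<^sub>E (\<theta> \<and>\<^sub>E \<omega>) = 0" for \<omega>
    using wedge_assoc[of \<theta> \<theta> \<omega>] by (simp add: sq wedge_zero_left)
  have 2: "\<alpha> \<and>\<^sub>E (\<theta> \<and>\<^sub>E \<omega>) = \<theta> \<and>\<^sub>E (\<alpha> \<and>\<^sub>E \<omega>)" for \<omega>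
    using wedge_assoc[of \<alpha> \<theta> \<omega>] wedge_assoc[of \<theta> \<alpha> \<omega>] wedge_commute[OF assms(1), of \<alpha>] by simp
  have 3: "of_nat j *s (\<alpha> \<and>\<^sub>E wedge_power \<alpha> (j - 1)) = of_nat j *s wedge_power \<alpha> j"
    by (cases j) (simp_all add: wedge_power_Suc)
  have "wedge_power (\<alpha> + s *s \<theta>) (Suc j)
      = wedge_power \<alpha> (Suc j) + s *s (\<theta> \<and>\<^sub>E wedge_power \<alpha> j)
        + (of_nat j * s) *s (\<theta> \<and>\<^sub>E (\<alpha> \<and>\<^sub>E wedge_power \<alpha> (j - 1)))"
    by (simp add: wedge_power_Suc Suc wedge_add_left wedge_add_right wedge_scale_left wedge_scale_right 1 2)
  also have "(of_nat j * s) *s (\<theta> \<and>\<^sub>E (\<alpha> \<and>\<^sub>E wedge_power \<alpha> (j - 1)))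
      = s *s (\<theta> \<and>\<^sub>E (of_nat j *s (\<alpha> \<and>\<^sub>E wedge_power \<alpha> (j - 1))))"
    by (simp add: wedge_scale_right vector_smult_assoc mult.commute)
  also have "\<dots> = (of_nat j * s) *s (\<theta> \<and>\<^sub>E wedge_power \<alpha> j)"
    unfolding 3 by (simp add: wedge_scale_right vector_smult_assoc mult.commute)
  finally show ?case
    by (simp add: vector_sadd_rdistrib algebra_simps)
qed simp

section \<open>Coordinate computations with \<beta> and \<theta>\<close>

definition unit_form :: "'n::{finite,linorder} \<Rightarrow> 'n \<Rightarrow> 'n ext" where
  "unit_form j k = axis ({j}, {k}) 1"

lemma dz_wedge_dzbar: "dz j \<and>\<^sub>E dzbar k = unit_form j k"
  by (simp add: dz_def dzbar_def wedge_axis unit_form_def)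

lemma bidegree_unit_form: "bidegree 1 1 (unit_form j k)"
  by (auto simp: bidegree_def unit_form_def axis_def)

lemma unit_form_nth: "unit_form j k $ (I, J) = (if I = {j} \<and> J = {k} then 1 else 0)"
  by (auto simp: unit_form_def axis_def)

lemma unit_form_wedge_swap: "unit_form j k \<and>\<^sub>E unit_form j' k' = - (unit_form j' k \<and>\<^sub>E unit_form j k')"
proof (cases "j = j' \<or> k = k'")
  case False
  then have "shuffle_sign {j'} {j} = - shuffle_sign {j} {j'}"
    using shuffle_sign_swap[of "{j}" "{j'}"] by simp
  then show ?thesis
    using False by (simp add: unit_form_def wedge_axis insert_commute) (auto simp: vec_eq_iff axis_def)
qed (auto simp: unit_form_def wedge_axis)

lemma unit_form_wedge_nth:
  fixes K L :: "'n::{finite,linorder} set"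
  shows "(unit_form j k \<and>\<^sub>E \<omega>) $ (K, L) =
    (if j \<in> K \<and> k \<in> L then (-1) ^ (card K - 1) * shuffle_sign {j} (K - {j}) * shuffle_sign {k} (L - {k})
       * \<omega> $ (K - {j}, L - {k}) else 0)"
proof -
  define t where "t = (\<lambda>A B. (-1) ^ (card B * card (K - A)) * shuffle_sign A (K - A) * shuffle_sign B (L - B)
        * unit_form j k $ (A, B) * \<omega> $ (K - A, L - B))"
  have "t A B = 0" if "A \<noteq> {j} \<or> B \<noteq> {k}" for A B
    using that by (auto simp: t_def unit_form_nth)
  then have "(\<Sum>A\<in>Pow K. \<Sum>B\<in>Pow L. t A B) = (\<Sum>A\<in>Pow K. \<Sum>B\<in>Pow L. if A = {j} then if B = {k} then t {j} {k} else 0 else 0)"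
    by (intro sum.cong refl) auto
  also have "\<dots> = (if j \<in> K \<and> k \<in> L then t {j} {k} else 0)"
    by (simp add: sum_Pow_delta)
  finally show ?thesis
    unfolding wedge_nth t_def[symmetric] by (simp add: t_def unit_form_nth)
qed

definition beta0 :: "'n::{finite,linorder} ext" where
  "beta0 = (\<i> / (2 * complex_of_real pi)) *s (\<Sum>j\<in>UNIV. unit_form j j)"

text \<open>With \<open>w = z - a\<close>, this is \<open>\<i>/(2\<pi>)\<close> times the wedge product of \<open>\<partial>|w|\<^sup>2\<close> with its conjugate.\<close>

definition theta :: "'n::{finite,linorder} cspace \<Rightarrow> 'n ext" where
  "theta w = (\<i> / (2 * complex_of_real pi)) *s (\<Sum>j\<in>UNIV. \<Sum>k\<in>UNIV. (cnj (w $ j) * w $ k) *s unit_form j k)"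

lemma bidegree_beta0: "bidegree 1 1 beta0"
  unfolding beta0_def by (intro bidegree_scale bidegree_sum bidegree_unit_form)

lemma bidegree_theta: "bidegree 1 1 (theta w)"
  unfolding theta_def by (intro bidegree_scale bidegree_sum bidegree_unit_form)

text \<open>A multiple of the product of a (1,0)-form and its conjugate has square 0. In
  coordinates, exchanging j and j' fixes the coefficients and changes the sign of the product of
  unit forms.\<close>

lemma theta_square: "theta w \<and>\<^sub>E theta w = 0"
proof -
  let ?c = "\<i> / (2 * complex_of_real pi)"
  define S where "S = (\<Sum>j\<in>UNIV. \<Sum>k\<in>UNIV. (cnj (w $ j) * w $ k) *s unit_form j k)"
  have "S \<and>\<^sub>E S = (\<Sum>j\<in>UNIV. \<Sum>k\<in>UNIV. \<Sum>j'\<in>UNIV. \<Sum>k'\<in>UNIV.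
      (cnj (w $ j) * w $ k * cnj (w $ j') * w $ k') *s (unit_form j' k' \<and>\<^sub>E unit_form j k))" (is "_ = ?R")
    unfolding S_def wedge_sum_left wedge_sum_right wedge_scale_left wedge_scale_right vector_smult_assoc
      scale_sum_right by (simp add: mult_ac)
  also have "?R = (\<Sum>k\<in>UNIV. \<Sum>j\<in>UNIV. \<Sum>j'\<in>UNIV. \<Sum>k'\<in>UNIV.
      (cnj (w $ j) * w $ k * cnj (w $ j') * w $ k') *s (unit_form j' k' \<and>\<^sub>E unit_form j k))"
    by (rule sum.swap)
  also have "\<dots> = (\<Sum>k\<in>UNIV. \<Sum>j'\<in>UNIV. \<Sum>j\<in>UNIV. \<Sum>k'\<in>UNIV.
      (cnj (w $ j) * w $ k * cnj (w $ j') * w $ k') *s (unit_form j' k' \<and>\<^sub>E unit_form j k))"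
    by (rule sum.cong[OF refl], rule sum.swap)
  also have "\<dots> = (\<Sum>k\<in>UNIV. \<Sum>j'\<in>UNIV. \<Sum>j\<in>UNIV. \<Sum>k'\<in>UNIV.
      - ((cnj (w $ j') * w $ k * cnj (w $ j) * w $ k') *s (unit_form j k' \<and>\<^sub>E unit_form j' k)))"
    by (subst unit_form_wedge_swap) (simp add: mult_ac vector_smult_rneg)
  also have "\<dots> = - (\<Sum>k\<in>UNIV. \<Sum>j\<in>UNIV. \<Sum>j'\<in>UNIV. \<Sum>k'\<in>UNIV.
      (cnj (w $ j) * w $ k * cnj (w $ j') * w $ k') *s (unit_form j' k' \<and>\<^sub>E unit_form j k))"
    by (simp add: sum_negf)
  also have "\<dots> = - ?R"
    by (subst sum.swap) simp
  finally have R: "?R = - ?R" and S: "S \<and>\<^sub>E S = ?R" by (simp_all add: \<open>S \<and>\<^sub>E S = ?R\<close>)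
  have "S \<and>\<^sub>E S = - (S \<and>\<^sub>E S)" unfolding S by (rule R)
  then have "S \<and>\<^sub>E S = 0"
    by (auto simp: vec_eq_iff eq_neg_iff_add_eq_0 simp flip: mult_2)
  moreover have "theta w = ?c *s S" unfolding theta_def S_def ..
  ultimately show ?thesis
    by (simp add: wedge_scale_left wedge_scale_right)
qed

text \<open>In closed form i^k (-1)^(k(k-1)/2). The sign comes from sorting all dz before all dzbar:
  a new leading factor moves its dzbar past the k remaining dz.\<close>

primrec orient_coeff :: "nat \<Rightarrow> complex" where
  "orient_coeff 0 = 1"
| "orient_coeff (Suc k) = \<i> * (-1) ^ k * orient_coeff k"

lemma orientation_form_eq: "orientation_form = (axis (UNIV, UNIV) (orient_coeff CARD('n)) :: 'n::{finite,linorder} ext)"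
proof -
  have "wedge_list (map (\<lambda>j. \<i> *s (dz j \<and>\<^sub>E dzbar j)) xs) = axis (set xs, set xs) (orient_coeff (length xs))"
    if "distinct xs" for xs :: "'n list"
    using that
  proof (induction xs)
    case Nil
    then show ?case by (simp add: wedge_list_def ext_scalar_def)
  next
    case (Cons x xs)
    have "wedge_list (map (\<lambda>j. \<i> *s (dz j \<and>\<^sub>E dzbar j)) (x # xs))
        = (\<i> *s unit_form x x) \<and>\<^sub>E wedge_list (map (\<lambda>j. \<i> *s (dz j \<and>\<^sub>E dzbar j)) xs)"
      by (simp add: wedge_list_def dz_wedge_dzbar)
    also have "\<dots> = \<i> *s (axis ({x}, {x}) 1 \<and>\<^sub>E axis (set xs, set xs) (orient_coeff (length xs)))"
      using Cons by (simp add: wedge_scale_left unit_form_def)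
    also have "\<dots> = axis (set (x # xs), set (x # xs)) (orient_coeff (length (x # xs)))"
      using Cons.prems shuffle_sign_square[of "{x}" "set xs"]
      by (simp add: wedge_axis distinct_card mult.assoc) (simp add: vec_eq_iff axis_def mult.assoc)
    finally show ?case .
  qed
  from this[of "sorted_list_of_set UNIV"] show ?thesis
    by (simp add: orientation_form_def)
qed

text \<open>The common diagonal coefficient of the k-th power of \<open>beta0\<close>. The factorial
  counts the orders in which the k factors of a given monomial can be picked.\<close>

definition beta0_coeff :: "nat \<Rightarrow> complex" where
  "beta0_coeff k = fact k / (2 * of_real pi) ^ k * orient_coeff k"

lemma beta0_coeff_Suc:
  "beta0_coeff (Suc k) = \<i> / (2 * of_real pi) * of_nat (Suc k) * (-1) ^ k * beta0_coeff k"
  by (simp add: beta0_coeff_def field_simps)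

lemma wedge_power_beta0_nth:
  fixes K L :: "'n::{finite,linorder} set"
  shows "wedge_power beta0 k $ (K, L) = (if K = L \<and> card K = k then beta0_coeff k else 0)"
proof (induction k arbitrary: K L)
  case 0
  then show ?case
    by (auto simp: ext_scalar_def axis_def beta0_coeff_def)
next
  case (Suc k)
  let ?c = "\<i> / (2 * complex_of_real pi)"
  have "wedge_power beta0 (Suc k) $ (K, L) = ?c * (\<Sum>j\<in>UNIV. (unit_form j j \<and>\<^sub>E wedge_power beta0 k) $ (K, L))"
    by (simp add: wedge_power_Suc beta0_def wedge_scale_left wedge_sum_left)
  also have "(\<Sum>j\<in>UNIV. (unit_form j j \<and>\<^sub>E wedge_power beta0 k) $ (K, L))
      = (\<Sum>j\<in>UNIV. if j \<in> K then (if K = L \<and> card K = Suc k then (-1) ^ k * beta0_coeff k else 0) else 0)"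
  proof (rule sum.cong[OF refl])
    fix j
    have "K - {j} = L - {j} \<longleftrightarrow> K = L" if "j \<in> K" "j \<in> L" using that by auto
    moreover have "card (K - {j}) = k \<longleftrightarrow> card K = Suc k" if "j \<in> K"
      using that card_Suc_Diff1[OF finite that] by auto
    ultimately show "(unit_form j j \<and>\<^sub>E wedge_power beta0 k) $ (K, L) =
      (if j \<in> K then (if K = L \<and> card K = Suc k then (-1) ^ k * beta0_coeff k else 0) else 0)"
      using shuffle_sign_square[of "{j}" "K - {j}"]
      by (auto simp: unit_form_wedge_nth Suc mult.assoc)
  qed
  also have "\<dots> = (if K = L \<and> card K = Suc k then of_nat (Suc k) * ((-1) ^ k * beta0_coeff k) else 0)"
    by (cases "K = L \<and> card K = Suc k") (auto simp: sum.If_cases)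
  finally show ?case
    by (cases "K = L"; cases "card K = Suc k") (auto simp: beta0_coeff_Suc)
qed

lemma wedge_power_beta0_top:
  "wedge_power beta0 CARD('n) = complex_of_real (fact CARD('n) / (2 * pi) ^ CARD('n)) *s (orientation_form :: 'n::{finite,linorder} ext)"
proof (rule ext_eqI)
  fix K L :: "'n set"
  have "card K = CARD('n) \<longleftrightarrow> K = UNIV" using card_eq_UNIV_imp_eq_UNIV[of K] by auto
  then show "wedge_power beta0 CARD('n) $ (K, L) =
      (complex_of_real (fact CARD('n) / (2 * pi) ^ CARD('n)) *s (orientation_form :: 'n ext)) $ (K, L)"
    by (auto simp: wedge_power_beta0_nth orientation_form_eq axis_def beta0_coeff_def)
qed

text \<open>Wedging with \<beta>^(n-1) takes a trace: that power has diagonal components only, so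
  just the entries of \<theta> with j = k survive, and their sum is |w|^2.\<close>

lemma theta_wedge_top:
  fixes w :: "'n::{finite,linorder} cspace"
  shows "theta w \<and>\<^sub>E wedge_power beta0 (CARD('n) - 1) = complex_of_real ((norm w)\<^sup>2 / CARD('n)) *s wedge_power beta0 CARD('n)"
proof (rule ext_eqI)
  fix K L :: "'n set"
  let ?n = "CARD('n)" and ?c = "\<i> / (2 * complex_of_real pi)"
  have n: "?n > 0" by simp
  then obtain n' where n': "?n = Suc n'" using gr0_implies_Suc by blast
  show "(theta w \<and>\<^sub>E wedge_power beta0 (?n - 1)) $ (K, L) = (complex_of_real ((norm w)\<^sup>2 / ?n) *s wedge_power beta0 ?n) $ (K, L)"
  proof (cases "K = UNIV \<and> L = UNIV")
    case True
    have "(unit_form j k \<and>\<^sub>E wedge_power beta0 n') $ (UNIV, UNIV) = (if j = k then (-1) ^ n' * beta0_coeff n' else 0)"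
      for j k :: 'n
    proof (cases "j = k")
      case True
      have "card (UNIV - {k}) = n'" using n' by (simp add: card_Diff_singleton)
      then show ?thesis
        using n' shuffle_sign_square[of "{k}" "UNIV - {k}"]
        by (simp add: True unit_form_wedge_nth wedge_power_beta0_nth mult.assoc)
    next
      case False
      then have "UNIV - {j} \<noteq> UNIV - {k}" by auto
      then show ?thesis
        using False by (simp add: unit_form_wedge_nth wedge_power_beta0_nth)
    qed
    then have "(theta w \<and>\<^sub>E wedge_power beta0 (?n - 1)) $ (UNIV, UNIV)
       = ?c * (\<Sum>j\<in>UNIV. \<Sum>k\<in>UNIV. (cnj (w $ j) * w $ k) * (if j = k then (-1) ^ n' * beta0_coeff n' else 0))"
      using n' by (simp add: theta_def wedge_scale_left wedge_sum_left)
    also have "\<dots> = ?c * ((\<Sum>j\<in>UNIV. cnj (w $ j) * w $ j) * ((-1) ^ n' * beta0_coeff n'))"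
      by (simp add: if_distrib[of "\<lambda>x. _ * x"] sum.delta sum_distrib_right cong: if_cong)
    also have "(\<Sum>j\<in>UNIV. cnj (w $ j) * w $ j) = complex_of_real ((norm w)\<^sup>2)"
    proof -
      have "(norm w)\<^sup>2 = (\<Sum>j\<in>UNIV. (norm (w $ j))\<^sup>2)"
        by (simp add: norm_vec_def L2_set_def sum_nonneg)
      moreover have "cnj x * x = complex_of_real ((norm x)\<^sup>2)" for x
        using complex_norm_square[of x] by (simp add: mult.commute)
      ultimately show ?thesis by (simp only: of_real_sum)
    qed
    also have "?c * (complex_of_real ((norm w)\<^sup>2) * ((-1) ^ n' * beta0_coeff n'))
      = complex_of_real ((norm w)\<^sup>2) / of_nat (Suc n') * beta0_coeff (Suc n')"
      unfolding beta0_coeff_Suc using of_nat_neq_0[of n', where 'a=complex] by (simp del: of_nat_Suc)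
    finally show ?thesis
      using True n' by (simp add: wedge_power_beta0_nth)
  next
    case False
    have "bidegree (1 + (?n - 1)) (1 + (?n - 1)) (theta w \<and>\<^sub>E wedge_power beta0 (?n - 1))"
      by (intro bidegree_wedge bidegree_theta bidegree_wedge_power bidegree_beta0)
    moreover have "1 + (?n - 1) = ?n" using n by linarith
    moreover have "card K \<noteq> ?n \<or> card L \<noteq> ?n"
      using False card_eq_UNIV_imp_eq_UNIV[OF finite, of K] card_eq_UNIV_imp_eq_UNIV[OF finite, of L] by blast
    ultimately have "(theta w \<and>\<^sub>E wedge_power beta0 (?n - 1)) $ (K, L) = 0"
      unfolding bidegree_def by metis
    moreover have "wedge_power beta0 ?n $ (K, L) = 0"
      using False card_eq_UNIV_imp_eq_UNIV[of K] by (auto simp: wedge_power_beta0_nth)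
    ultimately show ?thesis by simp
  qed
qed

subsection \<open>Radial forms and the operator \<open>ddc\<close>\<close>

lemma scaleR_eq_smult: "r *\<^sub>R (x :: complex ^ 'k) = complex_of_real r *s x"
  unfolding vec_eq_iff vector_scaleR_component vector_smult_component by (simp only: scaleR_conv_of_real simp_thms)

lemma bounded_linear_complexI:
  fixes f :: "complex ^ 'k \<Rightarrow> complex ^ 'l"
  assumes "\<And>x y. f (x + y) = f x + f y" "\<And>c x. f (c *s x) = c *s f x"
  shows "bounded_linear f"
  unfolding linear_conv_bounded_linear[symmetric]
  by (rule linearI) (simp_all add: assms scaleR_eq_smult)

lemma bounded_linear_smult_left: "bounded_linear (\<lambda>c::complex. c *s (x :: complex ^ 'k))"
  unfolding linear_conv_bounded_linear[symmetric]
  by (rule linearI) (simp_all add: vector_sadd_rdistrib scaleR_eq_smult vector_smult_assoc scaleR_conv_of_real)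

lemma bounded_linear_smult_right: "bounded_linear (\<lambda>x. c *s (x :: complex ^ 'k))"
  by (rule bounded_linear_complexI) (simp_all add: vector_add_ldistrib vector_smult_assoc mult.commute)

lemma bounded_linear_wedge_left: "bounded_linear (\<lambda>\<alpha>. \<alpha> \<and>\<^sub>E \<omega>)"
  by (rule bounded_linear_complexI) (simp_all add: wedge_add_left wedge_scale_left)

lemma bounded_bilinear_smult: "bounded_bilinear (\<lambda>c (x :: complex ^ 'k). c *s x)"
  unfolding bilinear_conv_bounded_bilinear[symmetric] bilinear_def linear_conv_bounded_linear
  by (simp add: bounded_linear_smult_left bounded_linear_smult_right)

lemma smooth_smult: "smooth f \<Longrightarrow> smooth g \<Longrightarrow> smooth (\<lambda>z. f z *s (g z :: complex ^ 'k))"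
  by (rule smooth_bounded_bilinear[OF bounded_bilinear_smult])

lemma smooth_of_real: "smooth f \<Longrightarrow> smooth (\<lambda>z. complex_of_real (f z))"
  by (rule smooth_linear_compose[OF bounded_linear_of_real])

lemma smooth_theta: "smooth (\<lambda>z. theta (z - a))"
proof -
  have c: "smooth (\<lambda>z::'a cspace. (z - a) $ j)" for j
    by (rule smooth_linear_compose[OF bounded_linear_vec_nth])
      (intro smooth_diff smooth_const smooth_bounded_linear bounded_linear_ident)
  then have "smooth (\<lambda>z::'a cspace. cnj ((z - a) $ j) * (z - a) $ k)" for j k
    by (intro smooth_mult smooth_linear_compose[OF bounded_linear_cnj])
  then show ?thesis
    unfolding theta_def by (intro smooth_smult smooth_const smooth_sum)
qed

lemma inner_axis_complex:
  fixes w :: "'n::finite cspace"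
  shows "w \<bullet> axis j 1 = Re (w $ j)" "w \<bullet> axis j \<i> = Im (w $ j)"
  by (simp_all add: inner_axis inner_complex_def)

lemma norm_squared_has_derivative:
  fixes a :: "'a::real_inner"
  shows "((\<lambda>z. (norm (z - a))\<^sup>2) has_derivative (\<lambda>h. 2 * ((z - a) \<bullet> h))) (at z)"
  unfolding power2_norm_eq_inner
  by (rule has_derivative_eq_rhs, (rule derivative_intros)+) (auto simp: inner_commute)

lemma radial_has_derivative:
  fixes a :: "'a::real_inner"
  assumes "\<And>t. (u has_real_derivative u' t) (at t)"
  shows "((\<lambda>z. u ((norm (z - a))\<^sup>2)) has_derivative
    (\<lambda>h. u' ((norm (z - a))\<^sup>2) * (2 * ((z - a) \<bullet> h)))) (at z)"
  using has_derivative_compose[OF norm_squared_has_derivative[of a z] assms[unfolded has_field_derivative_def]] .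

lemma wedge_dz_dz: "dz j \<and>\<^sub>E dz l = - (dz l \<and>\<^sub>E dz j)"
proof (cases "j = l")
  case False
  then have "shuffle_sign {l} {j} = - shuffle_sign {j} {l}"
    using shuffle_sign_swap[of "{j}" "{l}"] by simp
  then show ?thesis
    using False by (simp add: dz_def wedge_axis insert_commute) (auto simp: vec_eq_iff axis_def)
qed (simp add: dz_def wedge_axis)

lemma wedge_dzbar_dzbar: "dzbar j \<and>\<^sub>E dzbar l = - (dzbar l \<and>\<^sub>E dzbar j)"
proof (cases "j = l")
  case False
  then have "shuffle_sign {l} {j} = - shuffle_sign {j} {l}"
    using shuffle_sign_swap[of "{j}" "{l}"] by simp
  then show ?thesis
    using False by (simp add: dzbar_def wedge_axis insert_commute) (auto simp: vec_eq_iff axis_def)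
qed (simp add: dzbar_def wedge_axis)

lemma dzbar_wedge_dz: "dzbar l \<and>\<^sub>E dz j = - unit_form j l"
  by (simp add: dz_def dzbar_def wedge_axis unit_form_def) (auto simp: vec_eq_iff axis_def)

lemma sum_antisymmetric:
  fixes X :: "'i \<Rightarrow> 'i \<Rightarrow> complex ^ 'k"
  assumes "\<And>i j. X i j = - X j i"
  shows "(\<Sum>i\<in>A. \<Sum>j\<in>A. X i j) = 0"
proof -
  have "(\<Sum>i\<in>A. \<Sum>j\<in>A. X i j) = (\<Sum>j\<in>A. \<Sum>i\<in>A. X i j)" by (rule sum.swap)
  also have "\<dots> = - (\<Sum>i\<in>A. \<Sum>j\<in>A. X i j)"
    unfolding sum_negf[symmetric] using assms by (intro sum.cong refl)
  finally show ?thesis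
    by (auto simp: vec_eq_iff eq_neg_iff_add_eq_0 simp flip: mult_2)
qed

text \<open>Since \<omega> is constant, only the coefficient is differentiated. The dz-dz and
  dzbar-dzbar parts vanish by the symmetry of second derivatives, and the two mixed parts agree;
  this doubling turns the 1/(4 pi) of d^c into the 1/(2 pi) of \<beta> and \<theta>.\<close>

lemma ddc_radial:
  fixes a :: "'n::{finite,linorder} cspace" and \<omega> :: "'n ext"
  assumes d1: "\<And>t. (u has_real_derivative u1 t) (at t)" and d2: "\<And>t. (u1 has_real_derivative u2 t) (at t)"
  shows "ddc (\<lambda>z. complex_of_real (u ((norm (z - a))\<^sup>2)) *s \<omega>) z =
    complex_of_real (u1 ((norm (z - a))\<^sup>2)) *s (beta0 \<and>\<^sub>E \<omega>)
    + complex_of_real (u2 ((norm (z - a))\<^sup>2)) *s (theta (z - a) \<and>\<^sub>E \<omega>)"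
proof -
  define \<alpha> where "\<alpha> = (\<lambda>z. complex_of_real (u ((norm (z - a))\<^sup>2)) *s \<omega>)"
  define c where "c = \<i> / (4 * complex_of_real pi)"
  define A where "A = (\<lambda>j. c *s (dzbar j \<and>\<^sub>E \<omega>))"
  define B where "B = (\<lambda>j. - c *s (dz j \<and>\<^sub>E \<omega>))"
  have "(\<alpha> has_derivative (\<lambda>h. complex_of_real (u1 ((norm (z - a))\<^sup>2) * (2 * ((z - a) \<bullet> h))) *s \<omega>)) (at z)" for z
    unfolding \<alpha>_def
    by (intro bounded_linear.has_derivative[OF bounded_linear_smult_left]
        bounded_linear.has_derivative[OF bounded_linear_of_real] radial_has_derivative d1)
  then have fd: "frechet_derivative \<alpha> (at z) = (\<lambda>h. complex_of_real (u1 ((norm (z - a))\<^sup>2) * (2 * ((z - a) \<bullet> h))) *s \<omega>)" for z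
    using frechet_derivative_at by metis
  have z1: "del_z j \<alpha> z = (complex_of_real (u1 ((norm (z - a))\<^sup>2)) * cnj ((z - a) $ j)) *s \<omega>" for j z
    unfolding del_z_def fd inner_axis_complex
    by (simp add: vec_eq_iff complex_eq_iff algebra_simps)
  have z2: "del_zbar j \<alpha> z = (complex_of_real (u1 ((norm (z - a))\<^sup>2)) * (z - a) $ j) *s \<omega>" for j z
    unfolding del_zbar_def fd inner_axis_complex
    by (simp add: vec_eq_iff complex_eq_iff algebra_simps)
  \<comment> \<open>This is d^c \<alpha> in coordinates, a combination of the constant forms
    \<open>A j\<close> and \<open>B j\<close>.\<close>
  define g where "g = (\<lambda>z. \<Sum>j\<in>UNIV. (complex_of_real (u1 ((norm (z - a))\<^sup>2)) * (z - a) $ j) *s A j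
      + (complex_of_real (u1 ((norm (z - a))\<^sup>2)) * cnj ((z - a) $ j)) *s B j)"
  have dc: "ext_dc \<alpha> = g"
  proof
    fix z
    show "ext_dc \<alpha> z = g z"
      unfolding ext_dc_def delbar_def del_def z1 z2 g_def A_def B_def c_def[symmetric]
      by (simp add: vec_eq_iff wedge_scale_right right_diff_distrib sum_distrib_left sum_subtractf[symmetric] mult_ac)
  qed
  let ?t = "\<lambda>z. (norm (z - a))\<^sup>2"
  define g' where "g' = (\<lambda>z h. \<Sum>j\<in>UNIV.
       (complex_of_real (u1 (?t z)) * h $ j + complex_of_real (u2 (?t z) * (2 * ((z - a) \<bullet> h))) * (z - a) $ j) *s A j
      + (complex_of_real (u1 (?t z)) * cnj (h $ j) + complex_of_real (u2 (?t z) * (2 * ((z - a) \<bullet> h))) * cnj ((z - a) $ j)) *s B j)"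
  have co: "((\<lambda>z. (z - a) $ j) has_derivative (\<lambda>h. h $ j)) (at z)" for j z
  proof -
    have "((\<lambda>z. (z - a) $ j) has_derivative (\<lambda>h. (h - 0) $ j)) (at z)"
      by (intro bounded_linear.has_derivative[OF bounded_linear_vec_nth] has_derivative_diff has_derivative_ident has_derivative_const)
    then show ?thesis by simp
  qed
  have "(g has_derivative g' z) (at z)" for z
    unfolding g_def g'_def
    by (intro has_derivative_sum has_derivative_add bounded_linear.has_derivative[OF bounded_linear_smult_left]
        has_derivative_mult bounded_linear.has_derivative[OF bounded_linear_of_real] radial_has_derivative d2
        bounded_linear.has_derivative[OF bounded_linear_cnj] co)
  then have fd2: "frechet_derivative g (at z) = g' z" for z
    using frechet_derivative_at by metis
  define w where "w = z - a"
  define x1 where "x1 = complex_of_real (u1 ((norm w)\<^sup>2))"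
  define x2 where "x2 = complex_of_real (u2 ((norm w)\<^sup>2))"
  have ax: "axis l y $ j = (if j = l then y else 0)" for l j :: 'n and y :: complex
    by (simp add: axis_def)
  have split: "(1/2) *s ((p *s X + q *s Y) - \<i> *s (p' *s X + q' *s Y)) = ((1/2) * (p - \<i> * p')) *s X + ((1/2) * (q - \<i> * q')) *s Y"
    "(1/2) *s ((p *s X + q *s Y) + \<i> *s (p' *s X + q' *s Y)) = ((1/2) * (p + \<i> * p')) *s X + ((1/2) * (q + \<i> * q')) *s Y"
    for p q p' q' and X Y :: "'n ext"
    by (simp_all add: vec_eq_iff algebra_simps diff_divide_distrib add_divide_distrib)
  have w_eq: "w $ l = of_real (Re (w $ l)) + \<i> * of_real (Im (w $ l))"
    "cnj (w $ l) = of_real (Re (w $ l)) - \<i> * of_real (Im (w $ l))" for l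
    by (simp_all add: complex_eq_iff)
  have s1: "(1/2) * ((x1 * (if j = l then 1 else 0) + complex_of_real (r * (2 * Re (w $ l))) * y)
      - \<i> * (x1 * (if j = l then \<i> else 0) + complex_of_real (r * (2 * Im (w $ l))) * y))
      = of_real r * cnj (w $ l) * y + (if j = l then x1 else 0)"
    "(1/2) * ((x1 * cnj (if j = l then 1 else 0) + complex_of_real (r * (2 * Re (w $ l))) * y)
      - \<i> * (x1 * cnj (if j = l then \<i> else 0) + complex_of_real (r * (2 * Im (w $ l))) * y))
      = of_real r * cnj (w $ l) * y" for j l r y
    unfolding w_eq(2) by (cases "j = l"; simp add: field_simps)+
  have s2: "(1/2) * ((x1 * (if j = l then 1 else 0) + complex_of_real (r * (2 * Re (w $ l))) * y)
      + \<i> * (x1 * (if j = l then \<i> else 0) + complex_of_real (r * (2 * Im (w $ l))) * y))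
      = of_real r * w $ l * y"
    "(1/2) * ((x1 * cnj (if j = l then 1 else 0) + complex_of_real (r * (2 * Re (w $ l))) * y)
      + \<i> * (x1 * cnj (if j = l then \<i> else 0) + complex_of_real (r * (2 * Im (w $ l))) * y))
      = of_real r * w $ l * y + (if j = l then x1 else 0)" for j l r y
    by (subst (3) w_eq(1), cases "j = l"; simp add: field_simps)+
  have e1: "del_z l g z = (\<Sum>j\<in>UNIV. (x2 * cnj (w $ l) * w $ j + (if j = l then x1 else 0)) *s A j
     + (x2 * cnj (w $ l) * cnj (w $ j)) *s B j)" for l
    unfolding del_z_def fd2 g'_def inner_axis_complex w_def[symmetric] x1_def[symmetric] ax
      scale_sum_right sum_subtractf[symmetric] split s1 x2_def ..
  have e2: "del_zbar l g z = (\<Sum>j\<in>UNIV. (x2 * w $ l * w $ j) *s A j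
     + (x2 * w $ l * cnj (w $ j) + (if j = l then x1 else 0)) *s B j)" for l
    unfolding del_zbar_def fd2 g'_def inner_axis_complex w_def[symmetric] x1_def[symmetric] ax
      scale_sum_right sum.distrib[symmetric] 
    unfolding scale_sum_right split s2 x2_def ..
  \<comment> \<open>The complex Hessian of u(|z - a|^2): the derivative along z_l and along the
    conjugate of z_j.\<close>
  define h where "h = (\<lambda>l j. x2 * cnj (w $ l) * w $ j + (if j = l then x1 else 0))"
  have a1: "dz l \<and>\<^sub>E A j = c *s (unit_form l j \<and>\<^sub>E \<omega>)" for l j
    by (simp add: A_def wedge_scale_right wedge_assoc[symmetric] dz_wedge_dzbar)
  have neg: "(- X) \<and>\<^sub>E Y = - (X \<and>\<^sub>E Y)" for X Y :: "'n ext"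
    using wedge_scale_left[of "-1" X Y] by simp
  have neg_right: "X \<and>\<^sub>E (- Y) = - (X \<and>\<^sub>E Y)" for X Y :: "'n ext"
    using wedge_scale_right[of X "-1" Y] by simp
  have b2: "dzbar l \<and>\<^sub>E B j = c *s (unit_form j l \<and>\<^sub>E \<omega>)" for l j
    by (simp add: B_def wedge_scale_right wedge_assoc[symmetric] dzbar_wedge_dz neg neg_right)
  have b1: "dz l \<and>\<^sub>E B j = - (dz j \<and>\<^sub>E B l)" for l j
    using wedge_dz_dz[of l j] by (simp add: B_def wedge_scale_right wedge_assoc[symmetric] neg neg_right)
  have a2: "dzbar l \<and>\<^sub>E A j = - (dzbar j \<and>\<^sub>E A l)" for l j
    using wedge_dzbar_dzbar[of l j] by (simp add: A_def wedge_scale_right wedge_assoc[symmetric] neg)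
  have "ddc \<alpha> z = (\<Sum>l\<in>UNIV. dz l \<and>\<^sub>E del_z l g z) + (\<Sum>l\<in>UNIV. dzbar l \<and>\<^sub>E del_zbar l g z)"
    by (simp add: ddc_def dc ext_d_def del_def delbar_def)
  also have "(\<Sum>l\<in>UNIV. dz l \<and>\<^sub>E del_z l g z)
      = (\<Sum>l\<in>UNIV. \<Sum>j\<in>UNIV. h l j *s (c *s (unit_form l j \<and>\<^sub>E \<omega>)))
       + (\<Sum>l\<in>UNIV. \<Sum>j\<in>UNIV. (x2 * cnj (w $ l) * cnj (w $ j)) *s (dz l \<and>\<^sub>E B j))"
    unfolding e1 wedge_sum_right wedge_add_right wedge_scale_right a1 h_def sum.distrib ..
  also have "(\<Sum>l\<in>UNIV. \<Sum>j\<in>UNIV. (x2 * cnj (w $ l) * cnj (w $ j)) *s (dz l \<and>\<^sub>E B j)) = 0"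
  proof (rule sum_antisymmetric)
    fix l j
    show "(x2 * cnj (w $ l) * cnj (w $ j)) *s (dz l \<and>\<^sub>E B j) = - ((x2 * cnj (w $ j) * cnj (w $ l)) *s (dz j \<and>\<^sub>E B l))"
      unfolding b1[of l j] by (simp add: vec_eq_iff)
  qed
  also have "(\<Sum>l\<in>UNIV. dzbar l \<and>\<^sub>E del_zbar l g z)
      = (\<Sum>l\<in>UNIV. \<Sum>j\<in>UNIV. (x2 * w $ l * w $ j) *s (dzbar l \<and>\<^sub>E A j))
       + (\<Sum>l\<in>UNIV. \<Sum>j\<in>UNIV. h j l *s (c *s (unit_form j l \<and>\<^sub>E \<omega>)))"
    unfolding e2 wedge_sum_right wedge_add_right wedge_scale_right b2 h_def sum.distrib
    by (intro arg_cong2[where f="(+)"] refl sum.cong) (auto simp: mult_ac)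
  also have "(\<Sum>l\<in>UNIV. \<Sum>j\<in>UNIV. (x2 * w $ l * w $ j) *s (dzbar l \<and>\<^sub>E A j)) = 0"
  proof (rule sum_antisymmetric)
    fix l j
    show "(x2 * w $ l * w $ j) *s (dzbar l \<and>\<^sub>E A j) = - ((x2 * w $ j * w $ l) *s (dzbar j \<and>\<^sub>E A l))"
      unfolding a2[of l j] by (simp add: vec_eq_iff)
  qed
  also have "(\<Sum>l\<in>UNIV. \<Sum>j\<in>UNIV. h j l *s (c *s (unit_form j l \<and>\<^sub>E \<omega>)))
      = (\<Sum>l\<in>UNIV. \<Sum>j\<in>UNIV. h l j *s (c *s (unit_form l j \<and>\<^sub>E \<omega>)))"
    by (rule sum.swap)
  finally have "ddc \<alpha> z = (2 * c) *s (\<Sum>l\<in>UNIV. \<Sum>j\<in>UNIV. h l j *s (unit_form l j \<and>\<^sub>E \<omega>))"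
    by (simp add: scale_sum_right vector_smult_assoc mult_ac vec_eq_iff sum_distrib_left)
  also have "(\<Sum>l\<in>UNIV. \<Sum>j\<in>UNIV. h l j *s (unit_form l j \<and>\<^sub>E \<omega>))
     = x2 *s (\<Sum>l\<in>UNIV. \<Sum>j\<in>UNIV. (cnj (w $ l) * w $ j) *s (unit_form l j \<and>\<^sub>E \<omega>))
      + x1 *s (\<Sum>l\<in>UNIV. unit_form l l \<and>\<^sub>E \<omega>)"
  proof -
    have "(\<Sum>j\<in>UNIV. (if j = l then x1 else 0) *s (unit_form l j \<and>\<^sub>E \<omega>)) = x1 *s (unit_form l l \<and>\<^sub>E \<omega>)" for l
    proof -
      have "(\<Sum>j\<in>UNIV. (if j = l then x1 else 0) *s (unit_form l j \<and>\<^sub>E \<omega>))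
          = (\<Sum>j\<in>UNIV. if j = l then x1 *s (unit_form l l \<and>\<^sub>E \<omega>) else 0)"
        by (rule sum.cong) auto
      then show ?thesis by simp
    qed
    then show ?thesis
      unfolding h_def by (simp add: vector_sadd_rdistrib sum.distrib scale_sum_right vector_smult_assoc mult.assoc)
  qed
  also have "(2 * c) *s (x2 *s (\<Sum>l\<in>UNIV. \<Sum>j\<in>UNIV. (cnj (w $ l) * w $ j) *s (unit_form l j \<and>\<^sub>E \<omega>))
      + x1 *s (\<Sum>l\<in>UNIV. unit_form l l \<and>\<^sub>E \<omega>)) = x1 *s (beta0 \<and>\<^sub>E \<omega>) + x2 *s (theta w \<and>\<^sub>E \<omega>)"
    by (simp add: beta0_def theta_def wedge_scale_left wedge_sum_left vector_add_ldistrib vector_smult_assoc c_def mult.commute)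
  finally show ?thesis
    unfolding \<alpha>_def x1_def x2_def w_def .
qed

lemma beta_eq: "beta z = beta0"
proof -
  have "(\<lambda>z. ext_scalar (complex_of_real ((norm z)\<^sup>2))) = (\<lambda>z::'a cspace. complex_of_real ((norm (z - 0))\<^sup>2) *s ext_scalar 1)"
    by (simp add: fun_eq_iff vec_eq_iff ext_scalar_def axis_def)
  then have "beta z = ddc (\<lambda>z. complex_of_real ((norm (z - 0))\<^sup>2) *s ext_scalar 1) z"
    unfolding beta_def by (rule arg_cong)
  also have "\<dots> = beta0"
    by (subst ddc_radial[of "\<lambda>t. t" "\<lambda>t. 1" "\<lambda>t. 0"]) (simp_all add: wedge_ext_scalar_right)
  finally show ?thesis .
qed

lemma beta_power_eq: "beta_power k z = wedge_power beta0 k"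
  by (simp add: beta_power_def beta_eq)

subsection \<open>Test forms and positivity\<close>

lemma test_formsI:
  assumes "smooth \<alpha>" "\<And>z. bidegree p q (\<alpha> z)" "compact K" "K \<subseteq> \<Omega>" "\<And>z. z \<notin> K \<Longrightarrow> \<alpha> z = 0"
  shows "\<alpha> \<in> test_forms \<Omega> p q"
proof -
  have "closure {z. \<alpha> z \<noteq> 0} \<subseteq> K"
    using assms(3,5) by (intro closure_minimal compact_imp_closed) auto
  then have "compact (closure {z. \<alpha> z \<noteq> 0})" "closure {z. \<alpha> z \<noteq> 0} \<subseteq> \<Omega>"
    using assms(3,4) compact_Int_closed[OF assms(3) closed_closure, of "{z. \<alpha> z \<noteq> 0}"]
    by (auto simp: Int_absorb1)
  then show ?thesis
    using assms(1,2) by (simp add: test_forms_def)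
qed

lemma test_forms_smult:
  assumes f: "f \<in> test_functions \<Omega>" and G: "smooth G" "\<And>z. bidegree p q (G z)"
  shows "(\<lambda>z. complex_of_real (f z) *s G z) \<in> test_forms \<Omega> p q"
proof -
  obtain K where K: "compact K" "K \<subseteq> \<Omega>" "\<And>x. x \<notin> K \<Longrightarrow> f x = 0" "smooth f"
    using f unfolding test_functions_def by blast
  show ?thesis
    by (rule test_formsI[OF _ _ K(1,2)])
      (simp_all add: smooth_smult smooth_of_real K bidegree_scale G)
qed

lemma test_formsE:
  assumes "\<alpha> \<in> test_forms \<Omega> p q"
  obtains K where "smooth \<alpha>" "\<And>z. bidegree p q (\<alpha> z)" "compact K" "K \<subseteq> \<Omega>" "\<And>z. z \<notin> K \<Longrightarrow> \<alpha> z = 0"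
proof (rule that[of "closure {z. \<alpha> z \<noteq> 0}"])
  show "\<alpha> z = 0" if "z \<notin> closure {z. \<alpha> z \<noteq> 0}" for z
    using that closure_subset[of "{z. \<alpha> z \<noteq> 0}"] by blast
qed (use assms in \<open>simp_all add: test_forms_def\<close>)

lemma test_forms_add:
  assumes "\<alpha> \<in> test_forms \<Omega> p q" "\<omega> \<in> test_forms \<Omega> p q"
  shows "(\<lambda>z. \<alpha> z + \<omega> z) \<in> test_forms \<Omega> p q"
proof (rule test_formsE[OF assms(1)], rule test_formsE[OF assms(2)])
  fix K L
  assume *: "smooth \<alpha>" "\<And>z. bidegree p q (\<alpha> z)" "compact K" "K \<subseteq> \<Omega>" "\<And>z. z \<notin> K \<Longrightarrow> \<alpha> z = 0"
    "smooth \<omega>" "\<And>z. bidegree p q (\<omega> z)" "compact L" "L \<subseteq> \<Omega>" "\<And>z. z \<notin> L \<Longrightarrow> \<omega> z = 0"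
  show ?thesis
    by (rule test_formsI[of _ _ _ "K \<union> L"]) (simp_all add: * smooth_add bidegree_add compact_Un)
qed

lemma test_forms_scale:
  assumes "\<alpha> \<in> test_forms \<Omega> p q"
  shows "(\<lambda>z. c *s \<alpha> z) \<in> test_forms \<Omega> p q"
proof (rule test_formsE[OF assms])
  fix K assume *: "smooth \<alpha>" "\<And>z. bidegree p q (\<alpha> z)" "compact K" "K \<subseteq> \<Omega>" "\<And>z. z \<notin> K \<Longrightarrow> \<alpha> z = 0"
  show ?thesis
    by (rule test_formsI[of _ _ _ K]) (simp_all add: * smooth_smult smooth_const bidegree_scale)
qed

lemma test_forms_0_0:
  assumes "\<phi> \<in> test_forms \<Omega> 0 0"
  shows "\<phi> z = ext_scalar (\<phi> z $ ({}, {}))"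
    and "(\<lambda>z. Re (\<phi> z $ ({}, {}))) \<in> test_functions \<Omega>" "(\<lambda>z. Im (\<phi> z $ ({}, {}))) \<in> test_functions \<Omega>"
proof -
  show "\<phi> z = ext_scalar (\<phi> z $ ({}, {}))"
    using assms by (auto simp: test_forms_def bidegree_def vec_eq_iff ext_scalar_def axis_def)
  have s: "smooth (\<lambda>z. \<phi> z $ ({}, {}))"
    using assms by (intro smooth_linear_compose[OF bounded_linear_vec_nth]) (simp add: test_forms_def)
  obtain K where K: "compact K" "K \<subseteq> \<Omega>" "\<And>z. z \<notin> K \<Longrightarrow> \<phi> z = 0"
    using test_formsE[OF assms] by metis
  show "(\<lambda>z. Re (\<phi> z $ ({}, {}))) \<in> test_functions \<Omega>" "(\<lambda>z. Im (\<phi> z $ ({}, {}))) \<in> test_functions \<Omega>"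
    unfolding test_functions_def
    using K smooth_linear_compose[OF bounded_linear_Re s] smooth_linear_compose[OF bounded_linear_Im s]
    by (auto intro!: exI[of _ K])
qed

lemma representsD:
  assumes "represents \<Omega> S M"
  shows "sets M = sets (restrict_space borel \<Omega>)"
    and "compact K \<Longrightarrow> K \<subseteq> \<Omega> \<Longrightarrow> emeasure M K < \<infinity>"
    and "\<phi> \<in> test_forms \<Omega> 0 0 \<Longrightarrow> S \<phi> = (\<integral>z. \<phi> z $ ({}, {}) \<partial>M)"
  using assms by (simp_all add: represents_def)

lemma represents_test_function:
  fixes S :: "'n::{finite,linorder} current"
  assumes "represents \<Omega> S M" "u \<in> test_functions \<Omega>"
  shows "S (\<lambda>z. complex_of_real (u z) *s ext_scalar 1) = complex_of_real (\<integral>z. u z \<partial>M)"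
proof -
  have "(\<lambda>z. complex_of_real (u z) *s ext_scalar 1) \<in> test_forms \<Omega> 0 0"
    by (intro test_forms_smult assms smooth_const bidegree_ext_scalar)
  then have "S (\<lambda>z. complex_of_real (u z) *s ext_scalar 1) = (\<integral>z. (complex_of_real (u z) *s (ext_scalar 1 :: 'n ext)) $ ({}, {}) \<partial>M)"
    using representsD(3)[OF assms(1)] by simp
  also have "\<dots> = complex_of_real (\<integral>z. u z \<partial>M)"
    by (simp add: ext_scalar_def axis_def)
  finally show ?thesis .
qed

lemma real_11_radial: "real_11 (beta0 + complex_of_real s *s theta w)"
proof -
  have b: "beta0 $ ({j}, {k}) = \<i> / (2 * complex_of_real pi) * (if j = k then 1 else 0)" for j k :: 'a
  proof -
    have "(\<Sum>i\<in>UNIV. unit_form i i $ ({j}, {k})) = (\<Sum>i\<in>UNIV. if i = j then (if j = k then 1 else 0) else 0 :: complex)"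
      by (rule sum.cong) (auto simp: unit_form_nth)
    then show ?thesis by (simp add: beta0_def)
  qed
  have t: "theta w $ ({j}, {k}) = \<i> / (2 * complex_of_real pi) * (cnj (w $ j) * w $ k)" for j k :: 'a
  proof -
    have "(\<Sum>l\<in>UNIV. (cnj (w $ i) * w $ l) * unit_form i l $ ({j}, {k})) = (if i = j then cnj (w $ j) * w $ k else 0)" for i
    proof -
      have "(\<Sum>l\<in>UNIV. (cnj (w $ i) * w $ l) * unit_form i l $ ({j}, {k}))
          = (\<Sum>l\<in>UNIV. if l = k then (if i = j then cnj (w $ j) * w $ k else 0) else 0)"
        by (rule sum.cong) (auto simp: unit_form_nth)
      then show ?thesis by simp
    qed
    then show ?thesis by (simp add: theta_def)
  qed
  show ?thesis
    unfolding real_11_def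
    using bidegree_add[OF bidegree_beta0 bidegree_scale[OF bidegree_theta]] by (auto simp: b t)
qed

text \<open>
  The eigenvalues of \<open>beta0 + s theta w\<close> relative to \<open>beta0\<close> are \<open>1, \<dots>, 1, 1 + s |w|\<^sup>2\<close>, and the
  extreme \<open>m\<close>-positive value is \<open>s |w|\<^sup>2 = - n/m\<close>.
\<close>

lemma m_positive_11_radial:
  fixes a :: "'n::{finite,linorder} cspace"
  assumes "m \<le> CARD('n)" and s: "\<And>z. s z \<le> 0" "\<And>z. - s z * (norm (z - a))\<^sup>2 * real m \<le> real CARD('n)"
  shows "m_positive_11 \<Omega> m (\<lambda>z. beta0 + complex_of_real (s z) *s theta (z - a))"
  unfolding m_positive_11_def beta_power_eq
proof (intro ballI conjI real_11_radial)
  fix z j assume j: "j \<in> {1..m}"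
  let ?n = "CARD('n)" and ?\<theta> = "theta (z - a)"
  have jn: "j + (?n - j) = ?n" "j - Suc 0 + (?n - j) = ?n - 1" using j assms(1) by auto
  have "wedge_power (beta0 + complex_of_real (s z) *s ?\<theta>) j \<and>\<^sub>E wedge_power beta0 (?n - j)
      = wedge_power beta0 ?n + (of_nat j * complex_of_real (s z)) *s (?\<theta> \<and>\<^sub>E wedge_power beta0 (?n - 1))"
    unfolding wedge_power_add_nilpotent[OF bidegree_even[OF bidegree_theta] theta_square]
    by (simp add: wedge_add_left wedge_scale_left wedge_assoc wedge_power_add jn)
  also have "\<dots> = complex_of_real (1 + real j * s z * ((norm (z - a))\<^sup>2 / ?n)) *s wedge_power beta0 ?n"
    unfolding theta_wedge_top by (simp add: vector_sadd_rdistrib vector_smult_assoc)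
  also have "\<dots> = complex_of_real ((1 + real j * s z * ((norm (z - a))\<^sup>2 / ?n)) * (fact ?n / (2 * pi) ^ ?n)) *s orientation_form"
    unfolding wedge_power_beta0_top by (simp only: vector_smult_assoc of_real_mult)
  finally have eq: "wedge_power (beta0 + complex_of_real (s z) *s ?\<theta>) j \<and>\<^sub>E wedge_power beta0 (?n - j) = \<dots>" .
  \<comment> \<open>As \<open>s z\<close> is at most 0, the factor decreases in \<open>j\<close>.
    The case j = m is therefore decisive, and there the bound on \<open>s\<close> says precisely
    that the factor is nonnegative.\<close>
  have "- (real j * s z * (norm (z - a))\<^sup>2) = real j * (- s z * (norm (z - a))\<^sup>2)" by simp
  also have "\<dots> \<le> real m * (- s z * (norm (z - a))\<^sup>2)"
    using j s(1)[of z] by (intro mult_right_mono mult_nonneg_nonneg) auto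
  also have "\<dots> \<le> real ?n" using s(2)[of z] by (simp add: mult_ac)
  finally have "0 \<le> 1 + real j * s z * ((norm (z - a))\<^sup>2 / ?n)"
    by (simp add: field_simps)
  then have "0 \<le> (1 + real j * s z * ((norm (z - a))\<^sup>2 / ?n)) * (fact ?n / (2 * pi) ^ ?n)"
    by (intro mult_nonneg_nonneg) simp_all
  then show "nonneg_top (wedge_power (beta0 + complex_of_real (s z) *s ?\<theta>) j \<and>\<^sub>E wedge_power beta0 (?n - j))"
    unfolding nonneg_top_def eq by blast
qed

section \<open>Consequences of m-positivity of the current\<close>

locale positive_current =
  fixes \<Omega> :: "'n::{finite,linorder} cspace set" and T :: "'n current" and m p q :: nat
  assumes m: "1 \<le> m" "m < CARD('n)" and open_domain: "open \<Omega>" and current: "is_current \<Omega> p T"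
    and q: "m + p = CARD('n) + q" and pos: "m_positive_current \<Omega> m p T"
begin

lemma T_add:
  assumes "\<alpha> \<in> test_forms \<Omega> p p" "\<omega> \<in> test_forms \<Omega> p p"
  shows "T (\<lambda>z. \<alpha> z + \<omega> z) = T \<alpha> + T \<omega>"
proof -
  have "\<forall>\<alpha>\<in>test_forms \<Omega> p p. \<forall>\<omega>\<in>test_forms \<Omega> p p. T (\<lambda>z. \<alpha> z + \<omega> z) = T \<alpha> + T \<omega>"
    using current unfolding is_current_def by (elim conjE)
  then show ?thesis using assms by metis
qed

lemma T_scale:
  assumes "\<alpha> \<in> test_forms \<Omega> p p"
  shows "T (\<lambda>z. c *s \<alpha> z) = c * T \<alpha>"
proof -
  have "\<forall>c. \<forall>\<alpha>\<in>test_forms \<Omega> p p. T (\<lambda>z. c *s \<alpha> z) = c * T \<alpha>"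
    using current unfolding is_current_def by (elim conjE)
  then show ?thesis using assms by metis
qed

text \<open>From m < n and m + p \<ge> n it follows that p \<ge> 1, so \<open>p - 1\<close> is a
  genuine exponent below.\<close>

lemma p_bounds: "p \<le> CARD('n)" "q \<le> CARD('n)" "CARD('n) - m + q = p" "1 \<le> p"
proof -
  show "p \<le> CARD('n)"
    using current unfolding is_current_def by (elim conjE)
  then show "q \<le> CARD('n)" "CARD('n) - m + q = p" "1 \<le> p"
    using m q by linarith+
qed

text \<open>The form tested is f (\<beta> + s \<theta>)^q. In the application \<open>s\<close> is
  -n/(m t), which is unbounded near \<open>a\<close>; hence \<open>g\<close> stands for the product
  f s, and smoothness is asked of \<open>f\<close> and \<open>g\<close> only. Strong m-positivity is
  pointwise and tolerates such an \<open>s\<close>.\<close>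

lemma T_nonneg_radial:
  assumes f: "f \<in> test_functions \<Omega>" "\<And>z. f z \<ge> 0" and g: "g \<in> test_functions \<Omega>"
    and fg: "\<And>z. f z * s z = g z"
    and s: "\<And>z. s z \<le> 0" "\<And>z. - s z * (norm (z - a))\<^sup>2 * real m \<le> real CARD('n)"
  shows "T (\<lambda>z. complex_of_real (f z) *s wedge_power beta0 p
      + (of_nat q * complex_of_real (g z)) *s (theta (z - a) \<and>\<^sub>E wedge_power beta0 (p - 1))) \<in> \<real>\<^sub>\<ge>\<^sub>0"
proof -
  let ?n = "CARD('n)"
  define A where "A = (\<lambda>z. beta0 + complex_of_real (s z) *s theta (z - a))"
  define \<alpha> where "\<alpha> = (\<lambda>z. complex_of_real (f z) *s wedge_power beta0 q
      + of_nat q *s (complex_of_real (g z) *s (theta (z - a) \<and>\<^sub>E wedge_power beta0 (q - 1))))"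
  have \<alpha>_eq: "\<alpha> z = complex_of_real (f z) *s wedge_list (map (\<lambda>j. A z) [0..<q])" for z
  proof -
    have "wedge_list (map (\<lambda>j. A z) [0..<q]) = wedge_power (A z) q"
      by (simp add: wedge_power_def map_replicate_const)
    then show ?thesis
      unfolding A_def wedge_power_add_nilpotent[OF bidegree_even[OF bidegree_theta] theta_square] \<alpha>_def fg[symmetric]
      by (simp add: vector_add_ldistrib vector_smult_assoc mult_ac)
  qed
  have smooth_G: "smooth (\<lambda>z. theta (z - a) \<and>\<^sub>E wedge_power beta0 k)" for k
    by (rule smooth_linear_compose[OF bounded_linear_wedge_left smooth_theta])
  have 1: "\<alpha> \<in> test_forms \<Omega> q q"
    unfolding \<alpha>_def
  proof (intro test_forms_add)
    show "(\<lambda>z. complex_of_real (f z) *s wedge_power beta0 q) \<in> test_forms \<Omega> q q"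
      by (intro test_forms_smult f smooth_const bidegree_wedge_power bidegree_beta0)
    show "(\<lambda>z. of_nat q *s (complex_of_real (g z) *s (theta (z - a) \<and>\<^sub>E wedge_power beta0 (q - 1)))) \<in> test_forms \<Omega> q q"
    \<comment> \<open>For q = 0 the truncated \<open>q - 1\<close> would leave a form of bidegree
      (1,1), but the factor \<open>of_nat q\<close> removes it.\<close>
    proof (cases q)
      case 0
      then show ?thesis
        using test_forms_smult[OF test_functions_zero smooth_const[of 0] bidegree_zero] by simp
    next
      case (Suc q')
      have "bidegree (1 + q') (1 + q') (theta w \<and>\<^sub>E wedge_power beta0 q')" for w :: "'n cspace"
        by (intro bidegree_wedge bidegree_theta bidegree_wedge_power bidegree_beta0)
      then show ?thesis
        unfolding Suc by (intro test_forms_scale test_forms_smult g) (simp_all add: smooth_G)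
    qed
  qed
  have 2: "strongly_m_positive \<Omega> m q \<alpha>"
    unfolding strongly_m_positive_def
  proof (intro exI conjI allI impI ballI)
    \<comment> \<open>Strong m-positivity wants binomially many summands: the first carries the
      whole form, the others get coefficient 0.\<close>
    let ?a = "\<lambda>k::nat. if k = 0 then f else (\<lambda>z. 0)"
    show "0 \<le> ?a k z" for k z using f(2) by auto
    show "m_positive_11 \<Omega> m A"
      unfolding A_def by (rule m_positive_11_radial) (use m s in auto)
    fix z
    have "0 < ?n choose q" using p_bounds by simp
    then have "(\<Sum>k<?n choose q. complex_of_real (?a k z) *s wedge_list (map (\<lambda>j. A z) [0..<q]))
       = (\<Sum>k<?n choose q. if k = 0 then \<alpha> z else 0)"
      by (intro sum.cong) (auto simp: \<alpha>_eq)
    also have "\<dots> = \<alpha> z"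
      using \<open>0 < ?n choose q\<close> by simp
    finally show "\<alpha> z = (\<Sum>k<?n choose q. complex_of_real (?a k z) *s wedge_list (map (\<lambda>j. A z) [0..<q]))" ..
  qed
  have "\<forall>\<alpha>\<in>test_forms \<Omega> q q. strongly_m_positive \<Omega> m q \<alpha> \<longrightarrow> current_wedge T (beta_power (?n - m)) \<alpha> \<in> \<real>\<^sub>\<ge>\<^sub>0"
    using pos unfolding m_positive_current_def q add_diff_cancel_left' .
  from mp[OF bspec[OF this 1] 2]
  have "current_wedge T (beta_power (?n - m)) \<alpha> \<in> \<real>\<^sub>\<ge>\<^sub>0" .
  then have "T (\<lambda>z. beta_power (?n - m) z \<and>\<^sub>E \<alpha> z) \<in> \<real>\<^sub>\<ge>\<^sub>0"
    unfolding current_wedge_def .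
  moreover have "(\<lambda>z. beta_power (?n - m) z \<and>\<^sub>E \<alpha> z) = (\<lambda>z. complex_of_real (f z) *s wedge_power beta0 p
      + (of_nat q * complex_of_real (g z)) *s (theta (z - a) \<and>\<^sub>E wedge_power beta0 (p - 1)))"
  proof
    fix z
    let ?X = "wedge_power beta0 (?n - m) \<and>\<^sub>E (theta (z - a) \<and>\<^sub>E wedge_power beta0 (q - 1))"
    let ?Y = "theta (z - a) \<and>\<^sub>E wedge_power beta0 (p - 1)"
    have XY: "of_nat q *s ?X = of_nat q *s ?Y"
    proof (cases q)
      case (Suc q')
      then have *: "?n - m + q' = p - 1" using p_bounds by simp
      have "?X = (wedge_power beta0 (?n - m) \<and>\<^sub>E theta (z - a)) \<and>\<^sub>E wedge_power beta0 (q - 1)"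
        by (simp only: wedge_assoc)
      also have "\<dots> = (theta (z - a) \<and>\<^sub>E wedge_power beta0 (?n - m)) \<and>\<^sub>E wedge_power beta0 (q - 1)"
        by (simp only: wedge_commute[OF bidegree_even[OF bidegree_theta], symmetric])
      also have "\<dots> = ?Y"
        by (simp only: wedge_assoc wedge_power_add Suc diff_Suc_1 *)
      finally show ?thesis by (simp only:)
    qed simp
    have "of_nat q *s (complex_of_real (g z) *s ?X) = complex_of_real (g z) *s (of_nat q *s ?X)"
      by (simp only: vector_smult_assoc mult.commute)
    also have "\<dots> = (of_nat q * complex_of_real (g z)) *s ?Y"
      unfolding XY by (simp only: vector_smult_assoc mult.commute)
    finally show "beta_power (?n - m) z \<and>\<^sub>E \<alpha> z = complex_of_real (f z) *s wedge_power beta0 p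
      + (of_nat q * complex_of_real (g z)) *s ?Y"
      unfolding \<alpha>_def beta_power_eq wedge_add_right wedge_scale_right wedge_power_add p_bounds(3) by (simp only:)
  qed
  ultimately show ?thesis by (simp only:)
qed

section \<open>The trace measure\<close>

definition trace :: "('n cspace \<Rightarrow> real) \<Rightarrow> complex" where
  "trace f = T (\<lambda>z. complex_of_real (f z) *s wedge_power beta0 p)"

lemma trace_form: "f \<in> test_functions \<Omega> \<Longrightarrow> (\<lambda>z. complex_of_real (f z) *s wedge_power beta0 p) \<in> test_forms \<Omega> p p"
  by (intro test_forms_smult smooth_const bidegree_wedge_power bidegree_beta0)

lemma trace_add:
  assumes "f \<in> test_functions \<Omega>" "g \<in> test_functions \<Omega>"
  shows "trace (\<lambda>z. f z + g z) = trace f + trace g"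
  using T_add[OF trace_form[OF assms(1)] trace_form[OF assms(2)]]
  by (simp add: trace_def vector_sadd_rdistrib)

lemma trace_cmul: "f \<in> test_functions \<Omega> \<Longrightarrow> trace (\<lambda>z. c * f z) = complex_of_real c * trace f"
  using T_scale[OF trace_form, of f "complex_of_real c"]
  by (simp add: trace_def vector_smult_assoc)

text \<open>The case s = 0 of \<open>T_nonneg_radial\<close>: \<beta> itself is m-positive.\<close>

lemma trace_nonneg:
  assumes "f \<in> test_functions \<Omega>" "\<And>z. f z \<ge> 0"
  shows "trace f \<in> \<real>\<^sub>\<ge>\<^sub>0"
  using T_nonneg_radial[OF assms test_functions_zero, of "\<lambda>z. 0" 0]
  by (simp add: trace_def)

text \<open>A test function is the difference of two nonnegative ones, f + B \<eta> and B \<eta>, on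
  which the value is real by positivity.\<close>

lemma trace_real:
  assumes "f \<in> test_functions \<Omega>"
  shows "Im (trace f) = 0"
proof -
  obtain K where K: "compact K" "K \<subseteq> \<Omega>" "\<And>x. x \<notin> K \<Longrightarrow> f x = 0"
    using assms unfolding test_functions_def by blast
  obtain B where B: "B > 0" "\<And>x. \<bar>f x\<bar> \<le> B"
    using test_functions_bounded[OF assms] by blast
  obtain \<eta> V where \<eta>: "\<eta> \<in> test_functions \<Omega>" "\<And>x. 0 \<le> \<eta> x" "\<And>x. \<eta> x \<le> 1"
    "open V" "K \<subseteq> V" "\<And>x. x \<in> V \<Longrightarrow> \<eta> x = 1"
    using smooth_urysohn[OF K(1) open_domain K(2)] by blast
  have B\<eta>: "(\<lambda>x. B * \<eta> x) \<in> test_functions \<Omega>" by (rule test_functions_cmul[OF \<eta>(1)])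
  have "0 \<le> f x + B * \<eta> x" for x
  proof (cases "x \<in> K")
    case True
    then show ?thesis using B(2)[of x] \<eta>(5,6) by auto
  qed (use K(3) B(1) \<eta>(2) in auto)
  then have "trace (\<lambda>x. f x + B * \<eta> x) \<in> \<real>\<^sub>\<ge>\<^sub>0"
    by (rule trace_nonneg[OF test_functions_add[OF assms B\<eta>]])
  moreover have "trace (\<lambda>x. B * \<eta> x) \<in> \<real>\<^sub>\<ge>\<^sub>0"
    using B(1) \<eta>(2) by (intro trace_nonneg B\<eta>) simp
  ultimately show ?thesis
    unfolding trace_add[OF assms B\<eta>] by (auto simp: complex_nonneg_Reals_iff)
qed

lemma trace_functional: "positive_functional \<Omega> (\<lambda>f. Re (trace f))"
  by unfold_locales (use open_domain trace_nonneg in \<open>auto simp: trace_add trace_cmul complex_nonneg_Reals_iff\<close>)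

text \<open>\<open>current_measure\<close> is a definite description, so the mass of a ball means
  something only once both existence and uniqueness are known. Complex test functions are split into
  real and imaginary parts.\<close>

lemma represents_ex1: "\<exists>!M. represents \<Omega> (current_wedge T (beta_power p)) M"
proof -
  interpret positive_functional \<Omega> "\<lambda>f. Re (trace f)" by (rule trace_functional)
  let ?S = "current_wedge T (beta_power p)"
  show ?thesis
  proof (rule ex_ex1I)
    have "represents \<Omega> ?S riesz_measure"
      unfolding represents_def
    proof (intro conjI allI impI ballI)
      fix \<phi> assume \<phi>: "\<phi> \<in> test_forms \<Omega> 0 0"
      define u where "u = (\<lambda>z. Re (\<phi> z $ ({}, {})))"
      define v where "v = (\<lambda>z. Im (\<phi> z $ ({}, {})))"
      have uv: "u \<in> test_functions \<Omega>" "v \<in> test_functions \<Omega>"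
        unfolding u_def v_def by (rule test_forms_0_0[OF \<phi>])+
      have c: "\<phi> z $ ({}, {}) = complex_of_real (u z) + \<i> * complex_of_real (v z)" for z
        by (simp add: u_def v_def complex_eq_iff)
      have "beta_power p z \<and>\<^sub>E \<phi> z = complex_of_real (u z) *s wedge_power beta0 p
          + \<i> *s (complex_of_real (v z) *s wedge_power beta0 p)" for z
        by (subst test_forms_0_0(1)[OF \<phi>])
          (simp add: beta_power_eq wedge_ext_scalar_right c vector_sadd_rdistrib vector_smult_assoc)
      then have "?S \<phi> = trace u + \<i> * trace v"
        unfolding current_wedge_def trace_def
        using T_add[OF trace_form[OF uv(1)] test_forms_scale[OF trace_form[OF uv(2)], of "\<i>"]]
          T_scale[OF trace_form[OF uv(2)], of "\<i>"] by (simp only:)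
      also have "\<dots> = complex_of_real (\<integral>z. u z \<partial>riesz_measure) + \<i> * complex_of_real (\<integral>z. v z \<partial>riesz_measure)"
        unfolding riesz_representation[OF uv(1), symmetric] riesz_representation[OF uv(2), symmetric]
        using trace_real[OF uv(1)] trace_real[OF uv(2)] by (simp add: complex_eq_iff)
      also have "\<dots> = (\<integral>z. complex_of_real (u z) + \<i> * complex_of_real (v z) \<partial>riesz_measure)"
      proof -
        note * = integrable_test_function[OF sets_riesz_measure open_domain emeasure_riesz_measure_compact]
        show ?thesis
          using *[OF _ _ uv(1)] *[OF _ _ uv(2)] by (subst Bochner_Integration.integral_add) auto
      qed
      finally show "?S \<phi> = (\<integral>z. \<phi> z $ ({}, {}) \<partial>riesz_measure)" by (simp add: c)
    qed (simp_all add: sets_riesz_measure emeasure_riesz_measure_compact[simplified])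
    then show "\<exists>M. represents \<Omega> ?S M" by blast
    fix M N assume MN: "represents \<Omega> ?S M" "represents \<Omega> ?S N"
    show "M = N"
    proof (rule measure_eqI_test_functions[OF open_domain])
      fix u :: "'n cspace \<Rightarrow> real" assume "u \<in> test_functions \<Omega>"
      from represents_test_function[OF MN(1) this] represents_test_function[OF MN(2) this]
      show "(\<integral>x. u x \<partial>M) = (\<integral>x. u x \<partial>N)" by (metis of_real_eq_iff)
    qed (rule representsD[OF MN(1)] representsD[OF MN(2)]; assumption?)+
  qed
qed

lemma trace_eq_integral:
  assumes "represents \<Omega> (current_wedge T (beta_power p)) M" "u \<in> test_functions \<Omega>"
  shows "trace u = complex_of_real (\<integral>z. u z \<partial>M)"
  using represents_test_function[OF assms]
  by (simp add: current_wedge_def trace_def beta_power_eq wedge_scale_right wedge_ext_scalar_right)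

end

subsection \<open>Monotonicity of the normalized mass\<close>

lemma radial_test_function:
  fixes a :: "'a::euclidean_space"
  assumes "smooth h" "\<And>t. t \<ge> y \<Longrightarrow> h t = 0" "0 \<le> R" "cball a R \<subseteq> \<Omega>" "y \<le> R\<^sup>2"
  shows "(\<lambda>z. h ((norm (z - a))\<^sup>2)) \<in> test_functions \<Omega>"
proof -
  have "h ((norm (z - a))\<^sup>2) = 0" if "z \<notin> cball a R" for z
  proof -
    have "R\<^sup>2 \<le> (norm (z - a))\<^sup>2"
      using that assms(3) by (intro power_mono) (auto simp: dist_norm norm_minus_commute)
    then show ?thesis using assms(2,5) by simp
  qed
  then show ?thesis
    using assms(4) smooth_compose[OF assms(1) smooth_norm_squared]
    by (auto simp: test_functions_def intro!: exI[of _ "cball a R"])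
qed

lemma (in positive_current) radial_inequality:
  assumes M: "represents \<Omega> (current_wedge T (beta_power p)) M"
    and N: "represents \<Omega> (current_wedge (current_ddc T) (beta_power (p - 1))) N"
    and R: "0 \<le> R" "cball a R \<subseteq> \<Omega>" "y \<le> R\<^sup>2" and x: "0 \<le> x"
    and h: "smooth h" "\<And>t. h t \<ge> 0" "\<And>t. t \<le> x \<Longrightarrow> h t = 0" "\<And>t. t \<ge> y \<Longrightarrow> h t = 0"
  shows "real q * real CARD('n) / real m * (\<integral>z. integral {(norm (z - a))\<^sup>2..y+1} h \<partial>M)
    \<le> (\<integral>z. (norm (z - a))\<^sup>2 * h ((norm (z - a))\<^sup>2) \<partial>M)"
proof -
  define H where "H = (\<lambda>t. integral {t..y+1} h)"
  \<comment> \<open>The g of the overview: G' = -H and G'' = h. As a tail integral of H \<ge> 0 it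
    is nonnegative and vanishes for t \<ge> y.\<close>
  define G where "G = (\<lambda>t. integral {t..y+1} H)"
  have H: "smooth H" "\<And>t. t \<ge> y \<Longrightarrow> H t = 0" "\<And>t. H t \<ge> 0"
    unfolding H_def using h smooth_continuous_on[OF h(1)]
    by (simp_all add: smooth_tail_integral tail_integral_eq_0 tail_integral_nonneg)
  have G: "smooth G" "\<And>t. t \<ge> y \<Longrightarrow> G t = 0" "\<And>t. G t \<ge> 0"
    unfolding G_def using H smooth_continuous_on[OF H(1)]
    by (simp_all add: smooth_tail_integral tail_integral_eq_0 tail_integral_nonneg)
  have dH: "(H has_real_derivative - h t) (at t)" for t
    unfolding H_def by (rule tail_integral_deriv) (use h smooth_continuous_on in auto)
  have dG: "(G has_real_derivative - H t) (at t)" for t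
    unfolding G_def by (rule tail_integral_deriv) (use H smooth_continuous_on in auto)
  have dH': "((\<lambda>t. - H t) has_real_derivative h t) (at t)" for t
    using DERIV_minus[OF dH[of t]] by simp
  let ?t = "\<lambda>z. (norm (z - a))\<^sup>2"
  have ht: "(\<lambda>z. h (?t z)) \<in> test_functions \<Omega>" by (rule radial_test_function[OF h(1,4) R])
  have Ht: "(\<lambda>z. H (?t z)) \<in> test_functions \<Omega>" by (rule radial_test_function[OF H(1,2) R])
  have Gt: "(\<lambda>z. G (?t z)) \<in> test_functions \<Omega>" by (rule radial_test_function[OF G(1,2) R])
  have ft: "(\<lambda>z. ?t z * h (?t z)) \<in> test_functions \<Omega>"
    by (rule test_functions_mult[OF ht smooth_norm_squared])
  let ?\<theta> = "\<lambda>z. theta (z - a) \<and>\<^sub>E wedge_power beta0 (p - 1)"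
  define B where "B = (\<lambda>z. complex_of_real (h (?t z)) *s ?\<theta> z)"
  have "bidegree (1 + (p - 1)) (1 + (p - 1)) (?\<theta> z)" for z
    by (intro bidegree_wedge bidegree_theta bidegree_wedge_power bidegree_beta0)
  then have B: "B \<in> test_forms \<Omega> p p"
    unfolding B_def using p_bounds(4)
    by (intro test_forms_smult ht smooth_linear_compose[OF bounded_linear_wedge_left smooth_theta]) simp
  have bp: "(beta0 :: 'n ext) \<and>\<^sub>E wedge_power beta0 (p - 1) = wedge_power beta0 p"
    using p_bounds(4) wedge_power_Suc[of "beta0 :: 'n ext" "p - 1"] by simp
  have "complex_of_real (\<integral>z. G (?t z) \<partial>N)
      = current_wedge (current_ddc T) (beta_power (p - 1)) (\<lambda>z. complex_of_real (G (?t z)) *s ext_scalar 1)"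
    by (rule represents_test_function[OF N Gt, symmetric])
  also have "\<dots> = T (ddc (\<lambda>z. complex_of_real (G (?t z)) *s wedge_power beta0 (p - 1)))"
    unfolding current_wedge_def current_ddc_def beta_power_eq wedge_scale_right wedge_ext_scalar_right vector_smult_lid ..
  also have "ddc (\<lambda>z. complex_of_real (G (?t z)) *s wedge_power beta0 (p - 1))
      = (\<lambda>z. (-1) *s (complex_of_real (H (?t z)) *s wedge_power beta0 p) + B z)"
    by (rule ext) (simp add: ddc_radial[OF dG dH'] B_def bp vec_eq_iff del: One_nat_def)
  also have "T \<dots> = (-1) * trace (\<lambda>z. H (?t z)) + T B"
    unfolding trace_def T_scale[OF trace_form[OF Ht], symmetric]
    by (rule T_add[OF test_forms_scale[OF trace_form[OF Ht]] B])
  \<comment> \<open>The \<theta>-term exceeds the integral of H against T \<and> \<beta>^p by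
    exactly the integral of G against dd^c T \<and> \<beta>^(p-1).\<close>
  finally have TB: "T B = complex_of_real ((\<integral>z. G (?t z) \<partial>N) + (\<integral>z. H (?t z) \<partial>M))"
    unfolding trace_eq_integral[OF M Ht] by simp
  let ?e = "real CARD('n) / real m"
  \<comment> \<open>The extreme admissible value from \<open>m_positive_11_radial\<close>. At z = a
    the division by zero makes it 0, which does no harm because \<open>h\<close> vanishes
    there.\<close>
  define s where "s = (\<lambda>z. - (?e / ?t z))"
  have "T (\<lambda>z. complex_of_real (?t z * h (?t z)) *s wedge_power beta0 p
      + (of_nat q * complex_of_real (- ?e * h (?t z))) *s ?\<theta> z) \<in> \<real>\<^sub>\<ge>\<^sub>0"
  proof (rule T_nonneg_radial[where s=s])
    show "(\<lambda>z. ?t z * h (?t z)) \<in> test_functions \<Omega>" by (rule ft)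
    show "0 \<le> ?t z * h (?t z)" for z using h(2) by simp
    show "(\<lambda>z. - ?e * h (?t z)) \<in> test_functions \<Omega>" by (rule test_functions_cmul[OF ht])
    show "?t z * h (?t z) * s z = - ?e * h (?t z)" for z
      using h(3)[of 0] x by (cases "z = a") (simp_all add: s_def)
    show "s z \<le> 0" for z by (simp add: s_def)
    show "- s z * ?t z * real m \<le> real CARD('n)" for z
      using m(1) by (cases "z = a") (simp_all add: s_def)
  qed
  also have "(\<lambda>z. complex_of_real (?t z * h (?t z)) *s wedge_power beta0 p
      + (of_nat q * complex_of_real (- ?e * h (?t z))) *s ?\<theta> z)
     = (\<lambda>z. complex_of_real (?t z * h (?t z)) *s wedge_power beta0 p
      + (of_nat q * complex_of_real (- ?e)) *s B z)"
    unfolding B_def vector_smult_assoc of_real_mult mult.assoc ..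
  also have "T \<dots> = trace (\<lambda>z. ?t z * h (?t z)) + (of_nat q * complex_of_real (- ?e)) * T B"
    unfolding trace_def T_scale[OF B, symmetric]
    by (rule T_add[OF trace_form[OF ft] test_forms_scale[OF B]])
  also have "\<dots> = complex_of_real ((\<integral>z. ?t z * h (?t z) \<partial>M)
      - real q * ?e * ((\<integral>z. G (?t z) \<partial>N) + (\<integral>z. H (?t z) \<partial>M)))"
    unfolding trace_eq_integral[OF M ft] TB by simp
  finally have "0 \<le> (\<integral>z. ?t z * h (?t z) \<partial>M) - real q * ?e * ((\<integral>z. G (?t z) \<partial>N) + (\<integral>z. H (?t z) \<partial>M))"
    by (simp only: complex_nonneg_Reals_iff Re_complex_of_real)
  \<comment> \<open>Here the sign of dd^c T \<and> \<beta>^(p-1) enters: its contribution is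
    nonnegative and is dropped.\<close>
  moreover have "0 \<le> (\<integral>z. G (?t z) \<partial>N)" using G(3) by simp
  then have "real q * ?e * (\<integral>z. H (?t z) \<partial>M) \<le> real q * ?e * ((\<integral>z. G (?t z) \<partial>N) + (\<integral>z. H (?t z) \<partial>M))"
    by (intro mult_left_mono) auto
  ultimately show ?thesis unfolding H_def by simp
qed

text \<open>The loss caused by smoothing the indicator of (x, y) is put into a factor c < 1, so no
  limit of integrals is needed. Pointwise, H is at least c (y - x) on the smaller ball, and t h(t)
  is at most y between the two balls and 0 elsewhere.\<close>

lemma (in positive_current) mass_inequality:
  assumes M: "represents \<Omega> (current_wedge T (beta_power p)) M"
    and N: "represents \<Omega> (current_wedge (current_ddc T) (beta_power (p - 1))) N"
    and R: "0 \<le> R" "cball a R \<subseteq> \<Omega>" and xy: "0 < x" "x < y" "y \<le> R\<^sup>2"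
  shows "real q * real CARD('n) / real m * (y - x) * measure M (ball a (sqrt x))
    \<le> y * (measure M (ball a (sqrt y)) - measure M (ball a (sqrt x)))"
proof (rule field_le_mult_one_interval)
  fix c :: real assume c: "0 < c" "c < 1"
  \<comment> \<open>Chosen so that the plateau [x + d, y - d] of \<open>h\<close> has length c (y -
    x).\<close>
  define d where "d = (1 - c) * (y - x) / 2"
  have "0 < (1 - c) * (y - x)" using c xy by simp
  then have "d > 0" by (simp add: d_def)
  moreover have "2 * d = (1 - c) * (y - x)" by (simp add: d_def)
  ultimately have d: "d > 0" "c * (y - x) = y - x - 2 * d" by (simp_all add: algebra_simps)
  have d2: "x + d \<le> y - d"
    using d(2) mult_pos_pos[of c "y - x"] c xy by linarith
  \<comment> \<open>One step rises on [x, x + d], the other falls on [y - d, y].\<close>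
  define h where "h = (\<lambda>t. smooth_step ((1/d) * t + - x/d) * smooth_step ((-1/d) * t + y/d))"
  have h: "smooth h" "\<And>t. h t \<ge> 0" "\<And>t. h t \<le> 1"
    unfolding h_def
    by (rule smooth_mult[OF smooth_compose[OF smooth_step(1) smooth_affine] smooth_compose[OF smooth_step(1) smooth_affine]])
      (simp_all add: smooth_step mult_le_one)
  have h0: "h t = 0" if "t \<le> x \<or> t \<ge> y" for t
    using that d(1) by (auto simp: h_def smooth_step field_simps)
  have h1: "h t = 1" if "x + d \<le> t" "t \<le> y - d" for t
    using that d(1) by (simp add: h_def smooth_step field_simps)
  let ?t = "\<lambda>z. (norm (z - a))\<^sup>2"
  define H where "H = (\<lambda>t. integral {t..y+1} h)"
  have H: "smooth H" "\<And>t. t \<ge> y \<Longrightarrow> H t = 0" "\<And>t. H t \<ge> 0"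
    unfolding H_def using h h0 smooth_continuous_on[OF h(1)]
    by (simp_all add: smooth_tail_integral tail_integral_eq_0 tail_integral_nonneg)
  have Hx: "y - x - 2 * d \<le> H t" if "t \<le> x" for t
  proof -
    have int: "h integrable_on {l..r}" for l r
      using smooth_continuous_on[OF h(1)] by (rule integrable_continuous_interval)
    have "integral {x + d..y - d} h = integral {x + d..y - d} (\<lambda>_. 1)"
      by (rule integral_cong) (simp add: h1)
    moreover have "integral {x + d..y - d} h \<le> integral {t..y+1} h"
      using that d by (intro integral_subset_le int) (auto simp: h)
    ultimately show ?thesis using d2 by (simp add: H_def)
  qed
  have ball: "z \<in> ball a (sqrt r) \<longleftrightarrow> ?t z < r" for z r
    using real_sqrt_less_iff[of "?t z" r] by (simp add: dist_norm norm_minus_commute)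
  note sets_M = representsD(1)[OF M] and fin = representsD(2)[OF M]
  have sq: "sqrt y \<le> R" using real_sqrt_le_mono[OF xy(3)] R(1) by simp
  have Bsets: "ball a (sqrt r) \<in> sets M" "integrable M (indicat_real (ball a (sqrt r)))" if "r \<le> y" for r
  proof -
    have "sqrt r \<le> R" using sq real_sqrt_le_mono[OF that] by linarith
    then have sub: "ball a (sqrt r) \<subseteq> cball a R" by auto
    show s: "ball a (sqrt r) \<in> sets M"
      unfolding sets_M using sub R(2) open_domain by (simp add: sets_restrict_space_iff)
    have "cball a R \<in> sets M"
      unfolding sets_M using R(2) open_domain by (simp add: sets_restrict_space_iff)
    then have "emeasure M (ball a (sqrt r)) \<le> emeasure M (cball a R)"
      using sub by (rule emeasure_mono[rotated])
    also have "\<dots> < \<infinity>" by (rule fin[OF compact_cball R(2)])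
    finally show "integrable M (indicat_real (ball a (sqrt r)))"
      using s by (simp add: integrable_indicator_iff)
  qed
  have intg: "integrable M u" if "u \<in> test_functions \<Omega>" for u
    by (rule integrable_test_function[OF sets_M open_domain fin that])
  have Ht: "(\<lambda>z. H (?t z)) \<in> test_functions \<Omega>" by (rule radial_test_function[OF H(1,2) R xy(3)])
  have ht: "(\<lambda>z. h (?t z)) \<in> test_functions \<Omega>"
    by (rule radial_test_function[OF h(1) _ R xy(3)]) (simp add: h0)
  have ft: "(\<lambda>z. ?t z * h (?t z)) \<in> test_functions \<Omega>"
    by (rule test_functions_mult[OF ht smooth_norm_squared])
  let ?e = "real q * real CARD('n) / real m"
  have "(y - x - 2 * d) * measure M (ball a (sqrt x)) = (\<integral>z. (y - x - 2 * d) * indicat_real (ball a (sqrt x)) z \<partial>M)"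
    using Bsets(1)[of x] xy by simp
  also have "\<dots> \<le> (\<integral>z. H (?t z) \<partial>M)"
  proof (rule integral_mono)
    show "integrable M (\<lambda>z. (y - x - 2 * d) * indicat_real (ball a (sqrt x)) z)"
      using Bsets(2)[of x] xy by simp
    show "integrable M (\<lambda>z. H (?t z))" by (rule intg[OF Ht])
    show "(y - x - 2 * d) * indicat_real (ball a (sqrt x)) z \<le> H (?t z)" for z
      using Hx[of "?t z"] H(3) ball[of z x] by (cases "z \<in> ball a (sqrt x)") auto
  qed
  finally have "?e * ((y - x - 2 * d) * measure M (ball a (sqrt x))) \<le> ?e * (\<integral>z. H (?t z) \<partial>M)"
    by (rule mult_left_mono) simp
  also have "?e * (\<integral>z. H (?t z) \<partial>M) \<le> (\<integral>z. ?t z * h (?t z) \<partial>M)"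
    unfolding H_def by (rule radial_inequality[OF M N R xy(3) less_imp_le[OF xy(1)] h(1,2)]) (simp_all add: h0)
  also have "\<dots> \<le> (\<integral>z. y * (indicat_real (ball a (sqrt y)) z - indicat_real (ball a (sqrt x)) z) \<partial>M)"
  proof (rule integral_mono)
    show "integrable M (\<lambda>z. ?t z * h (?t z))" by (rule intg[OF ft])
    show "integrable M (\<lambda>z. y * (indicat_real (ball a (sqrt y)) z - indicat_real (ball a (sqrt x)) z))"
      using Bsets(2)[of x] Bsets(2)[of y] xy by simp
    show "?t z * h (?t z) \<le> y * (indicat_real (ball a (sqrt y)) z - indicat_real (ball a (sqrt x)) z)" for z
    proof -
      consider "?t z < x" | "x \<le> ?t z" "?t z < y" | "y \<le> ?t z" by linarith
      then show ?thesis
      proof cases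
        case 1
        then show ?thesis using ball[of z x] ball[of z y] xy h0[of "?t z"] by (simp add: indicator_def)
      next
        case 2
        then have "?t z * h (?t z) \<le> y * 1" using h xy by (intro mult_mono) auto
        then show ?thesis using 2 ball[of z x] ball[of z y] by (simp add: indicator_def)
      next
        case 3
        then show ?thesis using ball[of z x] ball[of z y] xy h0[of "?t z"] by (simp add: indicator_def)
      qed
    qed
  qed
  also have "\<dots> = y * (measure M (ball a (sqrt y)) - measure M (ball a (sqrt x)))"
    using Bsets[of x] Bsets[of y] xy by simp
  finally show "c * (?e * (y - x) * measure M (ball a (sqrt x)))
      \<le> y * (measure M (ball a (sqrt y)) - measure M (ball a (sqrt x)))"
    unfolding d(2)[symmetric] by (simp only: mult_ac)
qed

section \<open>From the growth inequality to the limit\<close>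

lemma power_growth_limit:
  fixes c e :: real
  assumes "c > 1" "e \<ge> 0"
  shows "(\<lambda>N. (1 + e * (1 - 1 / c powr (1 / real N))) ^ N) \<longlonglongrightarrow> c powr e"
proof -
  \<comment> \<open>With u = ln c / N the N-th power is exp(ln c * f(u)/u). Since f(0) = 0, the
    quotient f(u)/u tends to f'(0) = e.\<close>
  define f where "f = (\<lambda>u. ln (1 + e * (1 - exp (- u))))"
  define u where "u = (\<lambda>N. ln c / real N)"
  have L: "ln c > 0" using assms(1) by simp
  have "(f has_real_derivative e) (at 0)"
    unfolding f_def by (auto intro!: derivative_eq_intros)
  then have d: "((\<lambda>h. f h / h) \<longlongrightarrow> e) (at 0)"
    by (simp add: DERIV_def f_def)
  have "u \<longlonglongrightarrow> 0"
    unfolding u_def by (rule lim_const_over_n)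
  moreover have "eventually (\<lambda>N. u N \<noteq> 0) sequentially"
    using eventually_gt_at_top[of 0] by eventually_elim (use L in \<open>simp add: u_def\<close>)
  ultimately have "filterlim u (at 0) sequentially"
    by (intro filterlim_atI) auto
  from filterlim_compose[OF d this]
  have "(\<lambda>N. exp (ln c * (f (u N) / u N))) \<longlonglongrightarrow> exp (ln c * e)"
    by (intro tendsto_intros)
  moreover have "eventually (\<lambda>N. exp (ln c * (f (u N) / u N)) = (1 + e * (1 - 1 / c powr (1 / real N))) ^ N) sequentially"
    using eventually_gt_at_top[of 0]
  proof eventually_elim
    case (elim N)
    have eq: "1 / c powr (1 / real N) = exp (- u N)"
      using assms(1) by (simp add: powr_def u_def exp_minus field_simps)
    have "u N \<ge> 0" using L by (simp add: u_def)
    then have "1 + e * (1 - exp (- u N)) > 0"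
      using assms(2) by (intro add_pos_nonneg mult_nonneg_nonneg) auto
    then have "exp (real N * f (u N)) = (1 + e * (1 - exp (- u N))) ^ N"
      unfolding f_def exp_of_nat_mult by simp
    moreover have "ln c * (f (u N) / u N) = real N * f (u N)"
      using elim L by (simp add: u_def)
    ultimately show ?case unfolding eq by simp
  qed
  ultimately have "(\<lambda>N. (1 + e * (1 - 1 / c powr (1 / real N))) ^ N) \<longlonglongrightarrow> exp (ln c * e)"
    by (rule Lim_transform_eventually)
  then show ?thesis using assms(1) by (simp add: powr_def mult.commute)
qed

text \<open>
  The hypothesis is a discrete form of \<open>x G' \<ge> e G\<close>; iterating it along a geometric progression
  from \<open>x\<close> to \<open>y\<close> with \<open>N\<close> steps and letting \<open>N \<rightarrow> \<infinity>\<close> integrates it.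
\<close>

lemma growth_monotone:
  fixes G :: "real \<Rightarrow> real"
  assumes e: "e \<ge> 0" and G: "\<And>x. G x \<ge> 0"
    and step: "\<And>x y. 0 < x \<Longrightarrow> x < y \<Longrightarrow> y \<le> S \<Longrightarrow> e * (y - x) * G x \<le> y * (G y - G x)"
    and xy: "0 < x" "x < y" "y \<le> S"
  shows "G x / x powr e \<le> G y / y powr e"
proof -
  define c where "c = y / x"
  have c: "c > 1" using xy by (simp add: c_def)
  have "G x * (1 + e * (1 - 1 / c powr (1 / real N))) ^ N \<le> G y" if N: "N > 0" for N :: nat
  proof -
    \<comment> \<open>The ratio of the progression from x to y. Dividing the hypothesis for two
      neighbouring points by the larger one gives the gain 1 + e (1 - 1/\<rho>) per step.\<close>
    define \<rho> where "\<rho> = c powr (1 / real N)"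
    have \<rho>: "\<rho> > 1" unfolding \<rho>_def using c N by (simp add: gr_one_powr)
    have \<rho>N: "\<rho> ^ N = c"
      unfolding \<rho>_def using c N by (simp add: powr_realpow[symmetric] powr_powr)
    have "G x * (1 + e * (1 - 1 / \<rho>)) ^ k \<le> G (x * \<rho> ^ k)" if "k \<le> N" for k
      using that
    proof (induction k)
      case (Suc k)
      let ?x = "x * \<rho> ^ k"
      have x: "0 < ?x" "?x < ?x * \<rho>" using xy \<rho> by simp_all
      have "\<rho> ^ Suc k \<le> \<rho> ^ N" using Suc.prems \<rho> by (intro power_increasing) auto
      then have "?x * \<rho> \<le> y" using xy \<rho>N by (simp add: c_def field_simps)
      then have "e * (?x * \<rho> - ?x) * G ?x \<le> ?x * \<rho> * (G (?x * \<rho>) - G ?x)"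
        using x xy by (intro step) auto
      moreover have "?x * \<rho> * (G ?x * (1 + e * (1 - 1 / \<rho>))) = ?x * \<rho> * G ?x + e * (?x * \<rho> - ?x) * G ?x"
        using \<rho> by (simp add: field_simps)
      ultimately have "?x * \<rho> * (G ?x * (1 + e * (1 - 1 / \<rho>))) \<le> ?x * \<rho> * G (?x * \<rho>)"
        by (simp only: right_diff_distrib)
      moreover have "0 < ?x * \<rho>" using x by linarith
      ultimately have 1: "G ?x * (1 + e * (1 - 1 / \<rho>)) \<le> G (?x * \<rho>)"
        by (rule mult_left_le_imp_le)
      have "0 \<le> 1 + e * (1 - 1 / \<rho>)" using e \<rho> by simp
      then have "G x * (1 + e * (1 - 1 / \<rho>)) ^ k * (1 + e * (1 - 1 / \<rho>)) \<le> G ?x * (1 + e * (1 - 1 / \<rho>))"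
        using Suc by (intro mult_right_mono) auto
      then show ?case using 1 by (simp add: mult_ac)
    qed simp
    from this[of N] show ?thesis
      unfolding \<rho>N \<rho>_def[symmetric] using xy by (simp add: c_def)
  qed
  then have "eventually (\<lambda>N. G x * (1 + e * (1 - 1 / c powr (1 / real N))) ^ N \<le> G y) sequentially"
    by (rule eventually_mono[OF eventually_gt_at_top[of 0]])
  moreover have "(\<lambda>N. G x * (1 + e * (1 - 1 / c powr (1 / real N))) ^ N) \<longlonglongrightarrow> G x * c powr e"
    by (intro tendsto_mult tendsto_const power_growth_limit c e)
  ultimately have "G x * c powr e \<le> G y"
    using tendsto_upperbound trivial_limit_sequentially by blast
  then show ?thesis
    using xy by (simp add: c_def powr_divide field_simps)
qed

text \<open>The limit is the infimum over (0, R], finite because F \<ge> 0. Monotonicity is asked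
  for up to R only, the radius up to which closed balls stay in \<Omega>.\<close>

lemma monotone_limit_at_right:
  fixes F :: "real \<Rightarrow> real"
  assumes "R > 0" and mono: "\<And>r s. 0 < r \<Longrightarrow> r < s \<Longrightarrow> s \<le> R \<Longrightarrow> F r \<le> F s"
    and nonneg: "\<And>r. 0 \<le> F r"
  shows "\<exists>l. (F \<longlongrightarrow> l) (at_right 0)"
proof
  define l where "l = Inf (F ` {0<..R})"
  have bdd: "bdd_below (F ` {0<..R})" using nonneg by (intro bdd_belowI[of _ 0]) auto
  have ne: "F ` {0<..R} \<noteq> {}" using assms(1) by auto
  show "(F \<longlongrightarrow> l) (at_right 0)"
  proof (rule order_tendstoI)
    fix b assume "b < l"
    have "eventually (\<lambda>r. r \<in> {0<..<R}) (at_right 0)"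
      using assms(1) eventually_at_right_real by blast
    then show "eventually (\<lambda>r. b < F r) (at_right 0)"
    proof eventually_elim
      case (elim r)
      then have "l \<le> F r" unfolding l_def by (intro cInf_lower bdd) auto
      then show ?case using \<open>b < l\<close> by simp
    qed
  next
    fix b assume "l < b"
    then obtain s where s: "s \<in> {0<..R}" "F s < b"
      using cInf_lessD[OF ne] unfolding l_def by blast
    have "eventually (\<lambda>r. r \<in> {0<..<s}) (at_right 0)"
      using s eventually_at_right_real by auto
    then show "eventually (\<lambda>r. F r < b) (at_right 0)"
    proof eventually_elim
      case (elim r)
      then have "F r \<le> F s" using s by (intro mono) auto
      then show ?case using s by simp
    qed
  qed
qed

theorem theorem1:
  fixes \<Omega> :: "'n::{finite,linorder} cspace set"
    and T :: "'n current"
    and m p :: nat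
  assumes "1 \<le> m" and "m < CARD('n)"
    and "open \<Omega>"
    and "is_current \<Omega> p T"
    and "m + p \<ge> CARD('n)"
    and "m_positive_current \<Omega> m p T"
    and "is_positive_measure \<Omega> (current_wedge (current_ddc T) (beta_power (p - 1)))"
  shows "\<forall>a\<in>\<Omega>. \<exists>\<nu>::real.
           ((\<lambda>r. measure (current_measure \<Omega> (current_wedge T (beta_power p))) (ball a r)
                 / r powr (2 * real CARD('n) / real m * real (m + p - CARD('n))))
             \<longlongrightarrow> \<nu>) (at_right 0)"
proof
  fix a assume "a \<in> \<Omega>"
  define q where "q = m + p - CARD('n)"
  interpret positive_current \<Omega> T m p q
  proof
    show "m + p = CARD('n) + q" using assms(5) by (simp add: q_def)
  qed (rule assms)+
  define M where "M = current_measure \<Omega> (current_wedge T (beta_power p))"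
  have M: "represents \<Omega> (current_wedge T (beta_power p)) M"
    unfolding M_def current_measure_def by (rule theI'[OF represents_ex1])
  obtain N where N: "represents \<Omega> (current_wedge (current_ddc T) (beta_power (p - 1))) N"
    using assms(7) unfolding is_positive_measure_def by (elim exE)
  obtain R where R: "R > 0" "cball a R \<subseteq> \<Omega>"
    using \<open>a \<in> \<Omega>\<close> assms(3) open_contains_cball by blast
  define e where "e = real q * real CARD('n) / real m"
  define G where "G = (\<lambda>t. measure M (ball a (sqrt t)))"
  define F where "F = (\<lambda>r. measure M (ball a r) / r powr (2 * real CARD('n) / real m * real q))"
  \<comment> \<open>The growth estimate is in the squared radius, so the exponent e there becomes 2e
    in terms of r.\<close>
  have F: "F r = G (r\<^sup>2) / (r\<^sup>2) powr e" if "r > 0" for r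
  proof -
    have "r\<^sup>2 = r powr 2" using that by simp
    then have "(r\<^sup>2) powr e = r powr (2 * e)" by (simp only: powr_powr)
    moreover have "2 * e = 2 * real CARD('n) / real m * real q" by (simp add: e_def)
    moreover have "sqrt (r\<^sup>2) = r" using that by simp
    ultimately show ?thesis by (simp only: F_def G_def)
  qed
  have mono: "F r \<le> F s" if "0 < r" "r < s" "s \<le> R" for r s
  proof -
    have "G (r\<^sup>2) / (r\<^sup>2) powr e \<le> G (s\<^sup>2) / (s\<^sup>2) powr e"
    proof (rule growth_monotone[where S="R\<^sup>2"])
      show "e * (y - x) * G x \<le> y * (G y - G x)" if "0 < x" "x < y" "y \<le> R\<^sup>2" for x y
        unfolding e_def G_def by (rule mass_inequality[OF M N less_imp_le[OF R(1)] R(2) that])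
      show "r\<^sup>2 < s\<^sup>2" "s\<^sup>2 \<le> R\<^sup>2"
        using that by (simp_all add: power_strict_mono power_mono)
    qed (use that(1) in \<open>simp_all add: e_def G_def\<close>)
    then show ?thesis using F that by simp
  qed
  have nonneg: "0 \<le> F r" for r
    unfolding F_def by (intro divide_nonneg_nonneg measure_nonneg powr_ge_zero)
  have "\<exists>l. (F \<longlongrightarrow> l) (at_right 0)"
    by (rule monotone_limit_at_right[OF R(1) mono nonneg])
  then show "\<exists>\<nu>. ((\<lambda>r. measure (current_measure \<Omega> (current_wedge T (beta_power p))) (ball a r)
                 / r powr (2 * real CARD('n) / real m * real (m + p - CARD('n))))
             \<longlongrightarrow> \<nu>) (at_right 0)"
    unfolding F_def M_def q_def .
qed

end
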